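(* Fix $\epsilon,K'>0$ and $C>0$. Let $\xi$ be a complex random variable with $\mathbb{E}\xi=0$, $\mathbb{E}|\xi|^2=1$ and $\mathbb{E}|\xi|^{4+\epsilon}\le C$. Let $\tilde X$ be an $n\times n$ periodic block band matrix with atom variable $\xi$ and bandwidth $b_n$, let $m=n/b_n$, $c_n=3b_n$, $X=\tilde X/\sqrt{c_n}$, and assume $b_n\ge m\ge m_0$ where $m_0$ is a sufficiently large constant. Then for any $z\in\mathbb{C}$ with $|z|\le K'$, $$\mathbb{P}\big(s_n(X-zI)\le c_n^{-25m}\big)\le \frac{C_\xi}{\sqrt{c_n}},$$ where $C_\xi$ is a constant depending only on $\epsilon$, $C$ and $K'$.
   Context: Periodic block band matrix: let $b_n\ge 1$ divide $n$ and $m:=n/b_n$. Let $\tilde D_1,\tilde U_1,\tilde T_1,\dots,\tilde D_m,\tilde U_m,\tilde T_m$ be $3m$ independent $b_n\times b_n$ random matrices, each with iid entries distributed as $\xi$. $\tilde X$ is the $m\times m$ block matrix (blocks $b_n\times b_n$, block indices modulo $m$) with $(i,i)$ block $\tilde D_i$, $(i,i-1)$ block $\tilde T_{i-1}$, $(i,i+1)$ block $\tilde U_{i+1}$, all other blocks zero. For an $n\times n$ matrix $A$, $s_1(A)\ge\dots\ge s_n(A)\ge0$ are its singular values. *)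

theory Defs
  imports "HOL-Probability.Probability" "Jordan_Normal_Form.Schur_Decomposition"
begin

definition smallest_singular_value :: "complex mat \<Rightarrow> real" where
  "smallest_singular_value A =
     sqrt (Min {Re l | l. eigenvalue (mat_adjoint A * A) l})"

text \<open>Index set of the iid atom entries of the periodic block band matrix with m blocks of
  size b: the triple (k,a,c) is entry (a,c) of the k-th of the 3m independent blocks, where
  D_i = block 3i, U_i = block 3i+1, T_i = block 3i+2 (for i < m).\<close>
definition band_index :: "nat \<Rightarrow> nat \<Rightarrow> (nat \<times> nat \<times> nat) set" where
  "band_index m b = {..<3*m} \<times> {..<b} \<times> {..<b}"

text \<open>Entry (r,s) (0-based) of the (unnormalised) periodic block band matrix tilde X,
  n = m*b, blocks of size b, block indices modulo m:
  (I,I) block D_I, (I,I-1) block T_{I-1}, (I,I+1) block U_{I+1}.\<close>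
definition band_entry :: "nat \<Rightarrow> nat \<Rightarrow> (nat \<times> nat \<times> nat \<Rightarrow> complex) \<Rightarrow> nat \<Rightarrow> nat \<Rightarrow> complex" where
  "band_entry m b \<omega> r s =
     (let I = r div b; a = r mod b; J = s div b; c = s mod b in
      if J = I then \<omega> (3*I, a, c)
      else if J = (I + m - 1) mod m then \<omega> (3*J + 2, a, c)
      else if J = (I + 1) mod m then \<omega> (3*J + 1, a, c)
      else 0)"

definition band_matrix :: "nat \<Rightarrow> nat \<Rightarrow> (nat \<times> nat \<times> nat \<Rightarrow> complex) \<Rightarrow> complex mat" where
  "band_matrix m b \<omega> = mat (m*b) (m*b) (\<lambda>(r,s). band_entry m b \<omega> r s)"

end

theory Submission
  imports Defs "Jordan_Normal_Form.Spectral_Radius" "HOL-Real_Asymp.Real_Asymp"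
begin

text \<open>
  Let \<open>M = X' - z \<surd>c I\<close> with \<open>X'\<close> the unnormalised matrix. If \<open>M v\<close> is tiny and
  \<open>w\<close> is orthogonal to all columns of \<open>M\<close> but the \<open>k\<close>-th, then \<open>v\<^sub>k\<close> times the inner product of
  \<open>w\<close> with column \<open>k\<close> is tiny. The latter is a linear form in independent entries, so by
  Littlewood--Offord it is small with probability \<open>O(b\<^sup>-\<^sup>1\<^sup>/\<^sup>2)\<close> as soon as \<open>w\<close> has a positive
  proportion of large coordinates in the three blocks met by column \<open>k\<close>; if \<open>v\<close> is spread as well,
  one averages over the many \<open>k\<close> with \<open>v\<^sub>k\<close> large instead of taking a union bound.

  Both spreading statements reduce to one. A sparse vector on three consecutive blocks is
  almost never nearly annihilated by a block row, so three blocks that are not spread nearly vanish.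
  Reading the block equations as a recurrence, the pairs \<open>(x\<^sub>j, x\<^sub>j\<^sub>+\<^sub>1)\<close> then stay close to
  a space of dimension \<open>b div 2\<close>, independent of the next blocks: \<open>b\<close> equations on
  \<open>b div 2 + b\<close> unknowns are robustly solvable without inverting any square block, and
  losing only a power of \<open>b\<close> per block. The third vanishing block closes the cycle and forces
  the whole vector to nearly vanish.

  All anticoncentration for spaces comes from one device: a space is the graph of a matrix with
  coefficients of modulus at most \<open>1\<close> over suitable coordinates, so a random vector close to it is
  determined, up to a constant, by those coordinates.
\<close>


section \<open>Bounded row bases\<close>


text \<open>For a square \<open>b\<close> by \<open>b\<close> block the dimension count yields only
  the bound \<open>b * q\<close>, which says nothing; every spare row contributes a further factor
  \<open>q\<close>. This is why the recurrence carries a space of dimension \<open>b div 2\<close>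
  although its first two blocks nearly vanish and the zero space would contain them: injectivity on
  a \<open>d\<close>-dimensional space has \<open>b - d\<close> spare rows, solvability modulo its
  image has \<open>d\<close>, and \<open>d = b div 2\<close> makes both exponentially safe, so that
  a union over the blocks is affordable. The exponent 25: a forward step loses at most
  \<open>b ^ 10\<close>, a backward step \<open>b ^ 4\<close> but for two blocks at once, so the
  cycle costs \<open>b ^ (12 * m)\<close>. Large coordinates are thus only of size about
  \<open>1 / b ^ (12 * m)\<close>, and one of \<open>v\<close> is multiplied by those of
  \<open>w\<close>, which squares the scale; \<open>25 * m\<close> leaves room above
  \<open>24 * m\<close> for fixed powers. All failures but two are exponentially small in
  \<open>b\<close>. The rate is set by Littlewood--Offord and by truncating the entries at
  \<open>b powr (7 / 8)\<close>, whose cost under a fourth moment has the same order.\<close>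

lemma row_basis_exists:
  fixes U :: "'a \<Rightarrow> 'k \<Rightarrow> complex"
  assumes "finite K" "finite P" "card K \<le> card P"
  shows "\<exists>S L. S \<subseteq> P \<and> card S = card K \<and> (\<forall>i\<in>S. \<forall>l\<in>S. L i l = (if i = l then 1 else 0)) \<and>
    (\<forall>i\<in>P. \<forall>c\<in>K. U i c = (\<Sum>l\<in>S. L i l * U l c))"
  using assms
proof (induction K rule: finite_induct)
  case empty
  show ?case by (intro exI[of _ "{}"]) auto
next
  case (insert c K)
  have "card K \<le> card P" using insert by simp
  then obtain S L where SL: "S \<subseteq> P \<and> card S = card K \<and> (\<forall>i\<in>S. \<forall>l\<in>S. L i l = (if i = l then 1 else 0)) \<and>
    (\<forall>i\<in>P. \<forall>c\<in>K. U i c = (\<Sum>l\<in>S. L i l * U l c))" using insert.IH insert.prems by blast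
  then have S: "S \<subseteq> P" "card S = card K"
    and L1: "\<And>i l. i \<in> S \<Longrightarrow> l \<in> S \<Longrightarrow> L i l = (if i = l then 1 else 0)"
    and L2: "\<And>i c. i \<in> P \<Longrightarrow> c \<in> K \<Longrightarrow> U i c = (\<Sum>l\<in>S. L i l * U l c)"
    by simp_all
  have finS: "finite S" using S insert.prems finite_subset by auto
  define r where "r i = U i c - (\<Sum>l\<in>S. L i l * U l c)" for i
  have rS: "r i = 0" if "i \<in> S" for i
  proof -
    have "(\<Sum>l\<in>S. L i l * U l c) = (\<Sum>l\<in>S. if i = l then U l c else 0)"
      using that by (intro sum.cong) (auto simp: L1)
    then show ?thesis using that finS by (simp add: r_def)
  qed
  show ?case
  \<comment> \<open>Either some row has a nonzero residual in the new column and becomes the pivot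
    of an elimination step, or the column is already expressed and an arbitrary further row is
    added, so that \<open>S\<close> has exactly \<open>card K\<close> elements even for a
    rank-deficient \<open>U\<close>.\<close>
  proof (cases "\<exists>i0\<in>P. r i0 \<noteq> 0")
    case True
    then obtain i0 where i0: "i0 \<in> P" "r i0 \<noteq> 0" by auto
    then have i0S: "i0 \<notin> S" using rS by auto
    define L' where "L' i l = (if l = i0 then r i / r i0 else L i l - r i / r i0 * L i0 l)" for i l
    have id: "L' i l = (if i = l then 1 else 0)" if "i \<in> insert i0 S" "l \<in> insert i0 S" for i l
      using that i0 i0S rS by (auto simp: L'_def L1)
    have sum: "(\<Sum>l\<in>insert i0 S. L' i l * U l c') =
        r i / r i0 * (U i0 c' - (\<Sum>l\<in>S. L i0 l * U l c')) + (\<Sum>l\<in>S. L i l * U l c')" for i c'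
    proof -
      have "(\<Sum>l\<in>insert i0 S. L' i l * U l c') = r i / r i0 * U i0 c' + (\<Sum>l\<in>S. L' i l * U l c')"
        using finS i0S by (simp add: L'_def)
      also have "(\<Sum>l\<in>S. L' i l * U l c') = (\<Sum>l\<in>S. L i l * U l c' - r i / r i0 * (L i0 l * U l c'))"
        using i0S by (intro sum.cong) (auto simp: L'_def algebra_simps)
      also have "\<dots> = (\<Sum>l\<in>S. L i l * U l c') - r i / r i0 * (\<Sum>l\<in>S. L i0 l * U l c')"
        by (simp add: sum_subtractf sum_distrib_left)
      finally have e: "(\<Sum>l\<in>insert i0 S. L' i l * U l c') = r i / r i0 * U i0 c' +
        ((\<Sum>l\<in>S. L i l * U l c') - r i / r i0 * (\<Sum>l\<in>S. L i0 l * U l c'))" .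
      show ?thesis unfolding e by (simp only: algebra_simps)
    qed
    have "U i c' = (\<Sum>l\<in>insert i0 S. L' i l * U l c')" if "i \<in> P" "c' \<in> insert c K" for i c'
    proof (cases "c' = c")
      case True
      then show ?thesis using i0 by (simp only: sum r_def[of i0, symmetric]) (simp add: r_def)
    next
      case False
      then have "c' \<in> K" using that by auto
      then show ?thesis using that i0 L2 by (simp only: sum) simp
    qed
    moreover have "card (insert i0 S) = card (insert c K)" using i0S finS S insert by simp
    ultimately show ?thesis using S i0 id by (intro exI[of _ "insert i0 S"] exI[of _ L']) auto
  next
    case False
    have "card S < card P" using S insert by auto
    then obtain i0 where i0: "i0 \<in> P" "i0 \<notin> S"
      using S finS by (metis card_mono insert.prems(1) linorder_not_less subsetI)
    define L' where "L' i l = (if l = i0 then (if i = i0 then 1 else 0) else if i = i0 then 0 else L i l)" for i l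
    have id: "L' i l = (if i = l then 1 else 0)" if "i \<in> insert i0 S" "l \<in> insert i0 S" for i l
      using that i0 by (auto simp: L'_def L1)
    have "U i c' = (\<Sum>l\<in>insert i0 S. L' i l * U l c')" if "i \<in> P" "c' \<in> insert c K" for i c'
    proof -
      have "(\<Sum>l\<in>insert i0 S. L' i l * U l c') = (if i = i0 then U i c' else 0) + (\<Sum>l\<in>S. L' i l * U l c')"
        using finS i0 by (simp add: L'_def)
      also have "(\<Sum>l\<in>S. L' i l * U l c') = (if i = i0 then 0 else (\<Sum>l\<in>S. L i l * U l c'))"
        using i0 by (auto simp: L'_def intro!: sum.cong sum.neutral)
      also have "(\<Sum>l\<in>S. L i l * U l c') = U i c'"
        using that False L2 by (cases "c' = c") (auto simp: r_def)
      finally show ?thesis by auto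
    qed
    moreover have "card (insert i0 S) = card (insert c K)" using i0 finS S insert by simp
    ultimately show ?thesis using S i0 id by (intro exI[of _ "insert i0 S"] exI[of _ L']) auto
  qed
qed

text \<open>The rows of a largest minor express all other rows with coefficients of modulus at most 1,
  by Cramer's rule; this keeps the losses of the dimension counting polynomial.\<close>
lemma bounded_row_basis:
  fixes U :: "'a \<Rightarrow> 'k \<Rightarrow> complex"
  assumes "finite K" "finite P" "card K \<le> card P"
  obtains S L where "S \<subseteq> P" "card S = card K"
    "\<And>i l. i \<in> S \<Longrightarrow> l \<in> S \<Longrightarrow> L i l = (if i = l then 1 else 0)"
    "\<And>i l. i \<in> P \<Longrightarrow> l \<in> S \<Longrightarrow> cmod (L i l) \<le> 1"
    "\<And>i c. i \<in> P \<Longrightarrow> c \<in> K \<Longrightarrow> U i c = (\<Sum>l\<in>S. L i l * U l c)"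
proof -
  obtain S L where SL: "S \<subseteq> P \<and> card S = card K \<and> (\<forall>i\<in>S. \<forall>l\<in>S. L i l = (if i = l then 1 else 0)) \<and>
    (\<forall>i\<in>P. \<forall>c\<in>K. U i c = (\<Sum>l\<in>S. L i l * U l c))"
    using row_basis_exists[OF assms, of U] by blast
  then have S: "S \<subseteq> P" "card S = card K"
    and L1: "\<And>i l. i \<in> S \<Longrightarrow> l \<in> S \<Longrightarrow> L i l = (if i = l then 1 else 0)"
    and L2: "\<And>i c. i \<in> P \<Longrightarrow> c \<in> K \<Longrightarrow> U i c = (\<Sum>l\<in>S. L i l * U l c)"
    by simp_all
  have finS: "finite S" using S assms finite_subset by auto
  define k where "k = card S"
  obtain g where g: "bij_betw g {0..<k} S" unfolding k_def using ex_bij_betw_nat_finite[OF finS] by auto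
  \<comment> \<open>The minors are those of \<open>L\<close> and not of \<open>U\<close>: on
    \<open>S\<close> the matrix \<open>L\<close> is the identity, so some minor equals 1 and the
    largest one is nonzero even if \<open>U\<close> has smaller rank.\<close>
  define A where "A f = mat k k (\<lambda>(a,c). L (f a) (g c))" for f :: "nat \<Rightarrow> 'a"
  have A: "A f \<in> carrier_mat k k" for f by (simp add: A_def)
  define F where "F = ({0..<k} \<rightarrow>\<^sub>E P)"
  have finF: "finite F" unfolding F_def using assms by (intro finite_PiE) auto
  define g' where "g' = restrict g {0..<k}"
  have gS: "g a \<in> S" if "a < k" for a using g that by (auto simp: bij_betw_def)
  have ginj: "g a = g c \<longleftrightarrow> a = c" if "a < k" "c < k" for a c
    using g that by (auto simp: bij_betw_def inj_on_def)
  have g'F: "g' \<in> F" unfolding F_def g'_def using gS S by auto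
  have "A g' = 1\<^sub>m k" unfolding A_def g'_def
    by (rule eq_matI) (auto simp: L1 gS ginj)
  then have Dg: "cmod (det (A g')) = 1" by simp
  have "Max ((\<lambda>f. cmod (det (A f))) ` F) \<in> (\<lambda>f. cmod (det (A f))) ` F"
    using finF g'F by (intro Max_in) auto
  then obtain f where f: "f \<in> F" and "Max ((\<lambda>f. cmod (det (A f))) ` F) = cmod (det (A f))" by auto
  then have fmax: "cmod (det (A f')) \<le> cmod (det (A f))" if "f' \<in> F" for f'
    using finF that by (metis Max_ge finite_imageI imageI)
  have "det (A f) \<noteq> 0" using fmax[OF g'F] Dg by auto
  define At where "At = transpose_mat (A f)"
  have At: "At \<in> carrier_mat k k" using A by (simp add: At_def)
  have dAt: "det At = det (A f)" unfolding At_def using A det_transpose by blast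
  have nz: "det At \<noteq> 0" using \<open>det (A f) \<noteq> 0\<close> dAt by simp
  define x where "x i = (1 / det At) \<cdot>\<^sub>v (adj_mat At *\<^sub>v vec k (\<lambda>c. L i (g c)))" for i
  have adj: "adj_mat At \<in> carrier_mat k k" "At * adj_mat At = det At \<cdot>\<^sub>m 1\<^sub>m k"
    using adj_mat[OF At] by auto
  have xc: "x i \<in> carrier_vec k" for i
    by (rule carrier_vecI) (use adj(1) in \<open>simp add: x_def\<close>)
  have Ax: "At *\<^sub>v x i = vec k (\<lambda>c. L i (g c))" for i
  proof -
    let ?v = "vec k (\<lambda>c. L i (g c))"
    have v: "?v \<in> carrier_vec k" by auto
    have "At *\<^sub>v x i = (1 / det At) \<cdot>\<^sub>v (At *\<^sub>v (adj_mat At *\<^sub>v ?v))"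
      unfolding x_def by (rule mult_mat_vec[OF At]) (use adj in \<open>auto intro: mult_mat_vec_carrier\<close>)
    also have "At *\<^sub>v (adj_mat At *\<^sub>v ?v) = (At * adj_mat At) *\<^sub>v ?v"
      using assoc_mult_mat_vec[OF At adj(1) v] by simp
    also have "\<dots> = det At \<cdot>\<^sub>v ?v" unfolding adj(2) by (rule eq_vecI) auto
    finally show ?thesis using nz by (simp add: smult_smult_assoc)
  qed
  have bound: "cmod (x i $ a) \<le> 1" if i: "i \<in> P" and a: "a < k" for i a
  proof -
    have "f(a := i) \<in> F" using f i a by (auto simp: F_def PiE_iff extensional_def)
    have "replace_col At (At *\<^sub>v x i) a = transpose_mat (A (f(a := i)))"
      unfolding Ax by (rule eq_matI) (use At in \<open>auto simp: replace_col_def At_def A_def\<close>)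
    then have "det (replace_col At (At *\<^sub>v x i) a) = det (A (f(a := i)))"
      using A det_transpose by metis
    then have "x i $ a * det At = det (A (f(a := i)))"
      using cramer_lemma_mat[OF At xc a] by simp
    then have "cmod (x i $ a) * cmod (det (A f)) \<le> cmod (det (A f))"
      using fmax[OF \<open>f(a := i) \<in> F\<close>] dAt by (metis norm_mult)
    then show ?thesis using \<open>det (A f) \<noteq> 0\<close> by (simp add: mult_le_cancel_right1)
  qed
  have expand: "L i (g c) = (\<Sum>a\<in>{0..<k}. x i $ a * L (f a) (g c))" if "c < k" for i c
  proof -
    have "L i (g c) = (At *\<^sub>v x i) $ c" unfolding Ax using that by simp
    also have "\<dots> = (\<Sum>a\<in>{0..<k}. x i $ a * L (f a) (g c))"
      using At xc[of i] that by (auto simp: scalar_prod_def At_def A_def mult.commute intro!: sum.cong)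
    finally show ?thesis .
  qed
  have finj: "inj_on f {0..<k}"
  proof (rule inj_onI, rule ccontr)
    fix a c assume ac: "a \<in> {0..<k}" "c \<in> {0..<k}" "f a = f c" "a \<noteq> c"
    have "det (A f) = 0"
      using ac by (intro det_identical_rows[OF A, of a c]) (auto simp: A_def intro!: eq_vecI)
    then show False using \<open>det (A f) \<noteq> 0\<close> by simp
  qed
  define T where "T = f ` {0..<k}"
  have TP: "T \<subseteq> P" using f by (auto simp: T_def F_def)
  \<comment> \<open>Cramer's rule gives the coefficients off \<open>T\<close>; on \<open>T\<close>
    they are set to the identity directly.\<close>
  define M where "M i l = (if i \<in> T then (if i = l then 1 else 0) else x i $ (the_inv_into {0..<k} f l))" for i l
  have finT: "finite T" by (simp add: T_def)
  have Mrow: "L i j = (\<Sum>l\<in>T. M i l * L l j)" if "j \<in> S" for i j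
  proof (cases "i \<in> T")
    case True
    have "(\<Sum>l\<in>T. M i l * L l j) = (\<Sum>l\<in>T. if i = l then L l j else 0)"
      using True by (intro sum.cong) (auto simp: M_def)
    then show ?thesis using True finT by simp
  next
    case False
    obtain c where c: "c < k" "j = g c" using g \<open>j \<in> S\<close> by (auto simp: bij_betw_def)
    have "(\<Sum>l\<in>T. M i l * L l j) = (\<Sum>a\<in>{0..<k}. M i (f a) * L (f a) j)"
      unfolding T_def using finj by (simp add: sum.reindex)
    also have "\<dots> = (\<Sum>a\<in>{0..<k}. x i $ a * L (f a) (g c))"
    proof (rule sum.cong[OF refl])
      fix a assume a: "a \<in> {0..<k}"
      have "M i (f a) = x i $ a" unfolding M_def the_inv_into_f_f[OF finj a] using False by simp
      then show "M i (f a) * L (f a) j = x i $ a * L (f a) (g c)" using c(2) by simp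
    qed
    finally show ?thesis using expand[OF c(1), of i] unfolding c(2) by (rule trans[OF _ sym, rotated])
  qed
  show ?thesis
  proof (rule that[of T M])
    show "T \<subseteq> P" by (rule TP)
    show "card T = card K" unfolding T_def using finj S by (simp add: card_image k_def)
    show "M i l = (if i = l then 1 else 0)" if "i \<in> T" "l \<in> T" for i l using that by (simp add: M_def)
    show "cmod (M i l) \<le> 1" if "i \<in> P" "l \<in> T" for i l
    proof -
      obtain a where a: "a < k" "l = f a" using \<open>l \<in> T\<close> by (auto simp: T_def)
      then have "the_inv_into {0..<k} f l = a" using the_inv_into_f_f[OF finj] by simp
      then show ?thesis using bound[OF \<open>i \<in> P\<close> a(1)] by (auto simp: M_def)
    qed
    show "U i c = (\<Sum>l\<in>T. M i l * U l c)" if "i \<in> P" "c \<in> K" for i c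
    proof -
      have "U i c = (\<Sum>j\<in>S. (\<Sum>l\<in>T. M i l * L l j) * U j c)"
        unfolding L2[OF that] by (intro sum.cong refl arg_cong2[where f = "(*)"] Mrow)
      also have "\<dots> = (\<Sum>l\<in>T. M i l * (\<Sum>j\<in>S. L l j * U j c))"
        unfolding sum_distrib_left sum_distrib_right by (subst sum.swap) (simp add: mult.assoc)
      also have "\<dots> = (\<Sum>l\<in>T. M i l * U l c)" by (rule sum.cong[OF refl], subst L2[symmetric]) (use TP that in auto)
      finally show ?thesis .
    qed
  qed
qed

text \<open>The adjugate inverse, transported along enumerations to arbitrary finite index sets. The
  recurrence picks its rows and columns from sets of pairs and from a disjoint sum, so the index
  sets carry no order that a matrix type could use.\<close>

lemma square_inverse_exists:
  fixes A :: "'r \<Rightarrow> 'd \<Rightarrow> complex"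
  assumes fin: "finite R" "finite D" and card: "card R = card D"
    and inj: "\<And>t. (\<And>r. r \<in> R \<Longrightarrow> (\<Sum>d\<in>D. A r d * t d) = 0) \<Longrightarrow> \<forall>d\<in>D. t d = 0"
  shows "\<exists>N. (\<forall>d\<in>D. \<forall>d'\<in>D. (\<Sum>r\<in>R. N d r * A r d') = (if d = d' then 1 else 0)) \<and>
    (\<forall>r\<in>R. \<forall>r'\<in>R. (\<Sum>d\<in>D. A r d * N d r') = (if r = r' then 1 else 0))"
proof -
  define n where "n = card R"
  obtain g where g: "bij_betw g {0..<n} R" unfolding n_def using ex_bij_betw_nat_finite[OF fin(1)] by auto
  obtain h where h: "bij_betw h {0..<n} D" unfolding n_def card using ex_bij_betw_nat_finite[OF fin(2)] by auto
  define g' where "g' = the_inv_into {0..<n} g"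
  define h' where "h' = the_inv_into {0..<n} h"
  have g': "g' (g a) = a" if "a < n" for a
    using g that by (auto simp: g'_def bij_betw_def the_inv_into_f_f)
  have h': "h' (h a) = a" if "a < n" for a
    using h that by (auto simp: h'_def bij_betw_def the_inv_into_f_f)
  define M where "M = mat n n (\<lambda>(a,c). A (g a) (h c))"
  have M: "M \<in> carrier_mat n n" by (simp add: M_def)
  have nz: "det M \<noteq> 0"
  proof
    assume "det M = 0"
    then obtain v where v: "v \<in> carrier_vec n" "v \<noteq> 0\<^sub>v n" "M *\<^sub>v v = 0\<^sub>v n"
      using det_0_iff_vec_prod_zero[OF M] by auto
    have "\<forall>d\<in>D. v $ (h' d) = 0"
    proof (rule inj)
      fix r assume "r \<in> R"
      then obtain a where a: "a < n" "r = g a" using g by (auto simp: bij_betw_def)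
      have "(\<Sum>d\<in>D. A r d * v $ (h' d)) = (\<Sum>c\<in>{0..<n}. A r (h c) * v $ (h' (h c)))"
        by (rule sum.reindex_bij_betw[OF h, symmetric])
      also have "\<dots> = (\<Sum>c\<in>{0..<n}. M $$ (a, c) * v $ c)"
        using a h' by (intro sum.cong) (auto simp: M_def)
      also have "\<dots> = (M *\<^sub>v v) $ a" using a v(1) M by (auto simp: scalar_prod_def intro!: sum.cong)
      finally show "(\<Sum>d\<in>D. A r d * v $ (h' d)) = 0" using v a by simp
    qed
    then have "v $ c = 0" if "c < n" for c using that bij_betwE[OF h] h'[OF that] by force
    then have "v = 0\<^sub>v n" using v by (intro eq_vecI) auto
    then show False using v by simp
  qed
  have adj: "adj_mat M \<in> carrier_mat n n" "M * adj_mat M = det M \<cdot>\<^sub>m 1\<^sub>m n" "adj_mat M * M = det M \<cdot>\<^sub>m 1\<^sub>m n"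
    using adj_mat[OF M] by auto
  define N where "N d r = adj_mat M $$ (h' d, g' r) / det M" for d r
  show ?thesis
  proof (intro exI[of _ N] conjI ballI)
    fix d d' assume "d \<in> D" "d' \<in> D"
    then obtain a c where a: "a < n" "d = h a" and c: "c < n" "d' = h c" using h by (auto simp: bij_betw_def)
    have "(\<Sum>r\<in>R. N d r * A r d') = (\<Sum>e\<in>{0..<n}. N d (g e) * A (g e) d')"
      by (rule sum.reindex_bij_betw[OF g, symmetric])
    also have "\<dots> = (\<Sum>e\<in>{0..<n}. adj_mat M $$ (a, e) * M $$ (e, c)) / det M"
      unfolding sum_divide_distrib using a c g' h' by (intro sum.cong) (auto simp: M_def N_def)
    also have "(\<Sum>e\<in>{0..<n}. adj_mat M $$ (a, e) * M $$ (e, c)) = (adj_mat M * M) $$ (a, c)"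
      using a c M adj(1) by (auto simp: scalar_prod_def intro!: sum.cong)
    also have "\<dots> / det M = (if d = d' then 1 else 0)" unfolding adj using a c nz h'[OF a(1)] h'[OF c(1)]
      by auto
    finally show "(\<Sum>r\<in>R. N d r * A r d') = (if d = d' then 1 else 0)" .
  next
    fix r r' assume "r \<in> R" "r' \<in> R"
    then obtain a c where a: "a < n" "r = g a" and c: "c < n" "r' = g c" using g by (auto simp: bij_betw_def)
    have "(\<Sum>d\<in>D. A r d * N d r') = (\<Sum>e\<in>{0..<n}. A r (h e) * N (h e) r')"
      by (rule sum.reindex_bij_betw[OF h, symmetric])
    also have "\<dots> = (\<Sum>e\<in>{0..<n}. M $$ (a, e) * adj_mat M $$ (e, c)) / det M"
      unfolding sum_divide_distrib using a c g' h' by (intro sum.cong) (auto simp: M_def N_def)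
    also have "(\<Sum>e\<in>{0..<n}. M $$ (a, e) * adj_mat M $$ (e, c)) = (M * adj_mat M) $$ (a, c)"
      using a c M adj(1) by (auto simp: scalar_prod_def intro!: sum.cong)
    also have "\<dots> / det M = (if r = r' then 1 else 0)" unfolding adj using a c nz g'[OF a(1)] g'[OF c(1)]
      by auto
    finally show "(\<Sum>d\<in>D. A r d * N d r') = (if r = r' then 1 else 0)" .
  qed
qed

section \<open>Product measures and tall random matrices\<close>


text \<open>Since the condition is open in \<open>x\<close>, a witness can be moved into a countable
  dense set. The near-kernel events below are phrased with strict inequalities so that this applies
  to them.\<close>

lemma ex_open_measurable:
  fixes Q :: "'w \<Rightarrow> 'x::second_countable_topology \<Rightarrow> bool"
  assumes open_Q: "\<And>\<omega>. \<omega> \<in> space M \<Longrightarrow> open {x. Q \<omega> x}"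
    and meas_Q: "\<And>x. {\<omega> \<in> space M. Q \<omega> x} \<in> sets M"
  shows "{\<omega> \<in> space M. \<exists>x. Q \<omega> x} \<in> sets M"
proof -
  obtain D :: "'x set" where D: "countable D" "\<And>X. open X \<Longrightarrow> X \<noteq> {} \<Longrightarrow> \<exists>d\<in>D. d \<in> X"
    using countable_dense_setE by blast
  have "{\<omega> \<in> space M. \<exists>x. Q \<omega> x} = (\<Union>x\<in>D. {\<omega> \<in> space M. Q \<omega> x})"
  proof (intro equalityI subsetI)
    fix \<omega> assume w: "\<omega> \<in> {\<omega> \<in> space M. \<exists>x. Q \<omega> x}"
    then have "\<exists>d\<in>D. d \<in> {x. Q \<omega> x}" by (intro D(2) open_Q) auto
    then show "\<omega> \<in> (\<Union>x\<in>D. {\<omega> \<in> space M. Q \<omega> x})" using w by auto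
  qed auto
  then show ?thesis using sets.countable_UN'[OF D(1), of "\<lambda>x. {\<omega> \<in> space M. Q \<omega> x}" M] meas_Q by auto
qed

text \<open>Subtracting the \<open>L l\<close>-multiples of the rows in \<open>S\<close> from row
  \<open>p\<close> cancels every column of \<open>U\<close> and leaves the column \<open>X\<close>
  times \<open>c\<close>. As the multipliers have modulus at most 1, the smallness of the image
  passes to this combination without loss.\<close>

lemma eliminate_columns:
  fixes U :: "'p \<Rightarrow> 'k \<Rightarrow> complex"
  assumes fin: "finite P" and S: "S \<subseteq> P" and p: "p \<in> P - S"
    and L: "\<And>l. l \<in> S \<Longrightarrow> cmod (L l) \<le> 1"
    and U: "\<And>k. k \<in> K \<Longrightarrow> U p k = (\<Sum>l\<in>S. L l * U l k)"
    and small: "(\<Sum>p\<in>P. cmod (X p * c + (\<Sum>k\<in>K. U p k * v k))) < r * cmod c"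
  shows "cmod (X p - (\<Sum>l\<in>S. L l * X l)) < r"
proof -
  define w where "w p = X p * c + (\<Sum>k\<in>K. U p k * v k)" for p
  have c: "c \<noteq> 0"
  proof
    assume "c = 0"
    then have "(\<Sum>p\<in>P. cmod (w p)) < 0" using small by (simp add: w_def)
    then show False using sum_nonneg[of P "\<lambda>p. cmod (w p)"] by simp
  qed
  have finS: "finite S" using finite_subset[OF S fin] .
  have "(\<Sum>l\<in>S. L l * (\<Sum>k\<in>K. U l k * v k)) = (\<Sum>k\<in>K. (\<Sum>l\<in>S. L l * U l k) * v k)"
    unfolding sum_distrib_left sum_distrib_right by (subst sum.swap) (simp add: mult.assoc)
  also have "\<dots> = (\<Sum>k\<in>K. U p k * v k)" by (intro sum.cong refl) (simp add: U)
  finally have UU: "(\<Sum>l\<in>S. L l * (\<Sum>k\<in>K. U l k * v k)) = (\<Sum>k\<in>K. U p k * v k)" .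
  have "(\<Sum>l\<in>S. L l * w l) = (\<Sum>l\<in>S. L l * X l) * c + (\<Sum>k\<in>K. U p k * v k)"
    unfolding UU[symmetric] by (simp add: w_def distrib_left sum.distrib sum_distrib_right mult.assoc)
  then have eq: "(X p - (\<Sum>l\<in>S. L l * X l)) * c = w p - (\<Sum>l\<in>S. L l * w l)"
    by (simp add: w_def algebra_simps)
  have "cmod (X p - (\<Sum>l\<in>S. L l * X l)) * cmod c \<le> cmod (w p) + cmod (\<Sum>l\<in>S. L l * w l)"
    unfolding norm_mult[symmetric] eq by (rule norm_triangle_ineq4)
  also have "cmod (\<Sum>l\<in>S. L l * w l) \<le> (\<Sum>l\<in>S. cmod (L l * w l))" by (rule norm_sum)
  also have "\<dots> \<le> (\<Sum>l\<in>S. cmod (w l))"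
    using L by (intro sum_mono) (simp add: norm_mult mult_left_le_one_le)
  also have "cmod (w p) + (\<Sum>l\<in>S. cmod (w l)) = (\<Sum>l\<in>insert p S. cmod (w l))"
    using p finS by simp
  also have "\<dots> \<le> (\<Sum>l\<in>P. cmod (w l))"
    using p S fin by (intro sum_mono2) auto
  also have "\<dots> < r * cmod c" using small by (simp add: w_def)
  finally show ?thesis using c by (simp add: mult_less_cancel_right)
qed

section \<open>Conditioning, adaptive exposure and anticoncentration for iid families\<close>

locale atom_dist = prob_space \<mu> for \<mu> :: "complex measure" +
  assumes sets_atom: "sets \<mu> = sets borel"
begin

abbreviation iid :: "'i set \<Rightarrow> ('i \<Rightarrow> complex) measure" where
  "iid I \<equiv> PiM I (\<lambda>_. \<mu>)"

lemma space_atom: "space \<mu> = UNIV"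
  using sets_eq_imp_space_eq[OF sets_atom] by simp

lemma prob_space_iid: "prob_space (iid I)"
  by (intro prob_space_PiM) unfold_locales

lemma emeasure_iid: "emeasure (iid I) A = ennreal (measure (iid I) A)"
  by (rule finite_measure.emeasure_eq_measure[OF prob_space.finite_measure[OF prob_space_iid]])

lemma coord_measurable: "i \<in> I \<Longrightarrow> (\<lambda>\<omega>. \<omega> i) \<in> borel_measurable (iid I)"
  by (metis measurable_component_singleton measurable_cong_sets sets_atom)

lemma space_iid: "space (iid I) = extensional I"
  by (auto simp: space_PiM PiE_def space_atom)

lemma merge_space: "J \<subseteq> I \<Longrightarrow> merge (I - J) J (x, y) \<in> space (iid I)"
  unfolding space_iid by (auto simp: merge_def extensional_def)

lemma section_measurable:
  assumes "finite I" "J \<subseteq> I" "A \<in> sets (iid I)"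
  shows "{y \<in> space (iid J). merge (I - J) J (x, y) \<in> A} \<in> sets (iid J)"
proof -
  have eq: "(I - J) \<union> J = I" using assms by auto
  \<comment> \<open>The merged point reads \<open>x\<close> only on \<open>I - J\<close>, so an
    arbitrary \<open>x\<close> may be replaced by its restriction, which lies in the product
    space.\<close>
  have rx: "restrict x (I - J) \<in> space (iid (I - J))" by (simp add: space_iid)
  have "(\<lambda>y. merge (I - J) J (restrict x (I - J), y)) \<in> measurable (iid J) (iid ((I - J) \<union> J))"
    by (rule measurable_compose[OF measurable_Pair1'[OF rx] measurable_merge])
  then have "(\<lambda>y. merge (I - J) J (restrict x (I - J), y)) -` A \<inter> space (iid J) \<in> sets (iid J)"
    using assms unfolding eq by (intro measurable_sets)
  also have "(\<lambda>y. merge (I - J) J (restrict x (I - J), y)) -` A \<inter> space (iid J) =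
      {y \<in> space (iid J). merge (I - J) J (x, y) \<in> A}"
    by (auto simp: merge_def restrict_def cong: if_cong)
  finally show ?thesis .
qed

lemma emeasure_le_sections:
  assumes "finite I" "J \<subseteq> I" "A \<in> sets (iid I)"
    and sec: "\<And>x. x \<in> space (iid (I - J)) \<Longrightarrow>
      emeasure (iid J) {y \<in> space (iid J). merge (I - J) J (x, y) \<in> A} \<le> e"
  shows "emeasure (iid I) A \<le> e"
proof -
  interpret P: product_prob_space "\<lambda>_::'a. \<mu>" by unfold_locales
  interpret IJ: prob_space "iid (I - J)" by (rule prob_space_iid)
  have eq: "(I - J) \<union> J = I" using assms by auto
  have "emeasure (iid I) A = (\<integral>\<^sup>+x. emeasure (iid J)
      ((\<lambda>y. merge (I - J) J (x, y)) -` A \<inter> space (iid J)) \<partial>iid (I - J))"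
    using P.emeasure_fold_integral[of "I - J" J A] assms finite_subset[OF \<open>J \<subseteq> I\<close>] unfolding eq by auto
  also have "\<dots> \<le> (\<integral>\<^sup>+x. e \<partial>iid (I - J))"
  proof (rule nn_integral_mono)
    fix x assume "x \<in> space (iid (I - J))"
    moreover have "(\<lambda>y. merge (I - J) J (x, y)) -` A \<inter> space (iid J) =
      {y \<in> space (iid J). merge (I - J) J (x, y) \<in> A}" by auto
    ultimately show "emeasure (iid J) ((\<lambda>y. merge (I - J) J (x, y)) -` A \<inter> space (iid J)) \<le> e"
      using sec by simp
  qed
  also have "\<dots> = e" by (simp add: IJ.emeasure_space_1)
  finally show ?thesis .
qed

lemma prob_le_sections:
  assumes "finite I" "J \<subseteq> I" "A \<in> sets (iid I)" "0 \<le> e"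
    and sec: "\<And>x. x \<in> space (iid (I - J)) \<Longrightarrow>
      measure (iid J) {y \<in> space (iid J). merge (I - J) J (x, y) \<in> A} \<le> e"
  shows "measure (iid I) A \<le> e"
proof -
  have "emeasure (iid I) A \<le> ennreal e"
    using assms by (intro emeasure_le_sections[of I J]) (auto simp: emeasure_iid intro!: ennreal_leI)
  then show ?thesis using \<open>0 \<le> e\<close> by (simp add: emeasure_iid)
qed

text \<open>Once the other coordinates are fixed, each coordinate in \<open>J\<close> is confined to
  a ball whose centre is fixed too, and independence multiplies the small ball probabilities. The
  centre may depend on the fixed coordinates in a non-measurable way because only a bound for each
  section is used.\<close>

lemma small_ball_product:
  assumes "finite I" "J \<subseteq> I" "A \<in> sets (iid I)"
    and conc: "\<And>a. measure \<mu> (ball a r) \<le> q"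
    and sec: "\<And>x. x \<in> space (iid (I - J)) \<Longrightarrow>
      \<exists>a. \<forall>y\<in>space (iid J). merge (I - J) J (x, y) \<in> A \<longrightarrow> (\<forall>j\<in>J. cmod (y j - a j) < r)"
  shows "measure (iid I) A \<le> q ^ card J"
proof (rule prob_le_sections[OF assms(1-3)])
  have q0: "0 \<le> q" using conc[of 0] measure_nonneg[of \<mu> "ball 0 r"] by linarith
  then show "0 \<le> q ^ card J" by simp
  fix x assume "x \<in> space (iid (I - J))"
  then obtain a where a: "\<And>y j. y \<in> space (iid J) \<Longrightarrow> merge (I - J) J (x, y) \<in> A \<Longrightarrow> j \<in> J \<Longrightarrow> cmod (y j - a j) < r"
    using sec by metis
  interpret P: product_prob_space "\<lambda>_::'a. \<mu>" by unfold_locales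
  interpret J: prob_space "iid J" by (rule prob_space_iid)
  have finJ: "finite J" using finite_subset[OF assms(2,1)] .
  have ballm: "ball (a j) r \<in> sets \<mu>" for j by (simp add: sets_atom)
  have "{y \<in> space (iid J). merge (I - J) J (x, y) \<in> A} \<subseteq> (\<Pi>\<^sub>E j\<in>J. ball (a j) r)"
  proof (intro subsetI PiE_I)
    fix y j assume y: "y \<in> {y \<in> space (iid J). merge (I - J) J (x, y) \<in> A}"
    show "y j \<in> ball (a j) r" if "j \<in> J"
      using a[of y j] y that by (simp add: dist_norm[symmetric] dist_commute)
    show "y j = undefined" if "j \<notin> J" using y that by (auto simp: space_iid extensional_def)
  qed
  then have "measure (iid J) {y \<in> space (iid J). merge (I - J) J (x, y) \<in> A} \<le> measure (iid J) (\<Pi>\<^sub>E j\<in>J. ball (a j) r)"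
    using finJ ballm by (intro J.finite_measure_mono sets_PiM_I_finite) auto
  also have "\<dots> = (\<Prod>j\<in>J. measure \<mu> (ball (a j) r))"
  proof (rule measure_eq_emeasure_eq_ennreal)
    have "emeasure (iid J) (\<Pi>\<^sub>E j\<in>J. ball (a j) r) = (\<Prod>j\<in>J. emeasure \<mu> (ball (a j) r))"
      by (rule P.emeasure_PiM[OF finJ ballm])
    then show "emeasure (iid J) (\<Pi>\<^sub>E j\<in>J. ball (a j) r) = ennreal (\<Prod>j\<in>J. measure \<mu> (ball (a j) r))"
      by (simp add: emeasure_eq_measure prod_ennreal)
  qed (simp add: prod_nonneg)
  also have "\<dots> \<le> (\<Prod>j\<in>J. q)" by (intro prod_mono) (auto simp: conc)
  finally show "measure (iid J) {y \<in> space (iid J). merge (I - J) J (x, y) \<in> A} \<le> q ^ card J" by simp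
qed

text \<open>Only the final event has to be measurable: the past may be used through arbitrary,
  possibly non-measurable choices.\<close>
lemma sequential_exposure:
  fixes J :: "nat \<Rightarrow> 'i set" and Good :: "nat \<Rightarrow> ('i \<Rightarrow> complex) \<Rightarrow> bool"
  assumes "finite I" and JI: "\<And>k. k < N \<Longrightarrow> J k \<subseteq> I"
    and disj: "\<And>k l. k < l \<Longrightarrow> l < N \<Longrightarrow> J k \<inter> J l = {}"
    and Z: "Z \<in> sets (iid I)" and "0 \<le> e"
    and good0: "\<And>\<omega>. \<omega> \<in> space (iid I) \<Longrightarrow> Good 0 \<omega>"
    and step: "\<And>k \<omega>. k < N \<Longrightarrow> \<omega> \<in> space (iid I) \<Longrightarrow> Good k \<omega> \<Longrightarrow>
      \<exists>B\<in>sets (iid (J k)). measure (iid (J k)) B \<le> e \<and>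
        (\<forall>\<omega>'\<in>space (iid I). (\<forall>i\<in>I - \<Union>(J ` {k..<N}). \<omega>' i = \<omega> i) \<and> restrict \<omega>' (J k) \<notin> B \<longrightarrow> Good (Suc k) \<omega>')"
    and final: "\<And>\<omega>. \<omega> \<in> space (iid I) \<Longrightarrow> Good N \<omega> \<Longrightarrow> \<omega> \<notin> Z"
  shows "measure (iid I) Z \<le> N * e"
proof -
  interpret P: product_prob_space "\<lambda>_::'i. \<mu>" by unfold_locales
  \<comment> \<open>The coordinates not yet exposed at time \<open>k\<close>. The induction runs
    over the number of blocks left, and its claim bounds the conditional probability of
    \<open>Z\<close> given a good history.\<close>
  define F where "F k = \<Union>(J ` {k..<N})" for k
  have FI: "F k \<subseteq> I" for k using JI by (fastforce simp: F_def)
  have finF: "finite (F k)" for k using FI \<open>finite I\<close> finite_subset by blast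
  have main: "k + n = N \<Longrightarrow> \<omega> \<in> space (iid I) \<Longrightarrow> Good k \<omega> \<Longrightarrow>
    emeasure (iid (F k)) {y \<in> space (iid (F k)). merge (I - F k) (F k) (\<omega>, y) \<in> Z} \<le> ennreal (n * e)" for n k \<omega>
  proof (induction n arbitrary: k \<omega>)
    case 0
    then have "F k = {}" by (simp add: F_def)
    have "merge I {} (\<omega>, y) = \<omega>" for y
      using 0 unfolding space_iid by (auto simp: merge_def extensional_def)
    then have none: "{y \<in> space (iid (F k)). merge (I - F k) (F k) (\<omega>, y) \<in> Z} = {}"
      using final 0 \<open>F k = {}\<close> by auto
    show ?case unfolding none by simp
  next
    case (Suc n)
    then have k: "k < N" by simp
    obtain B where B: "B \<in> sets (iid (J k))" "measure (iid (J k)) B \<le> e"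
      "\<And>\<omega>'. \<omega>' \<in> space (iid I) \<Longrightarrow> (\<forall>i\<in>I - F k. \<omega>' i = \<omega> i) \<Longrightarrow> restrict \<omega>' (J k) \<notin> B \<Longrightarrow> Good (Suc k) \<omega>'"
      using step[OF k Suc.prems(2,3)] unfolding F_def by blast
    interpret Jk: prob_space "iid (J k)" by (rule prob_space_iid)
    interpret F': prob_space "iid (F (Suc k))" by (rule prob_space_iid)
    have "{k..<N} = insert k {Suc k..<N}" using k by auto
    then have Fk: "F k = J k \<union> F (Suc k)" by (auto simp: F_def)
    have dj: "J k \<inter> F (Suc k) = {}" unfolding F_def using disj[of k] by (auto simp: disjoint_iff)
    have finJ: "finite (J k)" using finite_subset[OF JI[OF k] \<open>finite I\<close>] .
    define A where "A = {y \<in> space (iid (F k)). merge (I - F k) (F k) (\<omega>, y) \<in> Z}"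
    have A: "A \<in> sets (iid (F k))" unfolding A_def by (rule section_measurable[OF \<open>finite I\<close> FI Z])
    have "emeasure (iid (F k)) A = (\<integral>\<^sup>+x. emeasure (iid (F (Suc k)))
        ((\<lambda>y. merge (J k) (F (Suc k)) (x, y)) -` A \<inter> space (iid (F (Suc k)))) \<partial>iid (J k))"
      using A unfolding Fk by (rule P.emeasure_fold_integral[OF dj finJ finF])
    \<comment> \<open>For \<open>x\<close> in \<open>B\<close> the inner probability is at most 1;
      outside \<open>B\<close> the history extended by \<open>x\<close> is good again and the
      induction hypothesis applies to it.\<close>
    also have "\<dots> \<le> (\<integral>\<^sup>+x. indicator B x + ennreal (n * e) \<partial>iid (J k))"
    proof (rule nn_integral_mono)
      fix x assume x: "x \<in> space (iid (J k))"
      define \<omega>1 where "\<omega>1 = merge (I - J k) (J k) (\<omega>, x)"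
      have \<omega>1: "\<omega>1 \<in> space (iid I)" unfolding \<omega>1_def by (rule merge_space[OF JI[OF k]])
      show "emeasure (iid (F (Suc k))) ((\<lambda>y. merge (J k) (F (Suc k)) (x, y)) -` A \<inter> space (iid (F (Suc k))))
          \<le> indicator B x + ennreal (n * e)"
      proof (cases "x \<in> B")
        case True
        then show ?thesis using \<open>0 \<le> e\<close> F'.emeasure_le_1 by (simp add: add_increasing2)
      next
        case False
        have "restrict \<omega>1 (J k) = x" using x unfolding \<omega>1_def space_iid
          by (auto simp: merge_def extensional_def restrict_def)
        moreover have "\<forall>i\<in>I - F k. \<omega>1 i = \<omega> i" by (auto simp: \<omega>1_def merge_def Fk)
        ultimately have "Good (Suc k) \<omega>1" using B(3) \<omega>1 False by auto
        then have IH: "emeasure (iid (F (Suc k))) {y \<in> space (iid (F (Suc k))). merge (I - F (Suc k)) (F (Suc k)) (\<omega>1, y) \<in> Z}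
            \<le> ennreal (n * e)" using Suc.prems \<omega>1 by (intro Suc.IH) auto
        have "merge (I - F k) (F k) (\<omega>, merge (J k) (F (Suc k)) (x, y)) = merge (I - F (Suc k)) (F (Suc k)) (\<omega>1, y)" for y
          using dj JI[OF k] by (auto simp: merge_def \<omega>1_def Fk fun_eq_iff)
        then have "(\<lambda>y. merge (J k) (F (Suc k)) (x, y)) -` A \<inter> space (iid (F (Suc k))) \<subseteq>
            {y \<in> space (iid (F (Suc k))). merge (I - F (Suc k)) (F (Suc k)) (\<omega>1, y) \<in> Z}"
          by (auto simp: A_def)
        then have "emeasure (iid (F (Suc k))) ((\<lambda>y. merge (J k) (F (Suc k)) (x, y)) -` A \<inter> space (iid (F (Suc k)))) \<le> ennreal (n * e)"
          by (intro order_trans[OF emeasure_mono IH] section_measurable[OF \<open>finite I\<close> FI Z])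
        then show ?thesis using False by simp
      qed
    qed
    also have "\<dots> = emeasure (iid (J k)) B + ennreal (n * e)"
      using B(1) by (simp add: nn_integral_add Jk.emeasure_space_1)
    also have "\<dots> \<le> ennreal e + ennreal (n * e)"
      using B(2) by (intro add_mono) (auto simp: emeasure_iid intro: ennreal_leI)
    also have "\<dots> = ennreal (Suc n * e)" using \<open>0 \<le> e\<close> by (simp add: ennreal_plus[symmetric] algebra_simps del: ennreal_plus)
    finally show ?case by (simp add: A_def)
  qed
  have "emeasure (iid I) Z \<le> ennreal (N * e)"
  proof (rule emeasure_le_sections[OF \<open>finite I\<close> FI[of 0] Z])
    fix x assume "x \<in> space (iid (I - F 0))"
    \<comment> \<open>The value 0 on \<open>F 0\<close> is a placeholder that every \<open>y\<close>
      overwrites; it only makes \<open>\<omega>\<close> a point of the full space from which the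
      induction can start.\<close>
    define \<omega> where "\<omega> = merge (I - F 0) (F 0) (x, \<lambda>_. 0)"
    have \<omega>: "\<omega> \<in> space (iid I)" unfolding \<omega>_def by (rule merge_space[OF FI])
    have "merge (I - F 0) (F 0) (x, y) = merge (I - F 0) (F 0) (\<omega>, y)" for y
      by (auto simp: merge_def \<omega>_def)
    then show "emeasure (iid (F 0)) {y \<in> space (iid (F 0)). merge (I - F 0) (F 0) (x, y) \<in> Z} \<le> ennreal (N * e)"
      using main[OF _ \<omega> good0[OF \<omega>], of N] by simp
  qed
  then show ?thesis using \<open>0 \<le> e\<close> by (simp add: emeasure_iid)
qed


lemma dominated_column_measurable:
  fixes A :: "('i \<Rightarrow> complex) \<Rightarrow> 'p \<Rightarrow> 'k::countable \<Rightarrow> complex"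
  assumes meas: "\<And>p k. p \<in> P \<Longrightarrow> k \<in> K \<Longrightarrow> (\<lambda>\<omega>. A \<omega> p k) \<in> borel_measurable (iid I)"
  shows "{\<omega> \<in> space (iid I). \<exists>x. (\<Sum>p\<in>P. cmod (\<Sum>k\<in>K. A \<omega> p k * x k)) < r * cmod (x k0)} \<in> sets (iid I)"
proof (rule ex_open_measurable)
  fix \<omega>
  show "open {x. (\<Sum>p\<in>P. cmod (\<Sum>k\<in>K. A \<omega> p k * x k)) < r * cmod (x k0)}"
    by (intro open_Collect_less continuous_intros continuous_on_product_coordinates)
next
  fix x :: "'k \<Rightarrow> complex"
  have "(\<lambda>\<omega>. (\<Sum>p\<in>P. cmod (\<Sum>k\<in>K. A \<omega> p k * x k))) \<in> borel_measurable (iid I)"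
    using meas by (intro borel_measurable_sum borel_measurable_norm[THEN measurable_compose, rotated]
        measurable_compose[OF _ borel_measurable_norm] borel_measurable_times) auto
  then show "{\<omega> \<in> space (iid I). (\<Sum>p\<in>P. cmod (\<Sum>k\<in>K. A \<omega> p k * x k)) < r * cmod (x k0)} \<in> sets (iid I)"
    by measurable
qed

text \<open>A column within distance \<open>r\<close> of the span of the others is determined up to \<open>r\<close> by
  its coordinates on a bounded row basis of that span, so each remaining coordinate costs a factor \<open>q\<close>.\<close>
lemma tall_matrix_bound:
  fixes \<phi> :: "'p \<Rightarrow> 'k::countable \<Rightarrow> 'i" and q r :: real
  assumes fin: "finite I" "finite P" "finite K" and card: "card K \<le> card P"
    and \<phi>I: "\<And>p k. p \<in> P \<Longrightarrow> k \<in> K \<Longrightarrow> \<phi> p k \<in> I"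
    and \<phi>inj: "\<And>p k p' k'. p \<in> P \<Longrightarrow> k \<in> K \<Longrightarrow> p' \<in> P \<Longrightarrow> k' \<in> K \<Longrightarrow> \<phi> p k = \<phi> p' k' \<Longrightarrow> p = p' \<and> k = k'"
    and meas: "\<And>p k. p \<in> P \<Longrightarrow> k \<in> K \<Longrightarrow> (\<lambda>\<omega>. F \<omega> p k) \<in> borel_measurable (iid I)"
    and indep: "\<And>\<omega> \<omega>' p k. p \<in> P \<Longrightarrow> k \<in> K \<Longrightarrow>
      \<forall>i\<in>I. (\<forall>p\<in>P. \<forall>k\<in>K. i \<noteq> \<phi> p k) \<longrightarrow> \<omega> i = \<omega>' i \<Longrightarrow> F \<omega> p k = F \<omega>' p k"
    and conc: "\<And>a. measure \<mu> (ball a r) \<le> q"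
  defines "B \<equiv> {\<omega> \<in> space (iid I). \<exists>x. \<exists>k0\<in>K.
    (\<Sum>p\<in>P. cmod (\<Sum>k\<in>K. (\<omega> (\<phi> p k) + F \<omega> p k) * x k)) < r * cmod (x k0)}"
  shows "B \<in> sets (iid I)" "measure (iid I) B \<le> card K * q ^ (card P + 1 - card K)"
proof -
  interpret I: prob_space "iid I" by (rule prob_space_iid)
  define E where "E k0 = {\<omega> \<in> space (iid I). \<exists>x.
    (\<Sum>p\<in>P. cmod (\<Sum>k\<in>K. (\<omega> (\<phi> p k) + F \<omega> p k) * x k)) < r * cmod (x k0)}" for k0
  have BE: "B = (\<Union>k0\<in>K. E k0)" unfolding B_def E_def by blast
  have Em: "E k0 \<in> sets (iid I)" for k0
    unfolding E_def
    by (rule dominated_column_measurable) (auto intro!: borel_measurable_add coord_measurable \<phi>I meas)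
  then show "B \<in> sets (iid I)" unfolding BE using fin by (intro sets.finite_UN) auto
  have one: "measure (iid I) (E k0) \<le> q ^ (card P + 1 - card K)" if k0: "k0 \<in> K" for k0
  proof -
    define J1 where "J1 = (\<lambda>p. \<phi> p k0) ` P"
    have J1: "J1 \<subseteq> I" using \<phi>I k0 by (auto simp: J1_def)
    have finJ1: "finite J1" using fin by (simp add: J1_def)
    have q0: "0 \<le> q" using conc[of 0] measure_nonneg[of \<mu> "ball 0 r"] by linarith
    show ?thesis
    proof (rule prob_le_sections[OF fin(1) J1 Em[of k0]])
      show "0 \<le> q ^ (card P + 1 - card K)" using q0 by simp
      fix x0 :: "'i \<Rightarrow> complex"
      define mg where "mg y = merge (I - J1) J1 (x0, y)" for y :: "'i \<Rightarrow> complex"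
      define \<omega>0 where "\<omega>0 = mg (\<lambda>_. 0)"
      have FF: "F (mg y) p k = F \<omega>0 p k" if "p \<in> P" "k \<in> K" for y p k
        using that k0 by (intro indep) (auto simp: mg_def \<omega>0_def merge_def J1_def)
      \<comment> \<open>The columns other than \<open>k0\<close> with everything outside column
        \<open>k0\<close> frozen. The shift \<open>F\<close> reads no entry at a position
        \<open>\<phi> p k\<close>, so \<open>U\<close> stays the same while column \<open>k0\<close>
        varies.\<close>
      define U where "U p k = \<omega>0 (\<phi> p k) + F \<omega>0 p k" for p k
      have UU: "mg y (\<phi> p k) + F (mg y) p k = U p k" if "p \<in> P" "k \<in> K - {k0}" for y p k
      proof -
        have "\<phi> p k \<notin> J1" using that \<phi>inj k0 by (auto simp: J1_def)
        then have "mg y (\<phi> p k) = \<omega>0 (\<phi> p k)" by (simp add: mg_def \<omega>0_def merge_def)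
        then show ?thesis using FF[of p k y] that by (simp add: U_def)
      qed
      have "card (K - {k0}) \<le> card P" using card k0 fin by simp
      then obtain S L where S: "S \<subseteq> P" "card S = card (K - {k0})"
        and L: "\<And>i l. i \<in> P \<Longrightarrow> l \<in> S \<Longrightarrow> cmod (L i l) \<le> 1"
        and UL: "\<And>i c. i \<in> P \<Longrightarrow> c \<in> K - {k0} \<Longrightarrow> U i c = (\<Sum>l\<in>S. L i l * U l c)"
        by (rule bounded_row_basis[OF finite_Diff[OF fin(3)] fin(2), where U = U]) blast
      define J2 where "J2 = (\<lambda>p. \<phi> p k0) ` (P - S)"
      have inj: "inj_on (\<lambda>p. \<phi> p k0) P" using \<phi>inj k0 by (auto simp: inj_on_def)
      have J2: "J2 \<subseteq> J1" by (auto simp: J1_def J2_def)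
      have "card J2 = card (P - S)" unfolding J2_def
        by (intro card_image inj_on_subset[OF inj]) auto
      also have "\<dots> = card P - card S" using S fin finite_subset by (intro card_Diff_subset) auto
      \<comment> \<open>The other columns are only \<open>card K - 1\<close> in number and fix as
        many coordinates of column \<open>k0\<close>; this is the origin of the extra 1 in the
        exponent.\<close>
      also have "\<dots> = card P + 1 - card K" using S k0 fin card_gt_0_iff[of K] by auto
      finally have cJ2: "card J2 = card P + 1 - card K" .
      show "measure (iid J1) {y \<in> space (iid J1). merge (I - J1) J1 (x0, y) \<in> E k0} \<le> q ^ (card P + 1 - card K)"
        unfolding cJ2[symmetric]
      proof (rule small_ball_product[OF finJ1 J2 section_measurable[OF fin(1) J1 Em] conc])
        fix x :: "'i \<Rightarrow> complex"
        define X where "X z p = z (\<phi> p k0) + F \<omega>0 p k0" for z :: "'i \<Rightarrow> complex" and p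
        define a where "a j = (let p = the_inv_into P (\<lambda>p. \<phi> p k0) j in
            (\<Sum>l\<in>S. L p l * X x l) - F \<omega>0 p k0)" for j
        show "\<exists>a. \<forall>y\<in>space (iid J2). merge (J1 - J2) J2 (x, y)
            \<in> {y \<in> space (iid J1). merge (I - J1) J1 (x0, y) \<in> E k0} \<longrightarrow> (\<forall>j\<in>J2. cmod (y j - a j) < r)"
        proof (intro exI[of _ a] ballI impI)
          fix y j
          assume y: "merge (J1 - J2) J2 (x, y) \<in> {y \<in> space (iid J1). merge (I - J1) J1 (x0, y) \<in> E k0}"
            and "j \<in> J2"
          then obtain p where p: "p \<in> P - S" "j = \<phi> p k0" by (auto simp: J2_def)
          define y1 where "y1 = merge (J1 - J2) J2 (x, y)"
          from y obtain v where v: "(\<Sum>p\<in>P. cmod (\<Sum>k\<in>K. (mg y1 (\<phi> p k) + F (mg y1) p k) * v k)) < r * cmod (v k0)"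
            by (auto simp: E_def mg_def y1_def)
          have "(\<Sum>k\<in>K. (mg y1 (\<phi> p k) + F (mg y1) p k) * v k) = X y1 p * v k0 + (\<Sum>k\<in>K - {k0}. U p k * v k)"
            if "p \<in> P" for p
          proof -
            have "\<phi> p k0 \<in> J1" using that by (auto simp: J1_def)
            then have "mg y1 (\<phi> p k0) = y1 (\<phi> p k0)" by (simp add: mg_def merge_def)
            then show ?thesis using k0 fin that UU FF
              by (subst sum.remove[of K k0]) (auto simp: X_def)
          qed
          then have "(\<Sum>p\<in>P. cmod (X y1 p * v k0 + (\<Sum>k\<in>K - {k0}. U p k * v k))) < r * cmod (v k0)"
            using v by simp
          then have less: "cmod (X y1 p - (\<Sum>l\<in>S. L p l * X y1 l)) < r"
            using p by (intro eliminate_columns[OF fin(2) S(1) p(1) L UL]) auto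
          have "\<phi> l k0 \<in> J1 - J2" if "l \<in> S" for l
            proof
            show "\<phi> l k0 \<in> J1" using that S by (auto simp: J1_def)
            show "\<phi> l k0 \<notin> J2"
            proof
              assume "\<phi> l k0 \<in> J2"
              then obtain p' where "p' \<in> P - S" "\<phi> l k0 = \<phi> p' k0" by (auto simp: J2_def)
              then show False using inj_onD[OF inj, of l p'] that S by auto
            qed
          qed
          then have "X y1 l = X x l" if "l \<in> S" for l using that by (simp add: X_def y1_def merge_def)
          then have e1: "(\<Sum>l\<in>S. L p l * X y1 l) = (\<Sum>l\<in>S. L p l * X x l)" by simp
          have e2: "X y1 p = y j + F \<omega>0 p k0" using \<open>j \<in> J2\<close> J2 p by (auto simp: X_def y1_def merge_def)
          have "the_inv_into P (\<lambda>p. \<phi> p k0) j = p" using the_inv_into_f_f[OF inj] p by auto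
          then have "a j = (\<Sum>l\<in>S. L p l * X x l) - F \<omega>0 p k0" by (simp add: a_def)
          then have "y j - a j = X y1 p - (\<Sum>l\<in>S. L p l * X y1 l)" unfolding e1 e2 by simp
          then show "cmod (y j - a j) < r" using less by simp
        qed
      qed
    qed
  qed
  have "measure (iid I) B \<le> (\<Sum>k0\<in>K. measure (iid I) (E k0))"
    unfolding BE using fin Em by (intro I.finite_measure_subadditive_finite) auto
  also have "\<dots> \<le> (\<Sum>k0\<in>K. q ^ (card P + 1 - card K))" by (intro sum_mono one)
  finally show "measure (iid I) B \<le> card K * q ^ (card P + 1 - card K)" by simp
qed

end

section \<open>One step of the block recurrence\<close>


text \<open>Coordinates of two consecutive blocks, the state of the second-order block recurrence;
  the first component tells which of the two blocks is meant.\<close>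

definition pair_index :: "nat \<Rightarrow> (nat \<times> nat) set" where
  "pair_index b = {..<2} \<times> {..<b}"

text \<open>A \<open>d\<close>-dimensional space of block pairs, encoded as a graph over the
  coordinates \<open>S\<close> with coefficients of modulus at most 1. A vector of the space is
  determined by its values on \<open>S\<close> and is at most \<open>d\<close> times as large as
  they are.\<close>

definition frame :: "nat \<Rightarrow> nat \<Rightarrow> (nat \<times> nat) set \<Rightarrow> (nat \<times> nat \<Rightarrow> nat \<times> nat \<Rightarrow> complex) \<Rightarrow> bool" where
  "frame b d S L \<longleftrightarrow> S \<subseteq> pair_index b \<and> card S = d \<and>
    (\<forall>i\<in>S. \<forall>l\<in>S. L i l = (if i = l then 1 else 0)) \<and>
    (\<forall>i\<in>pair_index b. \<forall>l\<in>S. cmod (L i l) \<le> 1)"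

definition graph_vec :: "nat \<Rightarrow> (nat \<times> nat) set \<Rightarrow> (nat \<times> nat \<Rightarrow> nat \<times> nat \<Rightarrow> complex) \<Rightarrow> (nat \<times> nat \<Rightarrow> complex) \<Rightarrow> bool" where
  "graph_vec b S L e \<longleftrightarrow> (\<forall>i\<in>pair_index b. e i = (\<Sum>l\<in>S. L i l * e l))"

definition row_value :: "nat \<Rightarrow> (nat \<Rightarrow> nat \<Rightarrow> nat \<Rightarrow> complex) \<Rightarrow> nat \<Rightarrow> (nat \<Rightarrow> complex) \<Rightarrow> (nat \<Rightarrow> complex) \<Rightarrow> (nat \<Rightarrow> complex) \<Rightarrow> complex" where
  "row_value b E a x0 x1 x2 =
    (\<Sum>c<b. E 0 a c * x0 c) + (\<Sum>c<b. E 1 a c * x1 c) + (\<Sum>c<b. E 2 a c * x2 c)"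

definition restricted_row :: "nat \<Rightarrow> (nat \<Rightarrow> nat \<Rightarrow> nat \<Rightarrow> complex) \<Rightarrow> (nat \<times> nat \<Rightarrow> nat \<times> nat \<Rightarrow> complex) \<Rightarrow> nat \<Rightarrow> nat \<times> nat \<Rightarrow> complex" where
  "restricted_row b E L p l = (\<Sum>i\<in>pair_index b. E (fst i) p (snd i) * L i l)"

text \<open>The first clause is robust injectivity of the row block on the frame and yields the
  backward bound. The second is the dual statement: the restricted rows together with the next block
  span everything robustly, which makes the row equations solvable and yields the forward
  bound.\<close>

definition good_step :: "nat \<Rightarrow> real \<Rightarrow> real \<Rightarrow> (nat \<Rightarrow> nat \<Rightarrow> nat \<Rightarrow> complex) \<Rightarrow> (nat \<times> nat) set \<Rightarrow> (nat \<times> nat \<Rightarrow> nat \<times> nat \<Rightarrow> complex) \<Rightarrow> bool" where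
  "good_step b r \<gamma> E S L \<longleftrightarrow>
    (\<forall>x. \<forall>l0\<in>S. r * cmod (x l0) \<le> (\<Sum>p<b. cmod (\<Sum>l\<in>S. restricted_row b E L p l * x l))) \<and>
    (\<forall>y. \<forall>p0<b. cmod (y p0) \<le> \<gamma> * ((\<Sum>l\<in>S. cmod (\<Sum>p<b. restricted_row b E L p l * y p)) +
      (\<Sum>c<b. cmod (\<Sum>p<b. E 2 p c * y p))))"

lemma card_pair_index [simp]: "finite (pair_index b)" "card (pair_index b) = 2 * b"
  by (auto simp: pair_index_def)

lemma frame_finite: "frame b d S L \<Longrightarrow> finite S"
  by (auto simp: frame_def dest: finite_subset)

lemma sum_le_const:
  fixes f :: "'a \<Rightarrow> real"
  assumes "\<And>i. i \<in> A \<Longrightarrow> f i \<le> c" "card A \<le> n" "0 \<le> c"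
  shows "sum f A \<le> n * c"
proof -
  have "sum f A \<le> card A * c" using sum_bounded_above[of A f c] assms(1) by simp
  also have "\<dots> \<le> n * c" using assms by (intro mult_right_mono) auto
  finally show ?thesis .
qed

lemma norm_sum_mult_le:
  fixes u v :: "'a \<Rightarrow> complex"
  assumes "\<And>i. i \<in> A \<Longrightarrow> cmod (u i) \<le> s" "\<And>i. i \<in> A \<Longrightarrow> cmod (v i) \<le> t" "card A \<le> n" "0 \<le> s" "0 \<le> t"
  shows "cmod (\<Sum>i\<in>A. u i * v i) \<le> n * (s * t)"
proof -
  have "cmod (\<Sum>i\<in>A. u i * v i) \<le> (\<Sum>i\<in>A. cmod (u i * v i))" by (rule norm_sum)
  also have "\<dots> \<le> n * (s * t)"
    using assms by (intro sum_le_const) (auto simp: norm_mult intro!: mult_mono)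
  finally show ?thesis .
qed

lemma pair_sum: "(\<Sum>i\<in>pair_index b. f i) = (\<Sum>c<b. f (0, c)) + (\<Sum>c<b. f (Suc 0, c))"
  unfolding pair_index_def by (simp add: sum.cartesian_product' numeral_2_eq_2)

text \<open>The columns of \<open>[W, U]\<close> span robustly once \<open>W\<close> is injective and \<open>U\<close> spans modulo \<open>W\<close>.\<close>
lemma dual_lower_bound:
  fixes W :: "nat \<Rightarrow> 'l \<Rightarrow> complex" and U :: "nat \<Rightarrow> nat \<Rightarrow> complex"
  assumes finS: "finite S" and R: "R \<subseteq> {..<b}" "card R = card S" and r: "0 < r" and \<Lambda>: "0 \<le> \<Lambda>"
    and M1: "\<And>i l. i \<in> R \<Longrightarrow> l \<in> R \<Longrightarrow> M i l = (if i = l then 1 else 0)"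
    and M2: "\<And>i l. i < b \<Longrightarrow> l \<in> R \<Longrightarrow> cmod (M i l) \<le> 1"
    and WM: "\<And>i c. i < b \<Longrightarrow> c \<in> S \<Longrightarrow> W i c = (\<Sum>l\<in>R. M i l * W l c)"
    and W: "\<And>x l0. l0 \<in> S \<Longrightarrow> r * cmod (x l0) \<le> (\<Sum>p<b. cmod (\<Sum>l\<in>S. W p l * x l))"
    and U: "\<And>p c. p < b \<Longrightarrow> c < b \<Longrightarrow> cmod (U p c) \<le> \<Lambda>"
    and Ut: "\<And>y i0. i0 \<in> {..<b} - R \<Longrightarrow> r * cmod (y i0) \<le>
      (\<Sum>c<b. cmod (\<Sum>i\<in>{..<b} - R. (U i c - (\<Sum>l\<in>R. M i l * U l c)) * y i))"
    and p0: "p0 < b"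
  shows "cmod (y p0) \<le> b / r * (2 + real b ^ 3 * \<Lambda> / r) *
    ((\<Sum>l\<in>S. cmod (\<Sum>p<b. W p l * y p)) + (\<Sum>c<b. cmod (\<Sum>p<b. U p c * y p)))"
proof -
  have finR: "finite R" using R finite_subset by auto
  have cR: "card R \<le> b" using card_mono[of "{..<b}" R] R by auto
  have inj: "\<forall>d\<in>S. t d = 0" if z: "\<And>q. q \<in> R \<Longrightarrow> (\<Sum>d\<in>S. W q d * t d) = 0" for t
  proof
    fix d assume d: "d \<in> S"
    have "(\<Sum>l\<in>S. W p l * t l) = 0" if "p < b" for p
    proof -
      have "(\<Sum>l\<in>S. W p l * t l) = (\<Sum>l\<in>S. (\<Sum>q\<in>R. M p q * W q l) * t l)"
        by (intro sum.cong refl) (simp add: WM[OF that])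
      also have "\<dots> = (\<Sum>q\<in>R. M p q * (\<Sum>l\<in>S. W q l * t l))"
        unfolding sum_distrib_left sum_distrib_right by (subst sum.swap) (simp add: mult.assoc)
      finally show ?thesis by (simp add: z)
    qed
    then have "r * cmod (t d) \<le> 0" using W[OF d, of t] by simp
    then show "t d = 0" using r by (simp add: mult_le_0_iff)
  qed
  have "\<exists>N. (\<forall>d\<in>S. \<forall>d'\<in>S. (\<Sum>q\<in>R. N d q * W q d') = (if d = d' then 1 else 0)) \<and>
    (\<forall>q\<in>R. \<forall>q'\<in>R. (\<Sum>d\<in>S. W q d * N d q') = (if q = q' then 1 else 0))"
    by (rule square_inverse_exists[OF finR finS R(2)]) (rule inj)
  then obtain N where
    "\<forall>q\<in>R. \<forall>q'\<in>R. (\<Sum>d\<in>S. W q d * N d q') = (if q = q' then 1 else 0)"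
    by blast
  then have N: "\<And>q q'. q \<in> R \<Longrightarrow> q' \<in> R \<Longrightarrow> (\<Sum>d\<in>S. W q d * N d q') = (if q = q' then 1 else 0)"
    by simp
  \<comment> \<open>A column of the inverse \<open>N\<close> is an admissible test vector for
    \<open>W\<close>: its image is a column of \<open>M\<close>, whose entries have modulus at most
    1, so the left side of the lower bound is at most \<open>b\<close>.\<close>
  have Nb: "cmod (N l q) \<le> b / r" if "l \<in> S" "q \<in> R" for l q
  proof -
    have "cmod (\<Sum>l\<in>S. W p l * N l q) \<le> 1" if "p < b" for p
    proof -
      have "(\<Sum>l\<in>S. W p l * N l q) = (\<Sum>l\<in>S. (\<Sum>q'\<in>R. M p q' * W q' l) * N l q)"
        by (intro sum.cong refl) (simp add: WM[OF that])
      also have "\<dots> = (\<Sum>q'\<in>R. M p q' * (\<Sum>l\<in>S. W q' l * N l q))"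
        unfolding sum_distrib_left sum_distrib_right by (subst sum.swap) (simp add: mult.assoc)
      also have "\<dots> = (\<Sum>q'\<in>R. if q' = q then M p q' else 0)"
        by (intro sum.cong refl) (simp add: N \<open>q \<in> R\<close>)
      also have "\<dots> = M p q" using finR \<open>q \<in> R\<close> by simp
      finally show ?thesis using M2[OF that \<open>q \<in> R\<close>] by simp
    qed
    then have "r * cmod (N l q) \<le> b"
      using W[OF \<open>l \<in> S\<close>, of "\<lambda>l. N l q"] sum_le_const[of "{..<b}" "\<lambda>p. cmod (\<Sum>l\<in>S. W p l * N l q)" 1 b] by simp
    then show ?thesis using r by (simp add: field_simps)
  qed
  define w where "w = (\<Sum>l\<in>S. cmod (\<Sum>p<b. W p l * y p))"
  define u where "u = (\<Sum>c<b. cmod (\<Sum>p<b. U p c * y p))"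
  have w0: "0 \<le> w" and u0: "0 \<le> u" by (auto simp: w_def u_def intro!: sum_nonneg)
  \<comment> \<open>\<open>W\<close> factors through \<open>M\<close>, so the pairings of
    \<open>y\<close> with \<open>W\<close> see only \<open>h\<close>, and \<open>N\<close> recovers
    \<open>h\<close> from them. Removing the contribution of \<open>h\<close> from the pairings with
    \<open>U\<close> leaves the matrix of \<open>Ut\<close>, acting on the coordinates of
    \<open>y\<close> off \<open>R\<close>.\<close>
  define h where "h q = (\<Sum>p<b. M p q * y p)" for q
  have Wh: "(\<Sum>p<b. W p l * y p) = (\<Sum>q\<in>R. h q * W q l)" if "l \<in> S" for l
  proof -
    have "(\<Sum>p<b. W p l * y p) = (\<Sum>p<b. (\<Sum>q\<in>R. M p q * W q l) * y p)"
      by (intro sum.cong refl) (simp add: WM[OF _ that])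
    also have "\<dots> = (\<Sum>q\<in>R. h q * W q l)"
      unfolding h_def sum_distrib_left sum_distrib_right by (subst sum.swap) (simp add: mult_ac)
    finally show ?thesis .
  qed
  have hb: "cmod (h q) \<le> b / r * w" if q: "q \<in> R" for q
  proof -
    have "(\<Sum>l\<in>S. (\<Sum>p<b. W p l * y p) * N l q) = (\<Sum>l\<in>S. (\<Sum>q'\<in>R. h q' * W q' l) * N l q)"
      by (intro sum.cong refl) (simp add: Wh)
    also have "\<dots> = (\<Sum>q'\<in>R. h q' * (\<Sum>l\<in>S. W q' l * N l q))"
      unfolding sum_distrib_left sum_distrib_right by (subst sum.swap) (simp add: mult.assoc)
    also have "\<dots> = (\<Sum>q'\<in>R. if q' = q then h q' else 0)"
      by (intro sum.cong refl) (simp add: N q)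
    also have "\<dots> = h q" using finR q by simp
    finally have "cmod (h q) = cmod (\<Sum>l\<in>S. (\<Sum>p<b. W p l * y p) * N l q)" by simp
    also have "\<dots> \<le> (\<Sum>l\<in>S. cmod (\<Sum>p<b. W p l * y p) * (b / r))"
      using Nb q by (intro order_trans[OF norm_sum] sum_mono) (simp add: norm_mult mult_left_mono del: times_divide_eq_right)
    also have "\<dots> = b / r * w" unfolding w_def by (simp add: sum_distrib_right[symmetric] sum_divide_distrib[symmetric])
    finally show ?thesis .
  qed
  have split: "(\<Sum>p<b. f p) = (\<Sum>p\<in>{..<b} - R. f p) + (\<Sum>p\<in>R. f p)" for f :: "nat \<Rightarrow> complex"
    using R by (simp add: sum.subset_diff)
  have hR: "h q = (\<Sum>i\<in>{..<b} - R. M i q * y i) + y q" if q: "q \<in> R" for q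
  proof -
    have "(\<Sum>p\<in>R. M p q * y p) = (\<Sum>p\<in>R. if p = q then y p else 0)"
      by (intro sum.cong refl) (simp add: M1 q)
    then show ?thesis using finR q by (simp add: h_def split)
  qed
  define t where "t = (u + real b ^ 3 * \<Lambda> / r * w) / r"
  have t0: "0 \<le> t" using u0 w0 r \<Lambda> by (simp add: t_def)
  have yc: "cmod (y i) \<le> t" if i: "i \<in> {..<b} - R" for i
  proof -
    have "(\<Sum>i\<in>{..<b} - R. (U i c - (\<Sum>l\<in>R. M i l * U l c)) * y i) = (\<Sum>p<b. U p c * y p) - (\<Sum>q\<in>R. U q c * h q)" for c
    proof -
      have "(\<Sum>i\<in>{..<b} - R. (\<Sum>l\<in>R. M i l * U l c) * y i) = (\<Sum>l\<in>R. U l c * (\<Sum>i\<in>{..<b} - R. M i l * y i))"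
        unfolding sum_distrib_left sum_distrib_right by (subst sum.swap) (simp add: mult_ac)
      also have "\<dots> = (\<Sum>l\<in>R. U l c * (h l - y l))"
        by (intro sum.cong refl) (simp add: hR)
      finally show ?thesis
        by (simp add: left_diff_distrib right_diff_distrib sum_subtractf split)
    qed
    then have "r * cmod (y i) \<le> (\<Sum>c<b. cmod ((\<Sum>p<b. U p c * y p) - (\<Sum>q\<in>R. U q c * h q)))"
      using Ut[OF i, of y] by simp
    also have "\<dots> \<le> (\<Sum>c<b. cmod (\<Sum>p<b. U p c * y p) + b * (\<Lambda> * (b / r * w)))"
    proof (rule sum_mono)
      fix c assume "c \<in> {..<b}"
      then have "cmod (\<Sum>q\<in>R. U q c * h q) \<le> b * (\<Lambda> * (b / r * w))"
        using R w0 r by (intro norm_sum_mult_le[OF _ hb cR \<Lambda>] U) auto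
      then show "cmod ((\<Sum>p<b. U p c * y p) - (\<Sum>q\<in>R. U q c * h q)) \<le> cmod (\<Sum>p<b. U p c * y p) + b * (\<Lambda> * (b / r * w))"
        using norm_triangle_ineq4[of "\<Sum>p<b. U p c * y p" "\<Sum>q\<in>R. U q c * h q"] by linarith
    qed
    also have "\<dots> = u + real b ^ 3 * \<Lambda> / r * w" by (simp add: sum.distrib u_def power3_eq_cube)
    finally show ?thesis using r by (simp add: t_def field_simps)
  qed
  have yall: "cmod (y p0) \<le> b / r * w + b * t"
  proof (cases "p0 \<in> R")
    case True
    have "cmod (\<Sum>i\<in>{..<b} - R. M i p0 * y i) \<le> b * (1 * t)"
      using True t0 yc M2 by (intro norm_sum_mult_le) (auto simp: card_Diff_subset finR R)
    moreover have "y p0 = h p0 - (\<Sum>i\<in>{..<b} - R. M i p0 * y i)" using hR[OF True] by simp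
    ultimately show ?thesis
      using hb[OF True] norm_triangle_ineq4[of "h p0" "\<Sum>i\<in>{..<b} - R. M i p0 * y i"] by simp
  next
    case False
    have "cmod (y p0) \<le> t" using False p0 by (intro yc) auto
    also have "t \<le> b * t" using t0 p0 by (simp add: mult_le_cancel_right1)
    finally show ?thesis using w0 r by (simp add: add_increasing)
  qed
  also have "b / r * w + b * t = b / r * (1 + real b ^ 3 * \<Lambda> / r) * w + b / r * u"
    by (simp add: t_def algebra_simps add_divide_distrib)
  also have "\<dots> \<le> b / r * (2 + real b ^ 3 * \<Lambda> / r) * w + b / r * (2 + real b ^ 3 * \<Lambda> / r) * u"
  proof -
    have g: "0 \<le> real b ^ 3 * \<Lambda> / r" using r \<Lambda> by simp
    have br: "0 \<le> b / r" using r by simp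
    have "b / r * 1 \<le> b / r * (2 + real b ^ 3 * \<Lambda> / r)" by (rule mult_left_mono[OF _ br]) (use g in linarith)
    moreover have "b / r * (1 + real b ^ 3 * \<Lambda> / r) \<le> b / r * (2 + real b ^ 3 * \<Lambda> / r)"
      by (rule mult_left_mono[OF _ br]) linarith
    ultimately show ?thesis by (intro add_mono mult_right_mono w0 u0) simp_all
  qed
  finally show ?thesis unfolding w_def u_def by (simp only: distrib_left of_nat_power)
qed


text \<open>The exact solutions of the \<open>b\<close> row equations in the \<open>d + b\<close>
  unknowns, that is \<open>e\<close> on \<open>S\<close> and the next block, form a kernel of
  dimension \<open>d\<close> again; forgetting the oldest block turns it into the next frame. Dual
  solvability puts an approximate solution near an exact one at cost \<open>\<Phi>\<close>. In the
  other direction, a small newest block forces the two older ones to be small at cost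
  \<open>Bk\<close>.\<close>

lemma step_propagation:
  fixes E :: "nat \<Rightarrow> nat \<Rightarrow> nat \<Rightarrow> complex"
  assumes fr: "frame b d S L" and db: "d \<le> b" and b1: "1 \<le> b" and r: "0 < r" and \<Lambda>: "1 \<le> \<Lambda>" and \<gamma>: "0 \<le> \<gamma>"
    and good: "good_step b r \<gamma> E S L"
    and E: "\<And>t p c. t < 3 \<Longrightarrow> p < b \<Longrightarrow> c < b \<Longrightarrow> cmod (E t p c) \<le> \<Lambda>"
  defines "\<Phi> \<equiv> 1 + 6 * real b ^ 4 * \<gamma> * \<Lambda>" and "Bk \<equiv> 1 + 3 * real b ^ 3 * \<Lambda> / r"
  shows "\<exists>S' L'. frame b d S' L' \<and> (\<forall>x0 x1 x2 e \<eta>.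
    graph_vec b S L e \<longrightarrow> (\<forall>c<b. cmod (x0 c - e (0, c)) \<le> \<eta> \<and> cmod (x1 c - e (1, c)) \<le> \<eta>) \<longrightarrow>
    (\<forall>a<b. cmod (row_value b E a x0 x1 x2) \<le> \<eta>) \<longrightarrow>
    (\<exists>e'. graph_vec b S' L' e' \<and> (\<forall>c<b. cmod (x1 c - e' (0, c)) \<le> \<Phi> * \<eta> \<and> cmod (x2 c - e' (1, c)) \<le> \<Phi> * \<eta>)) \<and>
    (\<forall>\<alpha>. (\<forall>c<b. cmod (x2 c) \<le> \<alpha>) \<longrightarrow> (\<forall>c<b. cmod (x0 c) \<le> Bk * (\<eta> + \<alpha>) \<and> cmod (x1 c) \<le> Bk * (\<eta> + \<alpha>))))"
proof -
  have S: "S \<subseteq> pair_index b" "card S = d"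
    and L1: "\<And>i l. i \<in> S \<Longrightarrow> l \<in> S \<Longrightarrow> L i l = (if i = l then 1 else 0)"
    and L2: "\<And>i l. i \<in> pair_index b \<Longrightarrow> l \<in> S \<Longrightarrow> cmod (L i l) \<le> 1"
    using fr by (auto simp: frame_def)
  have finS: "finite S" using fr by (rule frame_finite)
  define W where "W = restricted_row b E L"
  have good1: "r * cmod (x l0) \<le> (\<Sum>p<b. cmod (\<Sum>l\<in>S. W p l * x l))" if "l0 \<in> S" for x l0
    using good that unfolding good_step_def W_def by blast
  have good2: "cmod (y p0) \<le> \<gamma> * ((\<Sum>l\<in>S. cmod (\<Sum>p<b. W p l * y p)) + (\<Sum>c<b. cmod (\<Sum>p<b. E 2 p c * y p)))"
    if "p0 < b" for y p0 using good that unfolding good_step_def W_def by blast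
  \<comment> \<open>The unknowns of the linear system: the frame coordinates of the pair and the
    coordinates of the next block. \<open>G\<close> below is the transposed system, with one row per
    unknown.\<close>
  define N where "N = S <+> {..<b}"
  have finN: "finite N" using finS by (simp add: N_def)
  have cN: "card N = d + b" using finS S by (simp add: N_def card_Plus)
  have sumN: "(\<Sum>n\<in>N. f n) = (\<Sum>l\<in>S. f (Inl l)) + (\<Sum>c<b. f (Inr c))"
    for f :: "(nat \<times> nat) + nat \<Rightarrow> 'z::comm_monoid_add"
    unfolding N_def using finS by (simp add: sum.Plus)
  define G where "G n p = (case n of Inl l \<Rightarrow> W p l | Inr c \<Rightarrow> E 2 p c)" for n p
  have "card {..<b} \<le> card N" using cN by simp
  \<comment> \<open>The \<open>b\<close> unknowns in \<open>Q\<close> are the ones solved for; the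
    \<open>d\<close> unknowns in \<open>N - Q\<close> stay free. The bounded choice keeps the
    solution operator polynomial in \<open>b\<close>.\<close>
  then obtain Q M where Q: "Q \<subseteq> N" "card Q = card {..<b}"
    and M: "\<And>i l. i \<in> N \<Longrightarrow> l \<in> Q \<Longrightarrow> cmod (M i l) \<le> 1"
    and GM: "\<And>n p. n \<in> N \<Longrightarrow> p \<in> {..<b} \<Longrightarrow> G n p = (\<Sum>l\<in>Q. M n l * G l p)"
    by (rule bounded_row_basis[OF finite_lessThan finN, where U = G]) blast
  have finQ: "finite Q" using finite_subset[OF Q(1) finN] .
  have dual: "cmod (y p0) \<le> 2 * b * \<gamma> * (\<Sum>l\<in>Q. cmod (\<Sum>p<b. G l p * y p))" if "p0 < b" for y p0
  proof -
    have "cmod (\<Sum>p<b. G n p * y p) \<le> (\<Sum>l\<in>Q. cmod (\<Sum>p<b. G l p * y p))" if n: "n \<in> N" for n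
    proof -
      have "(\<Sum>p<b. G n p * y p) = (\<Sum>p<b. (\<Sum>l\<in>Q. M n l * G l p) * y p)"
        by (rule sum.cong[OF refl], subst GM[OF n]) auto
      also have "\<dots> = (\<Sum>l\<in>Q. M n l * (\<Sum>p<b. G l p * y p))"
        unfolding sum_distrib_left sum_distrib_right by (subst sum.swap) (simp add: mult.assoc)
      also have "cmod \<dots> \<le> (\<Sum>l\<in>Q. cmod (\<Sum>p<b. G l p * y p))"
        using M[OF n] by (intro order_trans[OF norm_sum] sum_mono) (simp add: norm_mult mult_left_le_one_le)
      finally show ?thesis .
    qed
    then have "(\<Sum>n\<in>N. cmod (\<Sum>p<b. G n p * y p)) \<le> (2 * b) * (\<Sum>l\<in>Q. cmod (\<Sum>p<b. G l p * y p))"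
      using cN db by (intro sum_le_const sum_nonneg) auto
    then have "\<gamma> * (\<Sum>n\<in>N. cmod (\<Sum>p<b. G n p * y p)) \<le> \<gamma> * ((2 * b) * (\<Sum>l\<in>Q. cmod (\<Sum>p<b. G l p * y p)))"
      using \<gamma> by (intro mult_left_mono) auto
    moreover have "cmod (y p0) \<le> \<gamma> * (\<Sum>n\<in>N. cmod (\<Sum>p<b. G n p * y p))"
      using good2[OF that, of y] by (simp add: sumN G_def)
    ultimately show ?thesis by (simp add: mult_ac)
  qed
  have inj: "\<forall>p\<in>{..<b}. y p = 0" if "\<And>l. l \<in> Q \<Longrightarrow> (\<Sum>p\<in>{..<b}. G l p * y p) = 0" for y
    using dual[of _ y] that by simp
  have "\<exists>V. (\<forall>p\<in>{..<b}. \<forall>p'\<in>{..<b}. (\<Sum>l\<in>Q. V p l * G l p') = (if p = p' then 1 else 0)) \<and>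
    (\<forall>l\<in>Q. \<forall>l'\<in>Q. (\<Sum>p\<in>{..<b}. G l p * V p l') = (if l = l' then 1 else 0))"
    by (rule square_inverse_exists[OF finQ finite_lessThan Q(2)]) (rule inj)
  then obtain V where "\<forall>l\<in>Q. \<forall>l'\<in>Q. (\<Sum>p<b. G l p * V p l') = (if l = l' then 1 else 0)"
    by blast
  then have V: "\<And>l l'. l \<in> Q \<Longrightarrow> l' \<in> Q \<Longrightarrow> (\<Sum>p<b. G l p * V p l') = (if l = l' then 1 else 0)" by simp
  have Vb: "cmod (V p l') \<le> 2 * b * \<gamma>" if "p < b" "l' \<in> Q" for p l'
  proof -
    have "(\<Sum>l\<in>Q. cmod (\<Sum>p<b. G l p * V p l')) = (\<Sum>l\<in>Q. if l = l' then 1 else 0)"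
      by (intro sum.cong refl) (simp add: V that)
    also have "\<dots> = 1" using finQ that by simp
    finally show ?thesis using dual[OF that(1), of "\<lambda>p. V p l'"] by simp
  qed
  \<comment> \<open>Kernel vector in which the free unknown \<open>f\<close> is 1 and the other free
    unknowns are 0; the relation \<open>GM\<close> dictates its values on \<open>Q\<close>. Next,
    \<open>u\<close> lists for each \<open>f\<close> the second and third block of the corresponding
    exact solution.\<close>
  define \<kappa> where "\<kappa> f n = (if n = f then 1 else if n \<in> Q then - M f n else 0)" for f n
  define u where "u i f = (if fst i = 0 then (\<Sum>l\<in>S. L (1, snd i) l * \<kappa> f (Inl l)) else \<kappa> f (Inr (snd i)))" for i :: "nat \<times> nat" and f
  have cNQ: "card (N - Q) = d" using Q cN finQ by (simp add: card_Diff_subset)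
  have "card (N - Q) \<le> card (pair_index b)" using cNQ db by simp
  then obtain S' L' where S': "S' \<subseteq> pair_index b" "card S' = card (N - Q)"
    and L'1: "\<And>i l. i \<in> S' \<Longrightarrow> l \<in> S' \<Longrightarrow> L' i l = (if i = l then 1 else 0)"
    and L'2: "\<And>i l. i \<in> pair_index b \<Longrightarrow> l \<in> S' \<Longrightarrow> cmod (L' i l) \<le> 1"
    and uL': "\<And>i f. i \<in> pair_index b \<Longrightarrow> f \<in> N - Q \<Longrightarrow> u i f = (\<Sum>l\<in>S'. L' i l * u l f)"
    by (rule bounded_row_basis[OF finite_Diff[OF finN] card_pair_index(1), where U = u]) blast
  have fr': "frame b d S' L'" using S' L'1 L'2 cNQ by (auto simp: frame_def)
  show ?thesis
  proof (intro exI[of _ S'] exI[of _ L'] conjI[OF fr'] allI impI)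
    fix x0 x1 x2 :: "nat \<Rightarrow> complex" and e :: "nat \<times> nat \<Rightarrow> complex" and \<eta> :: real
    assume e: "graph_vec b S L e"
      and xe: "\<forall>c<b. cmod (x0 c - e (0, c)) \<le> \<eta> \<and> cmod (x1 c - e (1, c)) \<le> \<eta>"
      and row: "\<forall>a<b. cmod (row_value b E a x0 x1 x2) \<le> \<eta>"
    have "cmod (row_value b E 0 x0 x1 x2) \<le> \<eta>" using row b1 by simp
    then have \<eta>0: "0 \<le> \<eta>" by (rule order_trans[OF norm_ge_zero])
    have eL: "e i = (\<Sum>l\<in>S. L i l * e l)" if "i \<in> pair_index b" for i
      using e that unfolding graph_vec_def by blast
    define g where "g p = (\<Sum>l\<in>S. W p l * e l) + (\<Sum>c<b. E 2 p c * x2 c)" for p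
    have We: "(\<Sum>l\<in>S. W p l * e l) = (\<Sum>c<b. E 0 p c * e (0, c)) + (\<Sum>c<b. E 1 p c * e (1, c))" for p
    proof -
      have "(\<Sum>l\<in>S. W p l * e l) = (\<Sum>i\<in>pair_index b. E (fst i) p (snd i) * (\<Sum>l\<in>S. L i l * e l))"
        unfolding W_def restricted_row_def sum_distrib_left sum_distrib_right by (subst sum.swap) (simp add: mult.assoc)
      also have "\<dots> = (\<Sum>i\<in>pair_index b. E (fst i) p (snd i) * e i)"
        by (rule sum.cong[OF refl], subst eL[symmetric]) auto
      finally show ?thesis by (simp add: pair_sum)
    qed
    have b\<Lambda>: "1 \<le> b * \<Lambda>" using b1 \<Lambda> mult_mono[of 1 "real b" 1 \<Lambda>] by simp
    have gb: "cmod (g p) \<le> 3 * (b * \<Lambda>) * \<eta>" if p: "p < b" for p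
    proof -
      have g: "g p = row_value b E p x0 x1 x2 - (\<Sum>c<b. E 0 p c * (x0 c - e (0, c))) - (\<Sum>c<b. E 1 p c * (x1 c - e (1, c)))"
        unfolding g_def We row_value_def by (simp add: right_diff_distrib sum_subtractf)
      have "cmod (\<Sum>c<b. E 0 p c * (x0 c - e (0, c))) \<le> b * (\<Lambda> * \<eta>)"
        using xe E p \<Lambda> \<eta>0 by (intro norm_sum_mult_le) auto
      moreover have "cmod (\<Sum>c<b. E 1 p c * (x1 c - e (1, c))) \<le> b * (\<Lambda> * \<eta>)"
        using xe E p \<Lambda> \<eta>0 by (intro norm_sum_mult_le) auto
      moreover have "cmod (row_value b E p x0 x1 x2) \<le> (b * \<Lambda>) * \<eta>"
        using row p mult_right_mono[OF b\<Lambda> \<eta>0] by fastforce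
      moreover have "cmod (g p) \<le> cmod (row_value b E p x0 x1 x2) + cmod (\<Sum>c<b. E 0 p c * (x0 c - e (0, c))) + cmod (\<Sum>c<b. E 1 p c * (x1 c - e (1, c)))"
        unfolding g by (intro order_trans[OF norm_triangle_ineq4] add_mono norm_triangle_ineq4 order_refl)
      ultimately show ?thesis by simp
    qed
    define z where "z n = (case n of Inl l \<Rightarrow> e l | Inr c \<Rightarrow> x2 c)" for n
    have Gz: "(\<Sum>n\<in>N. G n p * z n) = g p" for p by (simp add: sumN G_def z_def g_def)
    \<comment> \<open>The exact solution with the same free unknowns as \<open>z\<close>. The two
      differ on \<open>Q\<close> only, where the square system has inverse \<open>V\<close> and
      turns the residual \<open>g\<close> into the error \<open>\<theta>\<close>.\<close>
    define z' where "z' n = (\<Sum>f\<in>N - Q. \<kappa> f n * z f)" for n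
    have z'1: "z' n = z n" if "n \<in> N - Q" for n
    proof -
      have "z' n = (\<Sum>f\<in>N - Q. if n = f then z f else 0)"
        unfolding z'_def using that by (intro sum.cong refl) (auto simp: \<kappa>_def)
      then show ?thesis using that finN by simp
    qed
    have z'2: "z' n = - (\<Sum>f\<in>N - Q. M f n * z f)" if "n \<in> Q" for n
      unfolding z'_def sum_negf[symmetric] using that by (intro sum.cong refl) (auto simp: \<kappa>_def)
    have Gd: "(\<Sum>l\<in>Q. G l p * (z l - z' l)) = g p" if p: "p < b" for p
    proof -
      have "(\<Sum>l\<in>Q. G l p * (\<Sum>f\<in>N - Q. M f l * z f)) = (\<Sum>f\<in>N - Q. (\<Sum>l\<in>Q. M f l * G l p) * z f)"
        unfolding sum_distrib_left sum_distrib_right by (subst sum.swap) (simp add: mult_ac)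
      also have "\<dots> = (\<Sum>f\<in>N - Q. G f p * z f)"
        by (rule sum.cong[OF refl], subst GM[symmetric]) (use p in auto)
      finally have "(\<Sum>l\<in>Q. G l p * (z l - z' l)) = (\<Sum>l\<in>Q. G l p * z l) + (\<Sum>f\<in>N - Q. G f p * z f)"
        by (simp add: z'2 distrib_left sum.distrib)
      also have "\<dots> = g p" unfolding Gz[symmetric] using Q finN by (simp add: sum.subset_diff)
      finally show ?thesis .
    qed
    define \<theta> where "\<theta> = 6 * real b ^ 3 * \<gamma> * \<Lambda> * \<eta>"
    have \<theta>0: "0 \<le> \<theta>" using \<gamma> \<Lambda> \<eta>0 by (simp add: \<theta>_def)
    have dz: "cmod (z n - z' n) \<le> \<theta>" if n: "n \<in> N" for n
    proof (cases "n \<in> Q")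
      case True
      have "(\<Sum>p<b. V p n * g p) = (\<Sum>p<b. V p n * (\<Sum>l\<in>Q. G l p * (z l - z' l)))"
        by (intro sum.cong refl) (simp add: Gd)
      also have "\<dots> = (\<Sum>l\<in>Q. (\<Sum>p<b. G l p * V p n) * (z l - z' l))"
        unfolding sum_distrib_left sum_distrib_right by (subst sum.swap) (simp add: mult_ac)
      also have "\<dots> = (\<Sum>l\<in>Q. if l = n then z l - z' l else 0)"
        by (intro sum.cong refl) (simp add: V True)
      also have "\<dots> = z n - z' n" using finQ True by simp
      finally have "z n - z' n = (\<Sum>p<b. V p n * g p)" by simp
      also have "cmod \<dots> \<le> b * ((2 * b * \<gamma>) * (3 * (b * \<Lambda>) * \<eta>))"
        using gb Vb True \<gamma> \<eta>0 \<Lambda> by (intro norm_sum_mult_le) auto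
      also have "\<dots> = \<theta>" by (simp add: \<theta>_def power3_eq_cube)
      finally show ?thesis .
    next
      case False
      then show ?thesis using z'1 n \<theta>0 by simp
    qed
    define e' where "e' i = (\<Sum>f\<in>N - Q. u i f * z f)" for i
    have e'g: "graph_vec b S' L' e'" unfolding graph_vec_def
    proof
      fix i assume i: "i \<in> pair_index b"
      have "e' i = (\<Sum>f\<in>N - Q. (\<Sum>l\<in>S'. L' i l * u l f) * z f)"
        unfolding e'_def by (rule sum.cong[OF refl], subst uL'[OF i]) auto
      also have "\<dots> = (\<Sum>l\<in>S'. L' i l * e' l)"
        unfolding e'_def sum_distrib_left sum_distrib_right by (subst sum.swap) (simp add: mult.assoc)
      finally show "e' i = (\<Sum>l\<in>S'. L' i l * e' l)" .
    qed
    have e'0: "e' (0, c) = (\<Sum>l\<in>S. L (1, c) l * z' (Inl l))" for c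
      unfolding e'_def u_def z'_def sum_distrib_left sum_distrib_right by (subst sum.swap) (simp add: sum_distrib_right mult.assoc)
    have e'1: "e' (1, c) = z' (Inr c)" for c
      unfolding e'_def u_def z'_def by simp
    have \<Phi>\<eta>: "\<Phi> * \<eta> = \<eta> + b * \<theta>" by (simp add: \<Phi>_def \<theta>_def algebra_simps power3_eq_cube power4_eq_xxxx)
    have near: "cmod (x1 c - e' (0, c)) \<le> \<Phi> * \<eta>" "cmod (x2 c - e' (1, c)) \<le> \<Phi> * \<eta>" if c: "c < b" for c
    proof -
      have c1: "(1, c) \<in> pair_index b" using c by (simp add: pair_index_def)
      have "e (1, c) - e' (0, c) = (\<Sum>l\<in>S. L (1, c) l * (z (Inl l) - z' (Inl l)))"
        unfolding e'0 by (subst eL[OF c1]) (simp add: z_def right_diff_distrib sum_subtractf)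
      also have "cmod \<dots> \<le> b * (1 * \<theta>)"
        using L2[OF c1] dz S db \<theta>0 by (intro norm_sum_mult_le) (auto simp: N_def)
      finally have "cmod (e (1, c) - e' (0, c)) \<le> b * \<theta>" by simp
      moreover have "cmod (x1 c - e' (0, c)) \<le> cmod (x1 c - e (1, c)) + cmod (e (1, c) - e' (0, c))"
        using norm_triangle_ineq[of "x1 c - e (1, c)" "e (1, c) - e' (0, c)"] by simp
      ultimately show "cmod (x1 c - e' (0, c)) \<le> \<Phi> * \<eta>" using xe c unfolding \<Phi>\<eta> by fastforce
      have "cmod (x2 c - e' (1, c)) \<le> \<theta>" unfolding e'1 using dz[of "Inr c"] c by (simp add: z_def N_def InrI)
      also have "\<theta> \<le> b * \<theta>" using mult_right_mono[of 1 "real b" \<theta>] b1 \<theta>0 by simp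
      finally show "cmod (x2 c - e' (1, c)) \<le> \<Phi> * \<eta>" unfolding \<Phi>\<eta> using \<eta>0 by simp
    qed
    have ex: "\<exists>e'. graph_vec b S' L' e' \<and> (\<forall>c<b. cmod (x1 c - e' (0, c)) \<le> \<Phi> * \<eta> \<and> cmod (x2 c - e' (1, c)) \<le> \<Phi> * \<eta>)"
      using e'g near by blast
    \<comment> \<open>With \<open>x2\<close> small the restricted rows nearly annihilate
      \<open>e\<close>; the first clause of \<open>good_step\<close> bounds \<open>e\<close> on
      \<open>S\<close>, and the frame extends the bound to both blocks.\<close>
    have backward: "cmod (x0 c) \<le> Bk * (\<eta> + \<alpha>) \<and> cmod (x1 c) \<le> Bk * (\<eta> + \<alpha>)"
      if \<alpha>: "\<forall>c<b. cmod (x2 c) \<le> \<alpha>" and c: "c < b" for \<alpha> c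
    proof -
    have \<alpha>0: "0 \<le> \<alpha>" by (rule order_trans[OF norm_ge_zero]) (use \<alpha> c in blast)
    define \<tau> where "\<tau> = 3 * real b ^ 2 * \<Lambda> / r * (\<eta> + \<alpha>)"
    have \<tau>0: "0 \<le> \<tau>" using \<Lambda> \<eta>0 \<alpha>0 r by (simp add: \<tau>_def)
    have eb: "cmod (e l0) \<le> \<tau>" if "l0 \<in> S" for l0
    proof -
      have "cmod (\<Sum>l\<in>S. W p l * e l) \<le> 3 * (b * \<Lambda>) * (\<eta> + \<alpha>)" if p: "p < b" for p
      proof -
        have "cmod (\<Sum>c<b. E 2 p c * x2 c) \<le> b * (\<Lambda> * \<alpha>)"
          using \<alpha> E p \<Lambda> \<alpha>0 by (intro norm_sum_mult_le) auto
        moreover have "(\<Sum>l\<in>S. W p l * e l) = g p - (\<Sum>c<b. E 2 p c * x2 c)" by (simp add: g_def)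
        ultimately have "cmod (\<Sum>l\<in>S. W p l * e l) \<le> 3 * (b * \<Lambda>) * \<eta> + (b * \<Lambda>) * \<alpha>"
          using gb[OF p] norm_triangle_ineq4[of "g p" "\<Sum>c<b. E 2 p c * x2 c"] by simp
        also have "\<dots> \<le> 3 * (b * \<Lambda>) * (\<eta> + \<alpha>)"
        proof -
          have "0 \<le> (b * \<Lambda>) * \<alpha>" using \<Lambda> \<alpha>0 by (intro mult_nonneg_nonneg) auto
          then show ?thesis by (simp add: distrib_left mult_ac)
        qed
        finally show ?thesis .
      qed
      then have "r * cmod (e l0) \<le> b * (3 * (b * \<Lambda>) * (\<eta> + \<alpha>))"
        using \<eta>0 \<alpha>0 b\<Lambda> by (intro order_trans[OF good1[OF that]] sum_le_const) auto
      then show ?thesis using r by (simp add: \<tau>_def field_simps power2_eq_square)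
    qed
    have ei: "cmod (e i) \<le> b * \<tau>" if "i \<in> pair_index b" for i
    proof -
      have "cmod (\<Sum>l\<in>S. L i l * e l) \<le> b * (1 * \<tau>)"
        using L2[OF that] eb S db \<tau>0 by (intro norm_sum_mult_le) auto
      then show ?thesis by (subst eL[OF that]) simp
    qed
    have "Bk * (\<eta> + \<alpha>) = (\<eta> + \<alpha>) + b * \<tau>"
      by (simp add: Bk_def \<tau>_def algebra_simps power2_eq_square power3_eq_cube add_divide_distrib)
    moreover have "cmod (x0 c) \<le> \<eta> + b * \<tau>"
      using xe c ei[of "(0, c)"] norm_triangle_ineq2[of "x0 c" "e (0, c)"] by (fastforce simp: pair_index_def)
    moreover have "cmod (x1 c) \<le> \<eta> + b * \<tau>"
      using xe c ei[of "(1, c)"] norm_triangle_ineq2[of "x1 c" "e (1, c)"] by (fastforce simp: pair_index_def)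
    ultimately show ?thesis using \<alpha>0 by auto
    qed
    show "(\<exists>e'. graph_vec b S' L' e' \<and> (\<forall>c<b. cmod (x1 c - e' (0, c)) \<le> \<Phi> * \<eta> \<and> cmod (x2 c - e' (1, c)) \<le> \<Phi> * \<eta>)) \<and>
      (\<forall>\<alpha>. (\<forall>c<b. cmod (x2 c) \<le> \<alpha>) \<longrightarrow> (\<forall>c<b. cmod (x0 c) \<le> Bk * (\<eta> + \<alpha>) \<and> cmod (x1 c) \<le> Bk * (\<eta> + \<alpha>)))"
      using ex backward by blast
  qed
qed


context atom_dist
begin

text \<open>Two tall matrices are involved. The restricted rows form a matrix with \<open>b\<close>
  rows and \<open>d\<close> columns, giving the exponent \<open>b + 1 - d\<close>. Given the first
  two blocks, the third one reduced modulo the image of the restricted rows has \<open>b - d\<close>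
  rows and \<open>b\<close> columns, so its transpose is tall and gives
  \<open>d + 1\<close>.\<close>

lemma step_probability:
  fixes \<psi> :: "nat \<Rightarrow> nat \<Rightarrow> nat \<Rightarrow> 'i" and sh :: "nat \<Rightarrow> nat \<Rightarrow> nat \<Rightarrow> complex" and q r \<Lambda> :: real
  assumes finJ: "finite J" and \<psi>J: "\<And>t a c. t < 3 \<Longrightarrow> a < b \<Longrightarrow> c < b \<Longrightarrow> \<psi> t a c \<in> J"
    and \<psi>inj: "\<And>t a c t' a' c'. t < 3 \<Longrightarrow> a < b \<Longrightarrow> c < b \<Longrightarrow> t' < 3 \<Longrightarrow> a' < b \<Longrightarrow> c' < b \<Longrightarrow>
      \<psi> t a c = \<psi> t' a' c' \<Longrightarrow> t = t' \<and> a = a' \<and> c = c'"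
    and fr: "frame b d S L" and db: "d \<le> b" and r: "0 < r" and \<Lambda>: "0 \<le> \<Lambda>"
    and conc: "\<And>a. measure \<mu> (ball a r) \<le> q"
  defines "E \<equiv> (\<lambda>\<omega> t a c. \<omega> (\<psi> t a c) + sh t a c)"
    and "\<gamma> \<equiv> b / r * (2 + real b ^ 3 * \<Lambda> / r)"
  shows "\<exists>B\<in>sets (iid J). measure (iid J) B \<le> real d * q ^ (b + 1 - d) + real (b - d) * q ^ (d + 1) \<and>
    (\<forall>\<omega>\<in>space (iid J) - B. (\<forall>t<3. \<forall>a<b. \<forall>c<b. cmod (E \<omega> t a c) \<le> \<Lambda>) \<longrightarrow> good_step b r \<gamma> (E \<omega>) S L)"
proof -
  interpret J: prob_space "iid J" by (rule prob_space_iid)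
  have S: "S \<subseteq> pair_index b" "card S = d"
    and L1: "\<And>i l. i \<in> S \<Longrightarrow> l \<in> S \<Longrightarrow> L i l = (if i = l then 1 else 0)"
    using fr by (auto simp: frame_def)
  have finS: "finite S" using fr by (rule frame_finite)
  have Pb: "fst i < 2" "fst i < 3" "snd i < b" if "i \<in> pair_index b" for i
    using that by (auto simp: pair_index_def)
  have Sb: "fst i < 3" "snd i < b" if "i \<in> S" for i using Pb[of i] S that by auto
  define W where "W \<omega> = restricted_row b (E \<omega>) L" for \<omega>
  have Em: "(\<lambda>\<omega>. E \<omega> t a c) \<in> borel_measurable (iid J)" if "t < 3" "a < b" "c < b" for t a c
    unfolding E_def using that by (intro borel_measurable_add coord_measurable \<psi>J) auto
  have Wm: "(\<lambda>\<omega>. W \<omega> p l) \<in> borel_measurable (iid J)" if "p < b" for p l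
    unfolding W_def restricted_row_def using that Pb
    by (intro borel_measurable_sum borel_measurable_times Em) auto
  define B1 where "B1 = {\<omega> \<in> space (iid J). \<exists>x. \<exists>l0\<in>S. (\<Sum>p<b. cmod (\<Sum>l\<in>S. W \<omega> p l * x l)) < r * cmod (x l0)}"
  \<comment> \<open>Because \<open>L\<close> is the identity on \<open>S\<close>, the entry of
    \<open>W\<close> at \<open>(p, l)\<close> contains exactly one atom from the columns in
    \<open>S\<close>; all other atoms come from coordinates off \<open>S\<close> and go into the
    shift.\<close>
  define F where "F \<omega> p l = sh (fst l) p (snd l) + (\<Sum>i\<in>pair_index b - S. E \<omega> (fst i) p (snd i) * L i l)" for \<omega> p l
  have WF: "W \<omega> p l = \<omega> (\<psi> (fst l) p (snd l)) + F \<omega> p l" if "l \<in> S" for \<omega> p l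
  proof -
    have "W \<omega> p l = (\<Sum>i\<in>pair_index b - S. E \<omega> (fst i) p (snd i) * L i l) + (\<Sum>i\<in>S. E \<omega> (fst i) p (snd i) * L i l)"
      unfolding W_def restricted_row_def using S by (simp add: sum.subset_diff)
    also have "(\<Sum>i\<in>S. E \<omega> (fst i) p (snd i) * L i l) = (\<Sum>i\<in>S. if i = l then E \<omega> (fst i) p (snd i) else 0)"
      using that by (intro sum.cong refl) (simp add: L1)
    also have "\<dots> = E \<omega> (fst l) p (snd l)" using finS that by simp
    finally show ?thesis by (simp add: F_def E_def)
  qed
  have "B1 = {\<omega> \<in> space (iid J). \<exists>x. \<exists>l0\<in>S.
      (\<Sum>p\<in>{..<b}. cmod (\<Sum>l\<in>S. (\<omega> (\<psi> (fst l) p (snd l)) + F \<omega> p l) * x l)) < r * cmod (x l0)}"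
    unfolding B1_def by (simp add: WF cong: sum.cong)
  moreover have "\<dots> \<in> sets (iid J)" "measure (iid J) \<dots> \<le> card S * q ^ (card {..<b} + 1 - card S)"
  proof -
    have inj: "p = p' \<and> k = k'" if "p \<in> {..<b}" "k \<in> S" "p' \<in> {..<b}" "k' \<in> S"
      "\<psi> (fst k) p (snd k) = \<psi> (fst k') p' (snd k')" for p k p' k'
    proof -
      have "fst k = fst k' \<and> p = p' \<and> snd k = snd k'"
        using that Sb by (intro \<psi>inj) auto
      then show ?thesis by (simp add: prod_eq_iff)
    qed
    have indep: "F \<omega> p k = F \<omega>' p k" if "p \<in> {..<b}" "k \<in> S"
      and agree: "\<forall>i\<in>J. (\<forall>p\<in>{..<b}. \<forall>k\<in>S. i \<noteq> \<psi> (fst k) p (snd k)) \<longrightarrow> \<omega> i = \<omega>' i" for \<omega> \<omega>' p k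
    proof -
      have "\<omega> (\<psi> (fst i) p (snd i)) = \<omega>' (\<psi> (fst i) p (snd i))" if i: "i \<in> pair_index b - S" for i
      proof (rule agree[rule_format])
        have "fst i < 3" "snd i < b" using Pb[of i] i by auto
        then show "\<psi> (fst i) p (snd i) \<in> J" using \<open>p \<in> {..<b}\<close> by (intro \<psi>J) auto
        fix p' k' assume "p' \<in> {..<b}" "k' \<in> S"
        show "\<psi> (fst i) p (snd i) \<noteq> \<psi> (fst k') p' (snd k')"
        proof
          assume "\<psi> (fst i) p (snd i) = \<psi> (fst k') p' (snd k')"
          then have "fst i = fst k' \<and> p = p' \<and> snd i = snd k'"
            using Sb[OF \<open>k' \<in> S\<close>] \<open>fst i < 3\<close> \<open>snd i < b\<close> \<open>p \<in> {..<b}\<close> \<open>p' \<in> {..<b}\<close> by (intro \<psi>inj) auto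
          then show False using i \<open>k' \<in> S\<close> by (metis DiffE prod_eqI)
        qed
      qed
      then show ?thesis unfolding F_def E_def by simp
    qed
    have Fm: "(\<lambda>\<omega>. F \<omega> p k) \<in> borel_measurable (iid J)" if "p \<in> {..<b}" "k \<in> S" for p k
      unfolding F_def using that Pb
      by (intro borel_measurable_sum borel_measurable_times borel_measurable_add Em) auto
    have I: "\<psi> (fst k) p (snd k) \<in> J" if "p \<in> {..<b}" "k \<in> S" for p k
      using that Sb by (intro \<psi>J) auto
    have c: "card S \<le> card {..<b}" using S db by simp
    show "{\<omega> \<in> space (iid J). \<exists>x. \<exists>l0\<in>S.
      (\<Sum>p\<in>{..<b}. cmod (\<Sum>l\<in>S. (\<omega> (\<psi> (fst l) p (snd l)) + F \<omega> p l) * x l)) < r * cmod (x l0)} \<in> sets (iid J)"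
      by (rule tall_matrix_bound(1)[OF finJ finite_lessThan finS c I inj Fm indep conc])
    show "measure (iid J) {\<omega> \<in> space (iid J). \<exists>x. \<exists>l0\<in>S.
      (\<Sum>p\<in>{..<b}. cmod (\<Sum>l\<in>S. (\<omega> (\<psi> (fst l) p (snd l)) + F \<omega> p l) * x l)) < r * cmod (x l0)}
      \<le> card S * q ^ (card {..<b} + 1 - card S)"
      by (rule tall_matrix_bound(2)[OF finJ finite_lessThan finS c I inj Fm indep conc])
  qed
  ultimately have B1: "B1 \<in> sets (iid J)" "measure (iid J) B1 \<le> real d * q ^ (b + 1 - d)" using S by simp_all
  define V where "V \<omega> y = (\<Sum>l\<in>S. cmod (\<Sum>p<b. W \<omega> p l * y p)) + (\<Sum>c<b. cmod (\<Sum>p<b. E \<omega> 2 p c * y p))" for \<omega> y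
  define B2 where "B2 = (\<Union>p0<b. {\<omega> \<in> space (iid J). \<exists>y. \<gamma> * V \<omega> y < cmod (y p0)})"
  have B2: "B2 \<in> sets (iid J)"
    unfolding B2_def
  proof (intro sets.finite_UN finite_lessThan ex_open_measurable)
    fix p0 \<omega> show "open {y. \<gamma> * V \<omega> y < cmod (y p0)}" unfolding V_def
      by (intro open_Collect_less continuous_intros continuous_on_product_coordinates)
  next
    fix p0 and y :: "nat \<Rightarrow> complex"
    have [measurable]: "(\<lambda>\<omega>. V \<omega> y) \<in> borel_measurable (iid J)" unfolding V_def
      by (intro borel_measurable_add borel_measurable_sum measurable_compose[OF _ borel_measurable_norm]
          borel_measurable_times Em Wm) auto
    show "{\<omega> \<in> space (iid J). \<gamma> * V \<omega> y < cmod (y p0)} \<in> sets (iid J)" by measurable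
  qed
  define Bd where "Bd = (\<Inter>t<3. \<Inter>a<b. \<Inter>c<b. {\<omega> \<in> space (iid J). cmod (E \<omega> t a c) \<le> \<Lambda>})"
  show ?thesis
  proof (cases "b = 0")
    case True
    then have "S = {}" using S db finS by simp
    show ?thesis using True db by (intro bexI[of _ "{}"]) (auto simp: good_step_def \<open>S = {}\<close> \<open>b = 0\<close>)
  next
    case False
    then have b0: "0 < b" by simp
    have Bd: "Bd \<in> sets (iid J)" unfolding Bd_def
    proof (intro sets.finite_INT)
      fix t a c assume tac: "t \<in> {..<3::nat}" "a \<in> {..<b}" "c \<in> {..<b}"
      have [measurable]: "(\<lambda>\<omega>. E \<omega> t a c) \<in> borel_measurable (iid J)" using tac by (intro Em) auto
      show "{\<omega> \<in> space (iid J). cmod (E \<omega> t a c) \<le> \<Lambda>} \<in> sets (iid J)" by measurable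
    qed (use b0 in \<open>auto simp: lessThan_empty_iff\<close>)
    \<comment> \<open>The dual bound involves \<open>\<gamma>\<close>, hence the entry bound
      \<open>\<Lambda>\<close>; so only the part of \<open>B2\<close> with bounded entries is
      estimated, and only where the injectivity of the restricted rows has not failed.\<close>
    define A where "A = (B2 \<inter> Bd) - B1"
    have A: "A \<in> sets (iid J)" unfolding A_def using B1 B2 Bd by auto
    \<comment> \<open>Exposing only the third block keeps \<open>W\<close> fixed, and with it the
      rows \<open>R\<close> and coefficients \<open>M\<close> chosen from \<open>W\<close>; no
      measurability of that choice is involved.\<close>
    define Jc where "Jc = (\<lambda>(i, c). \<psi> 2 i c) ` ({..<b} \<times> {..<b})"
    have Jc: "Jc \<subseteq> J" unfolding Jc_def by (auto intro!: \<psi>J)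
    have finJc: "finite Jc" unfolding Jc_def by simp
    have q0: "0 \<le> q" using conc[of 0] measure_nonneg[of \<mu> "ball 0 r"] by linarith
    have PA: "measure (iid J) A \<le> real (b - d) * q ^ (d + 1)"
    proof (rule prob_le_sections[OF finJ Jc A])
      show "0 \<le> real (b - d) * q ^ (d + 1)" using q0 by simp
      fix x0 :: "'i \<Rightarrow> complex"
      define mg where "mg y = merge (J - Jc) Jc (x0, y)" for y :: "'i \<Rightarrow> complex"
      define \<omega>0 where "\<omega>0 = mg (\<lambda>_. 0)"
      have mgE: "E (mg y) t a c = E \<omega>0 t a c" if "t < 2" "a < b" "c < b" for y t a c
      proof -
        have "\<psi> t a c \<notin> Jc"
        proof
          assume "\<psi> t a c \<in> Jc"
          then obtain i c' where "i < b" "c' < b" "\<psi> t a c = \<psi> 2 i c'" by (auto simp: Jc_def)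
          then have "t = 2" using \<psi>inj[of t a c 2 i c'] that by auto
          then show False using that by simp
        qed
        then show ?thesis by (simp add: E_def mg_def \<omega>0_def merge_def)
      qed
      have WW: "W (mg y) p l = W \<omega>0 p l" if "p < b" for y p l
        unfolding W_def restricted_row_def using that Pb by (intro sum.cong refl) (simp add: mgE)
      have mgc: "mg y (\<psi> 2 i c) = y (\<psi> 2 i c)" if "i < b" "c < b" for y i c
      proof -
        have "\<psi> 2 i c \<in> Jc" using that by (auto simp: Jc_def)
        then show ?thesis by (simp add: mg_def merge_def)
      qed
      show "measure (iid Jc) {y \<in> space (iid Jc). merge (J - Jc) Jc (x0, y) \<in> A} \<le> real (b - d) * q ^ (d + 1)"
      proof (cases "\<forall>x. \<forall>l0\<in>S. r * cmod (x l0) \<le> (\<Sum>p<b. cmod (\<Sum>l\<in>S. W \<omega>0 p l * x l))")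
        case False
        then obtain x l0 where x: "l0 \<in> S" "(\<Sum>p<b. cmod (\<Sum>l\<in>S. W \<omega>0 p l * x l)) < r * cmod (x l0)"
          by (auto simp: not_le)
        have "mg y \<in> B1" for y
        proof -
          have "(\<Sum>p<b. cmod (\<Sum>l\<in>S. W (mg y) p l * x l)) < r * cmod (x l0)" using x by (simp add: WW)
          then show ?thesis unfolding B1_def mg_def using x merge_space[OF Jc] by blast
        qed
        then have none: "{y \<in> space (iid Jc). merge (J - Jc) Jc (x0, y) \<in> A} = {}"
          by (auto simp: A_def mg_def)
        show ?thesis unfolding none using q0 by simp
      next
        case True
        have cS: "card S \<le> card {..<b}" using S db by simp
        then obtain R M where R: "R \<subseteq> {..<b}" "card R = card S"
          and M1: "\<And>i l. i \<in> R \<Longrightarrow> l \<in> R \<Longrightarrow> M i l = (if i = l then 1 else 0)"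
          and M2: "\<And>i l. i \<in> {..<b} \<Longrightarrow> l \<in> R \<Longrightarrow> cmod (M i l) \<le> 1"
          and WM: "\<And>i c. i \<in> {..<b} \<Longrightarrow> c \<in> S \<Longrightarrow> W \<omega>0 i c = (\<Sum>l\<in>R. M i l * W \<omega>0 l c)"
          by (rule bounded_row_basis[OF finS finite_lessThan, where U = "W \<omega>0"]) blast
        define K where "K = {..<b} - R"
        have finK: "finite K" by (simp add: K_def)
        have "card K = b - d" unfolding K_def using R S finite_subset[OF R(1)] by (simp add: card_Diff_subset)
        \<comment> \<open>With this shift \<open>y (\<psi> 2 i c) + F y c i\<close> is the third
          block reduced modulo the rows \<open>R\<close>, as in a Schur complement. The shift reads
          atoms of rows in \<open>R\<close> only, which are disjoint from those of rows in
          \<open>K\<close>. Rows and columns exchange roles: the columns \<open>c\<close> now index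
          the equations.\<close>
        define F where "F y c i = sh 2 i c - (\<Sum>l\<in>R. M i l * (y (\<psi> 2 l c) + sh 2 l c))" for y c i
        define B2' where "B2' = {y \<in> space (iid Jc). \<exists>x. \<exists>k0\<in>K.
          (\<Sum>c\<in>{..<b}. cmod (\<Sum>i\<in>K. (y (\<psi> 2 i c) + F y c i) * x i)) < r * cmod (x k0)}"
        have inJc: "\<psi> 2 i c \<in> Jc" if "i < b" "c < b" for i c using that by (auto simp: Jc_def)
        have cK: "card K \<le> card {..<b}" using \<open>card K = b - d\<close> by simp
        have a1: "\<psi> 2 k p \<in> Jc" if "p \<in> {..<b}" "k \<in> K" for p k using that by (intro inJc) (auto simp: K_def)
        have a2: "p = p' \<and> k = k'" if "p \<in> {..<b}" "k \<in> K" "p' \<in> {..<b}" "k' \<in> K" "\<psi> 2 k p = \<psi> 2 k' p'" for p k p' k'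
          using \<psi>inj[of 2 k p 2 k' p'] that by (auto simp: K_def)
        have a3: "(\<lambda>y. F y p k) \<in> borel_measurable (iid Jc)" if "p \<in> {..<b}" "k \<in> K" for p k
          unfolding F_def using that R
          by (intro borel_measurable_diff borel_measurable_sum borel_measurable_times borel_measurable_add coord_measurable inJc) auto
        have a4: "F y p k = F y' p k" if "p \<in> {..<b}" "k \<in> K"
          and agree: "\<forall>i\<in>Jc. (\<forall>p\<in>{..<b}. \<forall>k\<in>K. i \<noteq> \<psi> 2 k p) \<longrightarrow> y i = y' i" for y y' p k
        proof -
          have "y (\<psi> 2 l p) = y' (\<psi> 2 l p)" if l: "l \<in> R" for l
          proof (rule agree[rule_format])
            have lb: "l < b" using l R by auto
            then show "\<psi> 2 l p \<in> Jc" using \<open>p \<in> {..<b}\<close> by (intro inJc) auto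
            fix p' k' assume "p' \<in> {..<b}" "k' \<in> K"
            then show "\<psi> 2 l p \<noteq> \<psi> 2 k' p'"
              using \<psi>inj[of 2 l p 2 k' p'] lb l \<open>p \<in> {..<b}\<close> by (auto simp: K_def)
          qed
          then show ?thesis unfolding F_def by simp
        qed
        have B2'm: "B2' \<in> sets (iid Jc)" unfolding B2'_def
          by (rule tall_matrix_bound(1)[OF finJc finite_lessThan finK cK a1 a2 a3 a4 conc])
        have "measure (iid Jc) B2' \<le> card K * q ^ (card {..<b} + 1 - card K)" unfolding B2'_def
          by (rule tall_matrix_bound(2)[OF finJc finite_lessThan finK cK a1 a2 a3 a4 conc])
        then have PB: "measure (iid Jc) B2' \<le> real (b - d) * q ^ (d + 1)" using \<open>card K = b - d\<close> db by simp
        have "{y \<in> space (iid Jc). merge (J - Jc) Jc (x0, y) \<in> A} \<subseteq> B2'"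
        proof (rule subsetI, rule ccontr)
          fix y assume y: "y \<in> {y \<in> space (iid Jc). merge (J - Jc) Jc (x0, y) \<in> A}" and nB: "y \<notin> B2'"
          have yA: "mg y \<in> B2" "mg y \<in> Bd" using y by (auto simp: A_def mg_def)
          obtain p0 v where p0: "p0 < b" and v: "\<gamma> * V (mg y) v < cmod (v p0)" using yA(1) by (auto simp: B2_def)
          have "cmod (v p0) \<le> b / r * (2 + real b ^ 3 * \<Lambda> / r) *
            ((\<Sum>l\<in>S. cmod (\<Sum>p<b. W \<omega>0 p l * v p)) + (\<Sum>c<b. cmod (\<Sum>p<b. E (mg y) 2 p c * v p)))"
          proof (rule dual_lower_bound[OF finS R r \<Lambda> M1 _ _ _ _ _ p0])
            show "cmod (M i l) \<le> 1" if "i < b" "l \<in> R" for i l using M2 that by simp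
            show "W \<omega>0 i c = (\<Sum>l\<in>R. M i l * W \<omega>0 l c)" if "i < b" "c \<in> S" for i c
              by (rule WM) (use that in auto)
            show "r * cmod (x l0) \<le> (\<Sum>p<b. cmod (\<Sum>l\<in>S. W \<omega>0 p l * x l))" if "l0 \<in> S" for x l0
              using True that by blast
            show "cmod (E (mg y) 2 p c) \<le> \<Lambda>" if "p < b" "c < b" for p c
              using yA(2) that by (auto simp: Bd_def)
            fix x i0 assume i0: "i0 \<in> {..<b} - R"
            have "y (\<psi> 2 i c) + F y c i = E (mg y) 2 i c - (\<Sum>l\<in>R. M i l * E (mg y) 2 l c)" if "i < b" "c < b" for i c
            proof -
              have "mg y (\<psi> 2 l c) = y (\<psi> 2 l c)" if "l \<in> R" for l using mgc[of l c y] that R \<open>c < b\<close> by auto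
              then show ?thesis using mgc[OF that, of y] by (simp add: F_def E_def)
            qed
            then have "(\<Sum>c\<in>{..<b}. cmod (\<Sum>i\<in>K. (y (\<psi> 2 i c) + F y c i) * x i)) =
              (\<Sum>c<b. cmod (\<Sum>i\<in>{..<b} - R. (E (mg y) 2 i c - (\<Sum>l\<in>R. M i l * E (mg y) 2 l c)) * x i))"
              by (intro sum.cong refl arg_cong[where f = cmod]) (auto simp: K_def)
            moreover have "r * cmod (x i0) \<le> (\<Sum>c\<in>{..<b}. cmod (\<Sum>i\<in>K. (y (\<psi> 2 i c) + F y c i) * x i))"
            proof (rule ccontr)
              assume "\<not> ?thesis"
              then have "y \<in> B2'" unfolding B2'_def using y i0 by (auto simp: K_def not_le)
              then show False using nB by simp
            qed
            ultimately show "r * cmod (x i0) \<le> (\<Sum>c<b. cmod (\<Sum>i\<in>{..<b} - R. (E (mg y) 2 i c - (\<Sum>l\<in>R. M i l * E (mg y) 2 l c)) * x i))"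
              by simp
          qed
          then have "cmod (v p0) \<le> \<gamma> * V (mg y) v" by (simp add: V_def \<gamma>_def WW)
          then show False using v by simp
        qed
        then have "measure (iid Jc) {y \<in> space (iid Jc). merge (J - Jc) Jc (x0, y) \<in> A} \<le> measure (iid Jc) B2'"
          by (intro finite_measure.finite_measure_mono[OF prob_space.finite_measure[OF prob_space_iid]] B2'm)
        then show ?thesis using PB by simp
      qed
    qed
    show ?thesis
    proof (intro bexI[of _ "B1 \<union> A"] conjI ballI impI)
      show "B1 \<union> A \<in> sets (iid J)" using B1 A by auto
      have "measure (iid J) (B1 \<union> A) \<le> measure (iid J) B1 + measure (iid J) A"
        using B1 A by (intro measure_Un_le) auto
      then show "measure (iid J) (B1 \<union> A) \<le> real d * q ^ (b + 1 - d) + real (b - d) * q ^ (d + 1)"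
        using B1 PA by simp
      fix \<omega> assume \<omega>: "\<omega> \<in> space (iid J) - (B1 \<union> A)" and bd: "\<forall>t<3. \<forall>a<b. \<forall>c<b. cmod (E \<omega> t a c) \<le> \<Lambda>"
      have "\<omega> \<in> Bd" unfolding Bd_def using bd \<omega> by auto
      then have n1: "\<omega> \<notin> B1" and n2: "\<omega> \<notin> B2" using \<omega> by (auto simp: A_def)
      have "r * cmod (x l0) \<le> (\<Sum>p<b. cmod (\<Sum>l\<in>S. W \<omega> p l * x l))" if "l0 \<in> S" for x l0
        using n1 that \<omega> unfolding B1_def by (force simp: not_less)
      moreover have "cmod (y p0) \<le> \<gamma> * V \<omega> y" if "p0 < b" for y p0
        using n2 that \<omega> unfolding B2_def by (force simp: not_less)
      ultimately show "good_step b r \<gamma> (E \<omega>) S L" unfolding good_step_def V_def W_def by blast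
    qed
  qed
qed

end

section \<open>Propagation along the blocks\<close>


text \<open>One backward step bounds two blocks by the block after them, so the descent goes by two
  and needs only about half as many factors as there are blocks. The factor 2 absorbs the fixed
  error \<open>H\<close> into the bound of the previous step.\<close>

lemma two_step_backward:
  fixes x :: "nat \<Rightarrow> nat \<Rightarrow> complex"
  assumes N: "1 \<le> N" and Bk: "1 \<le> Bk" and H: "0 \<le> H"
    and last: "\<And>c. c < b \<Longrightarrow> cmod (x (N + 1) c) \<le> H"
    and bwd: "\<And>j \<alpha> c. j < N \<Longrightarrow> (\<forall>c<b. cmod (x (j + 2) c) \<le> \<alpha>) \<Longrightarrow> c < b \<Longrightarrow>
      cmod (x j c) \<le> Bk * (H + \<alpha>) \<and> cmod (x (j + 1) c) \<le> Bk * (H + \<alpha>)"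
    and i: "i \<le> N + 1" and c: "c < b"
  shows "cmod (x i c) \<le> (2 * Bk) ^ (N div 2 + 1) * H"
proof -
  have B2: "1 \<le> 2 * Bk" using Bk by simp
  have main: "n \<le> N + 1 \<Longrightarrow> \<forall>c<b. cmod (x (N + 1 - n) c) \<le> (2 * Bk) ^ ((n + 1) div 2) * H" for n
  proof (induction n rule: less_induct)
    case (less n)
    consider "n = 0" | "n = 1" | "2 \<le> n" by linarith
    then show ?case
    proof cases
      case 1
      then show ?thesis using last by simp
    next
      case 2
      have "\<forall>c<b. cmod (x (N - 1 + 2) c) \<le> H" using last N by simp
      then have "\<forall>c<b. cmod (x (N - 1 + 1) c) \<le> Bk * (H + H)" using bwd[of "N - 1" H] N by simp
      then show ?thesis using 2 N by (simp add: mult_ac)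
    next
      case 3
      define \<alpha> where "\<alpha> = (2 * Bk) ^ ((n - 2 + 1) div 2) * H"
      have "H \<le> \<alpha>" unfolding \<alpha>_def using one_le_power[OF B2] H by (simp add: mult_le_cancel_right1)
      have "N + 1 - n + 2 = N + 1 - (n - 2)" using 3 less.prems by simp
      then have "\<forall>c<b. cmod (x (N + 1 - n + 2) c) \<le> \<alpha>"
        using less.IH[of "n - 2"] less.prems 3 by (simp only: \<alpha>_def) auto
      moreover have "N + 1 - n < N" using 3 less.prems by simp
      ultimately have "\<forall>c<b. cmod (x (N + 1 - n) c) \<le> Bk * (H + \<alpha>)" using bwd by blast
      moreover have "Bk * (H + \<alpha>) \<le> 2 * Bk * \<alpha>" using \<open>H \<le> \<alpha>\<close> Bk by simp
      moreover have "2 * Bk * \<alpha> = (2 * Bk) ^ ((n + 1) div 2) * H"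
      proof -
        have "(n + 1) div 2 = Suc ((n - 2 + 1) div 2)" using 3 by linarith
        then show ?thesis by (simp add: \<alpha>_def)
      qed
      ultimately show ?thesis by force
    qed
  qed
  have "cmod (x i c) \<le> (2 * Bk) ^ ((N + 1 - i + 1) div 2) * H"
    using main[of "N + 1 - i"] i c by simp
  also have "\<dots> \<le> (2 * Bk) ^ (N div 2 + 1) * H"
    using B2 H by (intro mult_right_mono power_increasing) auto
  finally show ?thesis .
qed

context atom_dist
begin

text \<open>The frame at time \<open>k\<close> is determined by the row blocks before
  \<open>k\<close>, hence fixed when the atoms of row block \<open>k\<close> are exposed.
  \<open>Good\<close> speaks about all approximate solutions simultaneously, so neither a net nor a
  union over vectors occurs; each step costs one failure probability.\<close>

lemma propagation_probability:
  fixes \<psi> :: "nat \<Rightarrow> nat \<Rightarrow> nat \<Rightarrow> nat \<Rightarrow> 'i" and sh :: "nat \<Rightarrow> nat \<Rightarrow> nat \<Rightarrow> complex" and q r \<Lambda> \<eta> :: real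
  assumes finI: "finite I" and \<psi>I: "\<And>j t a c. j < N \<Longrightarrow> t < 3 \<Longrightarrow> a < b \<Longrightarrow> c < b \<Longrightarrow> \<psi> j t a c \<in> I"
    and \<psi>inj: "\<And>j t a c j' t' a' c'. j < N \<Longrightarrow> t < 3 \<Longrightarrow> a < b \<Longrightarrow> c < b \<Longrightarrow> j' < N \<Longrightarrow> t' < 3 \<Longrightarrow> a' < b \<Longrightarrow> c' < b \<Longrightarrow>
      \<psi> j t a c = \<psi> j' t' a' c' \<Longrightarrow> j = j' \<and> t = t' \<and> a = a' \<and> c = c'"
    and db: "d \<le> b" and b1: "1 \<le> b" and r: "0 < r" and \<Lambda>: "1 \<le> \<Lambda>" and \<eta>: "0 \<le> \<eta>" and N: "1 \<le> N"
    and conc: "\<And>a. measure \<mu> (ball a r) \<le> q"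
  defines "E \<equiv> (\<lambda>\<omega> j t a c. \<omega> (\<psi> j t a c) + sh t a c)"
    and "\<gamma> \<equiv> b / r * (2 + real b ^ 3 * \<Lambda> / r)"
  defines "\<Phi> \<equiv> 1 + 6 * real b ^ 4 * \<gamma> * \<Lambda>" and "Bk \<equiv> 1 + 3 * real b ^ 3 * \<Lambda> / r"
  assumes Zm: "Z \<in> sets (iid I)"
    and Zb: "\<And>\<omega> j t a c. \<omega> \<in> Z \<Longrightarrow> j < N \<Longrightarrow> t < 3 \<Longrightarrow> a < b \<Longrightarrow> c < b \<Longrightarrow> cmod (E \<omega> j t a c) \<le> \<Lambda>"
    and Zx: "\<And>\<omega>. \<omega> \<in> Z \<Longrightarrow> \<exists>x. (\<forall>j<N. \<forall>a<b. cmod (row_value b (E \<omega> j) a (x j) (x (j + 1)) (x (j + 2))) \<le> \<eta>) \<and>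
      (\<forall>c<b. cmod (x 0 c) \<le> \<eta> \<and> cmod (x 1 c) \<le> \<eta> \<and> cmod (x (N + 1) c) \<le> \<eta>) \<and>
      (\<exists>i\<le>N + 1. \<exists>c<b. (2 * Bk) ^ (N div 2 + 1) * (\<Phi> ^ N * \<eta>) < cmod (x i c))"
  shows "measure (iid I) Z \<le> N * (real d * q ^ (b + 1 - d) + real (b - d) * q ^ (d + 1))"
proof -
  have \<gamma>0: "0 \<le> \<gamma>" using r \<Lambda> by (simp add: \<gamma>_def)
  have \<Phi>1: "1 \<le> \<Phi>" using \<gamma>0 \<Lambda> by (simp add: \<Phi>_def)
  have Bk1: "1 \<le> Bk" using r \<Lambda> by (simp add: Bk_def)
  define e where "e = real d * q ^ (b + 1 - d) + real (b - d) * q ^ (d + 1)"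
  have q0: "0 \<le> q" using conc[of 0] measure_nonneg[of \<mu> "ball 0 r"] by linarith
  have e0: "0 \<le> e" using q0 by (simp add: e_def)
  define J where "J k = {\<psi> k t a c | t a c. t < 3 \<and> a < b \<and> c < b}" for k
  have JI: "J k \<subseteq> I" if "k < N" for k using \<psi>I that by (auto simp: J_def)
  have disj: "J k \<inter> J l = {}" if "k < l" "l < N" for k l
  proof (rule ccontr)
    assume "J k \<inter> J l \<noteq> {}"
    then obtain t a c t' a' c' where "t < 3" "a < b" "c < b" "t' < 3" "a' < b" "c' < b" "\<psi> k t a c = \<psi> l t' a' c'"
      by (auto simp: J_def)
    then have "k = l" using \<psi>inj[of k t a c l t' a' c'] that by auto
    then show False using that by simp
  qed
  define bdd where "bdd k \<omega> \<longleftrightarrow> (\<forall>j<k. \<forall>t<3. \<forall>a<b. \<forall>c<b. cmod (E \<omega> j t a c) \<le> \<Lambda>)" for k \<omega>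
  define approx where "approx k \<omega> x \<longleftrightarrow>
    (\<forall>j<k. \<forall>a<b. cmod (row_value b (E \<omega> j) a (x j) (x (j + 1)) (x (j + 2))) \<le> \<eta>) \<and>
    (\<forall>c<b. cmod (x 0 c) \<le> \<eta> \<and> cmod (x 1 c) \<le> \<eta>)" for k \<omega> and x :: "nat \<Rightarrow> nat \<Rightarrow> complex"
  define near where "near k S L x \<longleftrightarrow> (\<exists>e. graph_vec b S L e \<and>
    (\<forall>c<b. cmod (x k c - e (0, c)) \<le> \<Phi> ^ k * \<eta> \<and> cmod (x (k + 1) c - e (1, c)) \<le> \<Phi> ^ k * \<eta>))"
    for k S L and x :: "nat \<Rightarrow> nat \<Rightarrow> complex"
  define bwd where "bwd k x \<longleftrightarrow> (\<forall>j<k. \<forall>\<alpha>. (\<forall>c<b. cmod (x (j + 2) c) \<le> \<alpha>) \<longrightarrow>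
    (\<forall>c<b. cmod (x j c) \<le> Bk * (\<Phi> ^ k * \<eta> + \<alpha>) \<and> cmod (x (j + 1) c) \<le> Bk * (\<Phi> ^ k * \<eta> + \<alpha>)))"
    for k and x :: "nat \<Rightarrow> nat \<Rightarrow> complex"
  \<comment> \<open>Vacuous as soon as an exposed entry exceeds \<open>\<Lambda>\<close>; every
    point of \<open>Z\<close> has bounded entries, so nothing is lost at the end.\<close>
  define Good where "Good k \<omega> \<longleftrightarrow> (bdd k \<omega> \<longrightarrow>
    (\<exists>S L. frame b d S L \<and> (\<forall>x. approx k \<omega> x \<longrightarrow> near k S L x \<and> bwd k x)))" for k \<omega>
  have "measure (iid I) Z \<le> N * e"
  proof (rule sequential_exposure[where N = N and Good = Good and J = J, OF finI JI disj Zm e0])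
    fix \<omega>
    show "Good 0 \<omega>" unfolding Good_def
    proof (intro impI exI conjI allI)
      \<comment> \<open>Any \<open>d\<close> coordinates of the first block do: both starting blocks
        are close to zero, which lies in every such space. The dimension \<open>d\<close> is
        introduced here and preserved by each step.\<close>
      let ?S = "{0} \<times> {..<d} :: (nat \<times> nat) set"
      let ?L = "\<lambda>i l. (if i = l then 1 else 0) :: complex"
      show "frame b d ?S ?L" using db by (auto simp: frame_def pair_index_def)
      fix x assume "approx 0 \<omega> x"
      then show "near 0 ?S ?L x" unfolding near_def approx_def
        by (intro exI[of _ "\<lambda>_. 0"]) (auto simp: graph_vec_def)
      show "bwd 0 x" by (simp add: bwd_def)
    qed
  next
    fix k \<omega> assume k: "k < N" and \<omega>: "\<omega> \<in> space (iid I)" and G: "Good k \<omega>"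
    show "\<exists>B\<in>sets (iid (J k)). measure (iid (J k)) B \<le> e \<and>
        (\<forall>\<omega>'\<in>space (iid I). (\<forall>i\<in>I - \<Union>(J ` {k..<N}). \<omega>' i = \<omega> i) \<and> restrict \<omega>' (J k) \<notin> B \<longrightarrow> Good (Suc k) \<omega>')"
    proof -
      have same: "E \<omega>' j t a c = E \<omega> j t a c"
        if ag: "\<forall>i\<in>I - \<Union>(J ` {k..<N}). \<omega>' i = \<omega> i" and j: "j < k" and tac: "t < 3" "a < b" "c < b" for \<omega>' j t a c
      proof -
        have "\<psi> j t a c \<in> J j" using tac by (auto simp: J_def)
        then have "\<psi> j t a c \<notin> \<Union>(J ` {k..<N})" using disj[of j] j by (fastforce simp: disjoint_iff)
        moreover have "\<psi> j t a c \<in> I" using j k tac by (intro \<psi>I) auto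
        ultimately show ?thesis using ag by (simp add: E_def)
      qed
      have bsame: "bdd k \<omega>" if "\<forall>i\<in>I - \<Union>(J ` {k..<N}). \<omega>' i = \<omega> i" "bdd (Suc k) \<omega>'" for \<omega>'
        unfolding bdd_def
      proof (intro allI impI)
        fix j t a c assume h: "j < k" "t < (3::nat)" "a < b" "c < b"
        have "cmod (E \<omega>' j t a c) \<le> \<Lambda>" using that(2) h unfolding bdd_def by auto
        then show "cmod (E \<omega> j t a c) \<le> \<Lambda>" using same[OF that(1) h] by simp
      qed
      show ?thesis
      proof (cases "bdd k \<omega>")
        case False
        show ?thesis
        proof (intro bexI[of _ "{}"] conjI ballI impI)
          fix \<omega>' assume "(\<forall>i\<in>I - \<Union>(J ` {k..<N}). \<omega>' i = \<omega> i) \<and> restrict \<omega>' (J k) \<notin> {}"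
          then show "Good (Suc k) \<omega>'" unfolding Good_def using bsame False by blast
        qed (use e0 in auto)
      next
        case True
        then obtain S L where fr: "frame b d S L" and SL: "\<And>x. approx k \<omega> x \<Longrightarrow> near k S L x \<and> bwd k x"
          using G unfolding Good_def by blast
        have finJ: "finite (J k)" using finite_subset[OF JI[OF k] finI] .
        have \<psi>J: "\<psi> k t a c \<in> J k" if "t < 3" "a < b" "c < b" for t a c using that by (auto simp: J_def)
        have inj: "t = t' \<and> a = a' \<and> c = c'" if "t < 3" "a < b" "c < b" "t' < 3" "a' < b" "c' < b" "\<psi> k t a c = \<psi> k t' a' c'" for t a c t' a' c'
          using \<psi>inj[of k t a c k t' a' c'] k that by auto
        have \<Lambda>0: "0 \<le> \<Lambda>" using \<Lambda> by simp
        have "\<exists>B\<in>sets (iid (J k)). measure (iid (J k)) B \<le> e \<and>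
          (\<forall>\<omega>\<in>space (iid (J k)) - B. (\<forall>t<3. \<forall>a<b. \<forall>c<b. cmod (\<omega> (\<psi> k t a c) + sh t a c) \<le> \<Lambda>) \<longrightarrow>
            good_step b r \<gamma> (\<lambda>t a c. \<omega> (\<psi> k t a c) + sh t a c) S L)"
          unfolding e_def \<gamma>_def by (rule step_probability[where sh = sh, OF finJ \<psi>J inj fr db r \<Lambda>0 conc])
        then obtain B where B: "B \<in> sets (iid (J k))" "measure (iid (J k)) B \<le> e"
          and Bg: "\<forall>\<omega>\<in>space (iid (J k)) - B. (\<forall>t<3. \<forall>a<b. \<forall>c<b. cmod (\<omega> (\<psi> k t a c) + sh t a c) \<le> \<Lambda>) \<longrightarrow>
            good_step b r \<gamma> (\<lambda>t a c. \<omega> (\<psi> k t a c) + sh t a c) S L"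
          by (elim bexE conjE)
        show ?thesis
        proof (intro bexI[OF _ B(1)] conjI B(2) ballI impI)
          fix \<omega>' assume \<omega>': "\<omega>' \<in> space (iid I)"
            and h: "(\<forall>i\<in>I - \<Union>(J ` {k..<N}). \<omega>' i = \<omega> i) \<and> restrict \<omega>' (J k) \<notin> B"
          show "Good (Suc k) \<omega>'" unfolding Good_def
          proof
            assume bd: "bdd (Suc k) \<omega>'"
            have Er: "restrict \<omega>' (J k) (\<psi> k t a c) + sh t a c = E \<omega>' k t a c" if "t < 3" "a < b" "c < b" for t a c
              using \<psi>J that by (simp add: E_def)
            have Eb: "cmod (E \<omega>' k t a c) \<le> \<Lambda>" if "t < 3" "a < b" "c < b" for t a c
              using bd that unfolding bdd_def by blast
            have "restrict \<omega>' (J k) \<in> space (iid (J k)) - B" using h by (simp add: space_iid)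
            then have "good_step b r \<gamma> (\<lambda>t a c. restrict \<omega>' (J k) (\<psi> k t a c) + sh t a c) S L"
              using Er Eb by (intro Bg[rule_format]) (simp_all del: restrict_apply)
            moreover have "good_step b r \<gamma> (\<lambda>t a c. restrict \<omega>' (J k) (\<psi> k t a c) + sh t a c) S L = good_step b r \<gamma> (E \<omega>' k) S L"
            proof -
              have "restricted_row b (\<lambda>t a c. restrict \<omega>' (J k) (\<psi> k t a c) + sh t a c) L p l = restricted_row b (E \<omega>' k) L p l" if "p < b" for p l
                unfolding restricted_row_def
              proof (intro sum.cong refl)
                fix i assume "i \<in> pair_index b"
                then have "fst i < 3" "snd i < b" by (auto simp: pair_index_def)
                then show "(restrict \<omega>' (J k) (\<psi> k (fst i) p (snd i)) + sh (fst i) p (snd i)) * L i l = E \<omega>' k (fst i) p (snd i) * L i l"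
                  by (simp only: Er[OF _ that])
              qed
              then show ?thesis unfolding good_step_def by (simp add: Er del: restrict_apply)
            qed
            ultimately have gs: "good_step b r \<gamma> (E \<omega>' k) S L" by simp
            have "\<exists>S' L'. frame b d S' L' \<and> (\<forall>x0 x1 x2 e \<eta>.
              graph_vec b S L e \<longrightarrow> (\<forall>c<b. cmod (x0 c - e (0, c)) \<le> \<eta> \<and> cmod (x1 c - e (1, c)) \<le> \<eta>) \<longrightarrow>
              (\<forall>a<b. cmod (row_value b (E \<omega>' k) a x0 x1 x2) \<le> \<eta>) \<longrightarrow>
              (\<exists>e'. graph_vec b S' L' e' \<and> (\<forall>c<b. cmod (x1 c - e' (0, c)) \<le> \<Phi> * \<eta> \<and> cmod (x2 c - e' (1, c)) \<le> \<Phi> * \<eta>)) \<and>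
              (\<forall>\<alpha>. (\<forall>c<b. cmod (x2 c) \<le> \<alpha>) \<longrightarrow> (\<forall>c<b. cmod (x0 c) \<le> Bk * (\<eta> + \<alpha>) \<and> cmod (x1 c) \<le> Bk * (\<eta> + \<alpha>))))"
              unfolding \<Phi>_def Bk_def by (rule step_propagation[OF fr db b1 r \<Lambda> \<gamma>0 gs Eb])
            then obtain S' L' where fr': "frame b d S' L'" and stp: "(\<forall>x0 x1 x2 e \<eta>.
              graph_vec b S L e \<longrightarrow> (\<forall>c<b. cmod (x0 c - e (0, c)) \<le> \<eta> \<and> cmod (x1 c - e (1, c)) \<le> \<eta>) \<longrightarrow>
              (\<forall>a<b. cmod (row_value b (E \<omega>' k) a x0 x1 x2) \<le> \<eta>) \<longrightarrow>
              (\<exists>e'. graph_vec b S' L' e' \<and> (\<forall>c<b. cmod (x1 c - e' (0, c)) \<le> \<Phi> * \<eta> \<and> cmod (x2 c - e' (1, c)) \<le> \<Phi> * \<eta>)) \<and>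
              (\<forall>\<alpha>. (\<forall>c<b. cmod (x2 c) \<le> \<alpha>) \<longrightarrow> (\<forall>c<b. cmod (x0 c) \<le> Bk * (\<eta> + \<alpha>) \<and> cmod (x1 c) \<le> Bk * (\<eta> + \<alpha>))))"
              by (elim exE conjE)
            show "\<exists>S L. frame b d S L \<and> (\<forall>x. approx (Suc k) \<omega>' x \<longrightarrow> near (Suc k) S L x \<and> bwd (Suc k) x)"
            proof (intro exI[of _ S'] exI[of _ L'] conjI[OF fr'] allI impI)
              fix x assume ap: "approx (Suc k) \<omega>' x"
              have "approx k \<omega> x" unfolding approx_def
              proof (intro conjI allI impI)
                fix j a assume j: "j < k" and a: "a < b"
                have "row_value b (E \<omega>' j) a (x j) (x (j + 1)) (x (j + 2)) = row_value b (E \<omega> j) a (x j) (x (j + 1)) (x (j + 2))"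
                  unfolding row_value_def using same[OF conjunct1[OF h] j _ a] by simp
                then show "cmod (row_value b (E \<omega> j) a (x j) (x (j + 1)) (x (j + 2))) \<le> \<eta>"
                  using ap j a unfolding approx_def by (metis less_SucI)
              qed (use ap in \<open>auto simp: approx_def\<close>)
              then have nb: "near k S L x" "bwd k x" using SL by auto
              from nb(1) obtain e where e: "graph_vec b S L e"
                "\<forall>c<b. cmod (x k c - e (0, c)) \<le> \<Phi> ^ k * \<eta> \<and> cmod (x (k + 1) c - e (1, c)) \<le> \<Phi> ^ k * \<eta>"
                unfolding near_def by blast
              \<comment> \<open>The residual of the new row block is dominated by the error
                accumulated so far, so a single error parameter per step suffices.\<close>
              have \<eta>le: "\<eta> \<le> \<Phi> ^ k * \<eta>" using one_le_power[OF \<Phi>1] \<eta> by (simp add: mult_le_cancel_right1)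
              have row: "\<forall>a<b. cmod (row_value b (E \<omega>' k) a (x k) (x (k + 1)) (x (k + 2))) \<le> \<Phi> ^ k * \<eta>"
                using ap \<eta>le unfolding approx_def by (meson lessI order_trans)
              note P = stp[rule_format, OF e(1) e(2)[rule_format] row[rule_format]]
              show "near (Suc k) S' L' x \<and> bwd (Suc k) x"
              proof
                show "near (Suc k) S' L' x" using conjunct1[OF P] by (simp add: near_def mult.assoc)
                have Hle: "\<Phi> ^ k * \<eta> \<le> \<Phi> ^ Suc k * \<eta>" using \<Phi>1 \<eta> by (intro mult_right_mono power_increasing) auto
                have le: "Bk * (\<Phi> ^ k * \<eta> + \<alpha>) \<le> Bk * (\<Phi> ^ Suc k * \<eta> + \<alpha>)" for \<alpha>
                  using Hle Bk1 by (intro mult_left_mono) auto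
                show "bwd (Suc k) x" unfolding bwd_def
                proof (intro allI impI)
                  fix j \<alpha> c assume j: "j < Suc k" and \<alpha>: "\<forall>c<b. cmod (x (j + 2) c) \<le> \<alpha>" and c: "c < b"
                  have "cmod (x j c) \<le> Bk * (\<Phi> ^ k * \<eta> + \<alpha>) \<and> cmod (x (j + 1) c) \<le> Bk * (\<Phi> ^ k * \<eta> + \<alpha>)"
                  proof (cases "j = k")
                    case True
                    then show ?thesis using conjunct2[OF P] \<alpha> c by blast
                  next
                    case False
                    then have "j < k" using j by simp
                    then show ?thesis using nb(2) \<alpha> c unfolding bwd_def by blast
                  qed
                  then show "cmod (x j c) \<le> Bk * (\<Phi> ^ Suc k * \<eta> + \<alpha>) \<and> cmod (x (j + 1) c) \<le> Bk * (\<Phi> ^ Suc k * \<eta> + \<alpha>)"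
                    using le[of \<alpha>] by linarith
                qed
              qed
            qed
          qed
        qed
      qed
    qed
  next
    fix \<omega> assume \<omega>: "\<omega> \<in> space (iid I)" and G: "Good N \<omega>"
    show "\<omega> \<notin> Z"
    proof
      assume Z: "\<omega> \<in> Z"
      then have "bdd N \<omega>" unfolding bdd_def using Zb by blast
      then have SL: "\<And>x. approx N \<omega> x \<Longrightarrow> bwd N x" using G unfolding Good_def by blast
      obtain x i c where rows: "\<forall>j<N. \<forall>a<b. cmod (row_value b (E \<omega> j) a (x j) (x (j + 1)) (x (j + 2))) \<le> \<eta>"
        and ini: "\<forall>c<b. cmod (x 0 c) \<le> \<eta> \<and> cmod (x 1 c) \<le> \<eta> \<and> cmod (x (N + 1) c) \<le> \<eta>"
        and i: "i \<le> N + 1" and c: "c < b" and big: "(2 * Bk) ^ (N div 2 + 1) * (\<Phi> ^ N * \<eta>) < cmod (x i c)"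
        using Zx[OF Z] by blast
      have "bwd N x" using rows ini by (intro SL) (auto simp: approx_def)
      have \<eta>le: "\<eta> \<le> \<Phi> ^ N * \<eta>" using one_le_power[OF \<Phi>1] \<eta> by (simp add: mult_le_cancel_right1)
      have "cmod (x i c) \<le> (2 * Bk) ^ (N div 2 + 1) * (\<Phi> ^ N * \<eta>)"
      proof (rule two_step_backward[OF N Bk1 _ _ _ i c])
        show "0 \<le> \<Phi> ^ N * \<eta>" using \<eta>le \<eta> by simp
        show "cmod (x (N + 1) c) \<le> \<Phi> ^ N * \<eta>" if "c < b" for c using ini that \<eta>le by force
        show "cmod (x j c) \<le> Bk * (\<Phi> ^ N * \<eta> + \<alpha>) \<and> cmod (x (j + 1) c) \<le> Bk * (\<Phi> ^ N * \<eta> + \<alpha>)"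
          if "j < N" "\<forall>c<b. cmod (x (j + 2) c) \<le> \<alpha>" "c < b" for j \<alpha> c
          using \<open>bwd N x\<close> that unfolding bwd_def by blast
      qed
      then show False using big by simp
    qed
  qed
  then show ?thesis by (simp add: e_def)
qed

end


section \<open>Near-kernel vectors of the cyclic system that are sparse on three blocks\<close>

lemma continuous_on_entry: "continuous_on A (\<lambda>x :: 'a \<Rightarrow> 'b \<Rightarrow> 'c::topological_space. x i j)"
proof -
  have "continuous_on A (\<lambda>x :: 'a \<Rightarrow> 'b \<Rightarrow> 'c. x i)"
    by (rule continuous_on_subset[OF continuous_on_product_coordinates]) simp
  moreover have "continuous_on UNIV (\<lambda>f :: 'b \<Rightarrow> 'c. f j)"
    by (rule continuous_on_product_coordinates)
  ultimately show ?thesis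
    using continuous_on_compose2[of UNIV "\<lambda>f :: 'b \<Rightarrow> 'c. f j" A "\<lambda>x. x i"] by simp
qed

lemma open_Collect_ball_finite:
  assumes "finite A" "\<And>j. j \<in> A \<Longrightarrow> open {x. Q j x}"
  shows "open {x. \<forall>j\<in>A. Q j x}"
proof -
  have "{x. \<forall>j\<in>A. Q j x} = (\<Inter>j\<in>A. {x. Q j x})" by auto
  then show ?thesis using assms by auto
qed

lemma open_Collect_bex:
  assumes "\<And>j. j \<in> A \<Longrightarrow> open {x. Q j x}"
  shows "open {x. \<exists>j\<in>A. Q j x}"
proof -
  have "{x. \<exists>j\<in>A. Q j x} = (\<Union>j\<in>A. {x. Q j x})" by auto
  then show ?thesis using assms by auto
qed

text \<open>In cyclic order around row block \<open>0\<close>: the blocks \<open>m - 1\<close>,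
  \<open>0\<close> and \<open>1\<close>.\<close>

definition triple_block :: "nat \<Rightarrow> nat \<Rightarrow> nat" where
  "triple_block m t = (if t = 0 then m - 1 else t - 1)"

definition triple_index :: "nat \<Rightarrow> (nat \<times> nat) set" where
  "triple_index b = {..<3} \<times> {..<b}"

lemma triple_index [simp]: "finite (triple_index b)" "card (triple_index b) = 3 * b"
  by (auto simp: triple_index_def)

lemma row_value_triple:
  "row_value b E a (x (m - 1)) (x 0) (x 1) =
    (\<Sum>p\<in>triple_index b. E (fst p) a (snd p) * x (triple_block m (fst p)) (snd p))"
  unfolding row_value_def triple_index_def triple_block_def
  by (simp add: sum.cartesian_product' numeral_3_eq_3 numeral_2_eq_2)

text \<open>The row blocks \<open>1\<close> to \<open>m - 2\<close> form an open chain through all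
  \<open>m\<close> blocks; the three vanishing blocks are the two at its beginning and the one at
  its end. The last clause stands for a vector normalised in the maximum norm, weakened to a strict
  inequality to remain open.\<close>

definition vanish_event :: "nat \<Rightarrow> nat \<Rightarrow> (nat \<Rightarrow> nat \<Rightarrow> nat \<Rightarrow> nat \<Rightarrow> complex) \<Rightarrow> real \<Rightarrow> (nat \<Rightarrow> nat \<Rightarrow> complex) \<Rightarrow> bool" where
  "vanish_event b m E \<eta> x \<longleftrightarrow>
    (\<forall>j\<in>{..<m - 2}. \<forall>a\<in>{..<b}. cmod (row_value b (E (j + 1)) a (x j) (x (j + 1)) (x (j + 2))) < \<eta>) \<and>
    (\<forall>p\<in>triple_index b. cmod (x (triple_block m (fst p)) (snd p)) < \<eta>) \<and>
    (\<exists>i\<in>{..<m}. \<exists>c\<in>{..<b}. 1 / 2 < cmod (x i c))"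

context atom_dist
begin

lemma vanish_event_measurable:
  assumes E: "\<And>j t a c. j < m \<Longrightarrow> t < 3 \<Longrightarrow> a < b \<Longrightarrow> c < b \<Longrightarrow> (\<lambda>\<omega>. E \<omega> j t a c) \<in> borel_measurable (iid I)"
  shows "{\<omega> \<in> space (iid I). \<exists>x. vanish_event b m (E \<omega>) \<eta> x} \<in> sets (iid I)"
proof (rule ex_open_measurable)
  fix \<omega> show "open {x. vanish_event b m (E \<omega>) \<eta> x}"
    unfolding vanish_event_def row_value_def
    by (intro open_Collect_conj open_Collect_ball_finite open_Collect_bex open_Collect_less
        continuous_intros continuous_on_entry) auto
next
  fix x
  have [measurable]: "(\<lambda>\<omega>. row_value b (E \<omega> (j + 1)) a u v w) \<in> borel_measurable (iid I)"
    if "j \<in> {..<m - 2}" "a \<in> {..<b}" for j a u v w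
    unfolding row_value_def using that
    by (intro borel_measurable_add borel_measurable_sum borel_measurable_times E) auto
  have "{\<omega> \<in> space (iid I). \<forall>j\<in>{..<m - 2}. \<forall>a\<in>{..<b}. cmod (row_value b (E \<omega> (j + 1)) a (x j) (x (j + 1)) (x (j + 2))) < \<eta>} \<in> sets (iid I)"
  proof (intro sets.sets_Collect_finite_All)
    fix j a assume [measurable]: "j \<in> {..<m - 2}" "a \<in> {..<b}"
    show "{\<omega> \<in> space (iid I). cmod (row_value b (E \<omega> (j + 1)) a (x j) (x (j + 1)) (x (j + 2))) < \<eta>} \<in> sets (iid I)"
      by measurable
  qed auto
  then show "{\<omega> \<in> space (iid I). vanish_event b m (E \<omega>) \<eta> x} \<in> sets (iid I)"
    unfolding vanish_event_def by (intro sets.sets_Collect_conj sets.sets_Collect_const)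
qed

text \<open>A near-kernel vector of the cyclic system cannot be concentrated on few coordinates of the
  three blocks seen by row block \<open>0\<close>: otherwise these blocks nearly vanish, which propagates around the
  cycle. Equation \<open>a0\<close> of row block \<open>0\<close> is not used.\<close>
lemma cyclic_spread:
  fixes \<psi> :: "nat \<Rightarrow> nat \<Rightarrow> nat \<Rightarrow> nat \<Rightarrow> 'i" and sh :: "nat \<Rightarrow> nat \<Rightarrow> nat \<Rightarrow> complex" and q r \<Lambda> \<eta> \<tau> \<tau>' :: real
  assumes finI: "finite I" and \<psi>I: "\<And>j t a c. j < m \<Longrightarrow> t < 3 \<Longrightarrow> a < b \<Longrightarrow> c < b \<Longrightarrow> \<psi> j t a c \<in> I"
    and \<psi>inj: "\<And>j t a c j' t' a' c'. j < m \<Longrightarrow> t < 3 \<Longrightarrow> a < b \<Longrightarrow> c < b \<Longrightarrow> j' < m \<Longrightarrow> t' < 3 \<Longrightarrow> a' < b \<Longrightarrow> c' < b \<Longrightarrow>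
      \<psi> j t a c = \<psi> j' t' a' c' \<Longrightarrow> j = j' \<and> t = t' \<and> a = a' \<and> c = c'"
    and db: "d \<le> b" and b1: "1 \<le> b" and r: "0 < r" and \<Lambda>: "1 \<le> \<Lambda>" and m: "3 \<le> m"
    and conc: "\<And>a. measure \<mu> (ball a r) \<le> q" and q1: "q \<le> 1" and sb: "s < b"
    and \<tau>': "0 < \<tau>'" "\<eta> \<le> \<tau>'" "\<tau> \<le> \<tau>'" "0 \<le> \<eta>" "0 \<le> \<tau>" "b * (\<eta> + 3 * b * (\<Lambda> * \<tau>)) < r * \<tau>'"
  defines "E \<equiv> (\<lambda>\<omega> j t a c. \<omega> (\<psi> j t a c) + sh t a c)"
    and "\<gamma> \<equiv> b / r * (2 + real b ^ 3 * \<Lambda> / r)"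
  defines "\<Phi> \<equiv> 1 + 6 * real b ^ 4 * \<gamma> * \<Lambda>" and "Bk \<equiv> 1 + 3 * real b ^ 3 * \<Lambda> / r"
  assumes total: "(2 * Bk) ^ ((m - 2) div 2 + 1) * (\<Phi> ^ (m - 2) * \<tau>') \<le> 1 / 2"
  shows "\<exists>B\<in>sets (iid I). measure (iid I) B \<le> m * (real d * q ^ (b + 1 - d) + real (b - d) * q ^ (d + 1)) +
      ((3 * b) choose s) * (s * q ^ (b - s)) \<and>
    (\<forall>\<omega>\<in>space (iid I) - B.
      (\<forall>j<m. \<forall>t<3. \<forall>a<b. \<forall>c<b. (j = 0 \<longrightarrow> a \<noteq> a0) \<longrightarrow> cmod (E \<omega> j t a c) \<le> \<Lambda>) \<longrightarrow>
      (\<forall>x. (\<forall>j<m - 2. \<forall>a<b. cmod (row_value b (E \<omega> (j + 1)) a (x j) (x (j + 1)) (x (j + 2))) < \<eta>) \<longrightarrow>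
        (\<forall>a<b. a \<noteq> a0 \<longrightarrow> cmod (row_value b (E \<omega> 0) a (x (m - 1)) (x 0) (x 1)) < \<eta>) \<longrightarrow>
        (\<exists>i<m. \<exists>c<b. 1 / 2 < cmod (x i c)) \<longrightarrow>
        s < card {p \<in> triple_index b. \<tau> \<le> cmod (x (triple_block m (fst p)) (snd p))}))"
proof -
  have Em: "(\<lambda>\<omega>. E \<omega> j t a c) \<in> borel_measurable (iid I)" if "j < m" "t < 3" "a < b" "c < b" for j t a c
    unfolding E_def using that by (intro borel_measurable_add coord_measurable \<psi>I) auto
  have q0: "0 \<le> q" using conc[of 0] measure_nonneg[of \<mu> "ball 0 r"] by linarith
  define e where "e = real d * q ^ (b + 1 - d) + real (b - d) * q ^ (d + 1)"
  have e0: "0 \<le> e" using q0 by (simp add: e_def)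
  define N where "N = m - 2"
  have N: "1 \<le> N" "N + 2 = m" using m by (auto simp: N_def)
  define Bd where "Bd = {\<omega> \<in> space (iid I). \<forall>j\<in>{..<N}. \<forall>t\<in>{..<3}. \<forall>a\<in>{..<b}. \<forall>c\<in>{..<b}. cmod (E \<omega> (j + 1) t a c) \<le> \<Lambda>}"
  have Bd: "Bd \<in> sets (iid I)" unfolding Bd_def
  proof (intro sets.sets_Collect_finite_All)
    fix j t a c assume "j \<in> {..<N}" "t \<in> {..<3::nat}" "a \<in> {..<b}" "c \<in> {..<b}"
    then have [measurable]: "(\<lambda>\<omega>. E \<omega> (j + 1) t a c) \<in> borel_measurable (iid I)" using N by (intro Em) auto
    show "{\<omega> \<in> space (iid I). cmod (E \<omega> (j + 1) t a c) \<le> \<Lambda>} \<in> sets (iid I)" by measurable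
  qed auto
  define Z1 where "Z1 = Bd \<inter> {\<omega> \<in> space (iid I). \<exists>x. vanish_event b m (E \<omega>) \<tau>' x}"
  have Z1: "Z1 \<in> sets (iid I)" unfolding Z1_def
    by (intro sets.Int Bd vanish_event_measurable Em)
  \<comment> \<open>The chain starts at row block \<open>1\<close>, hence the shift in
    \<open>\<psi>\<close>. Its error level is \<open>\<tau>'\<close> and not \<open>\<eta>\<close>,
    since the three blocks are known to vanish only up to \<open>\<tau>'\<close>.\<close>
  have P1: "measure (iid I) Z1 \<le> N * (real d * q ^ (b + 1 - d) + real (b - d) * q ^ (d + 1))"
  proof (rule propagation_probability[where \<psi> = "\<lambda>j. \<psi> (j + 1)" and sh = sh and \<eta> = \<tau>' and \<Lambda> = \<Lambda> and r = r,
        OF finI _ _ db b1 r \<Lambda> _ N(1) conc Z1])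
    show "\<psi> (j + 1) t a c \<in> I" if "j < N" "t < 3" "a < b" "c < b" for j t a c using that N by (intro \<psi>I) auto
    show "j = j' \<and> t = t' \<and> a = a' \<and> c = c'" if "j < N" "t < 3" "a < b" "c < b" "j' < N" "t' < 3" "a' < b" "c' < b"
      "\<psi> (j + 1) t a c = \<psi> (j' + 1) t' a' c'" for j t a c j' t' a' c'
      using \<psi>inj[of "j + 1" t a c "j' + 1" t' a' c'] that N by auto
    show "0 \<le> \<tau>'" using \<tau>' by simp
    show "cmod (\<omega> (\<psi> (j + 1) t a c) + sh t a c) \<le> \<Lambda>" if "\<omega> \<in> Z1" "j < N" "t < 3" "a < b" "c < b" for \<omega> j t a c
      using that by (auto simp: Z1_def Bd_def E_def)
    fix \<omega> assume "\<omega> \<in> Z1"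
    then obtain x where x: "vanish_event b m (E \<omega>) \<tau>' x" by (auto simp: Z1_def)
    have tot: "(2 * Bk) ^ (N div 2 + 1) * (\<Phi> ^ N * \<tau>') \<le> 1 / 2" using total by (simp add: N_def)
    have tri: "cmod (x (triple_block m t) c) < \<tau>'" if "t < 3" "c < b" for t c
      using x that unfolding vanish_event_def triple_index_def by auto
    have "triple_block m 0 = N + 1" using N by (simp add: triple_block_def)
    then have "cmod (x 0 c) \<le> \<tau>' \<and> cmod (x 1 c) \<le> \<tau>' \<and> cmod (x (N + 1) c) \<le> \<tau>'" if "c < b" for c
      using tri[of 0 c] tri[of 1 c] tri[of 2 c] that by (auto simp: triple_block_def less_imp_le)
    moreover have "\<forall>j<N. \<forall>a<b. cmod (row_value b (\<lambda>t a c. \<omega> (\<psi> (j + 1) t a c) + sh t a c) a (x j) (x (j + 1)) (x (j + 2))) \<le> \<tau>'"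
      using x unfolding vanish_event_def N_def E_def by (auto intro: less_imp_le)
    moreover obtain i c where "i < m" "c < b" "1 / 2 < cmod (x i c)"
      using x unfolding vanish_event_def by auto
    then have "\<exists>i\<le>N + 1. \<exists>c<b. (2 * Bk) ^ (N div 2 + 1) * (\<Phi> ^ N * \<tau>') < cmod (x i c)"
      using tot N by (intro exI[of _ i] conjI exI[of _ c]) auto
    ultimately show "\<exists>x. (\<forall>j<N. \<forall>a<b. cmod (row_value b (\<lambda>t a c. \<omega> (\<psi> (j + 1) t a c) + sh t a c) a (x j) (x (j + 1)) (x (j + 2))) \<le> \<tau>') \<and>
      (\<forall>c<b. cmod (x 0 c) \<le> \<tau>' \<and> cmod (x 1 c) \<le> \<tau>' \<and> cmod (x (N + 1) c) \<le> \<tau>') \<and>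
      (\<exists>i\<le>N + 1. \<exists>c<b. (2 * (1 + 3 * real b ^ 3 * \<Lambda> / r)) ^ (N div 2 + 1) * ((1 + 6 * real b ^ 4 * (b / r * (2 + real b ^ 3 * \<Lambda> / r)) * \<Lambda>) ^ N * \<tau>') < cmod (x i c))"
      unfolding \<Phi>_def Bk_def \<gamma>_def by blast
  qed
  define A where "A = {..<b} - {a0}"
  \<comment> \<open>An inequality, since \<open>a0\<close> may also be \<open>b\<close>, in which
    case no equation is dropped; the same statement thereby serves the rows and the columns. The
    dropped equation costs one unit, which the extra 1 of the tall matrix bound repays, leaving
    \<open>q ^ (b - s)\<close>.\<close>
  have cA: "b - 1 \<le> card A" by (simp add: A_def card_Diff_singleton_if)
  \<comment> \<open>Supports of size exactly \<open>s\<close>: smaller ones are padded, so the union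
    bound involves a single binomial coefficient.\<close>
  define TT where "TT = {T. T \<subseteq> triple_index b \<and> card T = s}"
  have finTT: "finite TT" and cTT: "card TT = (3 * b) choose s"
    unfolding TT_def using n_subsets[of "triple_index b" s] by auto
  define Z2 where "Z2 T = {\<omega> \<in> space (iid I). \<exists>x. \<exists>k0\<in>T.
    (\<Sum>a\<in>A. cmod (\<Sum>k\<in>T. (\<omega> (\<psi> 0 (fst k) a (snd k)) + sh (fst k) a (snd k)) * x k)) < r * cmod (x k0)}" for T
  have Z2: "Z2 T \<in> sets (iid I)" "measure (iid I) (Z2 T) \<le> s * q ^ (b - s)" if T: "T \<in> TT" for T
  proof -
    have T': "T \<subseteq> triple_index b" "card T = s" using T by (auto simp: TT_def)
    have finT: "finite T" using finite_subset[OF T'(1)] by simp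
    have Tb: "fst k < 3" "snd k < b" if "k \<in> T" for k using T' that by (auto simp: triple_index_def)
    have finA: "finite A" by (simp add: A_def)
    have m0: "0 < m" using m by simp
    have h1: "card T \<le> card A" using T' cA sb by simp
    have h2: "\<psi> 0 (fst k) a (snd k) \<in> I" if "a \<in> A" "k \<in> T" for a k using that Tb m0 by (intro \<psi>I) (auto simp: A_def)
    have h3: "a = a' \<and> k = k'" if "a \<in> A" "k \<in> T" "a' \<in> A" "k' \<in> T" "\<psi> 0 (fst k) a (snd k) = \<psi> 0 (fst k') a' (snd k')" for a k a' k'
    proof -
      have "fst k = fst k' \<and> a = a' \<and> snd k = snd k'"
        using \<psi>inj[OF m0 _ _ _ m0 _ _ _ that(5)] that Tb by (auto simp: A_def)
      then show ?thesis by (simp add: prod_eq_iff)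
    qed
    have h4: "(\<lambda>\<omega>. sh (fst k) a (snd k)) \<in> borel_measurable (iid I)" for k a by simp
    show "Z2 T \<in> sets (iid I)" unfolding Z2_def
      by (rule tall_matrix_bound(1)[OF finI finA finT h1 h2 h3 h4 refl conc])
    have "measure (iid I) (Z2 T) \<le> card T * q ^ (card A + 1 - card T)" unfolding Z2_def
      by (rule tall_matrix_bound(2)[OF finI finA finT h1 h2 h3 h4 refl conc])
    also have "\<dots> \<le> s * q ^ (b - s)"
      unfolding T' using cA q0 q1 sb by (intro mult_left_mono power_decreasing) auto
    finally show "measure (iid I) (Z2 T) \<le> s * q ^ (b - s)" .
  qed
  define B where "B = Z1 \<union> (\<Union>T\<in>TT. Z2 T)"
  have U: "(\<Union>T\<in>TT. Z2 T) \<in> sets (iid I)" using Z2(1) finTT by (intro sets.finite_UN) auto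
  show ?thesis
  proof (intro bexI[of _ B] conjI ballI impI allI)
    show "B \<in> sets (iid I)" unfolding B_def using Z1 U by auto
    have "measure (iid I) B \<le> measure (iid I) Z1 + measure (iid I) (\<Union>T\<in>TT. Z2 T)"
      unfolding B_def by (rule measure_Un_le[OF Z1 U])
    also have "measure (iid I) (\<Union>T\<in>TT. Z2 T) \<le> (\<Sum>T\<in>TT. measure (iid I) (Z2 T))"
      using Z2(1) finTT by (intro finite_measure.finite_measure_subadditive_finite[OF prob_space.finite_measure[OF prob_space_iid]]) auto
    also have "\<dots> \<le> (\<Sum>T\<in>TT. s * q ^ (b - s))" by (intro sum_mono Z2(2))
    also have "\<dots> = ((3 * b) choose s) * (s * q ^ (b - s))" by (simp add: cTT)
    also have "measure (iid I) Z1 \<le> m * e"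
      by (rule order_trans[OF P1[folded e_def]]) (use e0 N in \<open>auto intro: mult_right_mono\<close>)
    finally show "measure (iid I) B \<le> m * (real d * q ^ (b + 1 - d) + real (b - d) * q ^ (d + 1)) +
      ((3 * b) choose s) * (s * q ^ (b - s))" by (simp add: e_def)
  next
    fix \<omega> and x :: "nat \<Rightarrow> nat \<Rightarrow> complex"
    assume \<omega>: "\<omega> \<in> space (iid I) - B"
      and bd: "\<forall>j<m. \<forall>t<3. \<forall>a<b. \<forall>c<b. (j = 0 \<longrightarrow> a \<noteq> a0) \<longrightarrow> cmod (E \<omega> j t a c) \<le> \<Lambda>"
      and rows: "\<forall>j<m - 2. \<forall>a<b. cmod (row_value b (E \<omega> (j + 1)) a (x j) (x (j + 1)) (x (j + 2))) < \<eta>"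
      and row0: "\<forall>a<b. a \<noteq> a0 \<longrightarrow> cmod (row_value b (E \<omega> 0) a (x (m - 1)) (x 0) (x 1)) < \<eta>"
      and big: "\<exists>i<m. \<exists>c<b. 1 / 2 < cmod (x i c)"
    define y where "y p = x (triple_block m (fst p)) (snd p)" for p :: "nat \<times> nat"
    define Lg where "Lg = {p \<in> triple_index b. \<tau> \<le> cmod (y p)}"
    have "s < card Lg"
    proof (rule ccontr)
      assume "\<not> s < card Lg"
      then have "card Lg \<le> s" by simp
      moreover have "Lg \<subseteq> triple_index b" by (auto simp: Lg_def)
      moreover have "s \<le> card (triple_index b)" using sb by simp
      ultimately obtain T where T: "Lg \<subseteq> T" "T \<subseteq> triple_index b" "card T = s"
        using exists_subset_between[of Lg s "triple_index b"] by (auto simp: Lg_def)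
      then have TT: "T \<in> TT" by (simp add: TT_def)
      have off: "cmod (y p) < \<tau>" if "p \<in> triple_index b - T" for p
        using that T by (force simp: Lg_def not_le)
      show False
      \<comment> \<open>Two scales are compared. If all coordinates are below
        \<open>\<tau>'\<close>, the three blocks vanish at that scale. Otherwise a coordinate of
        size \<open>\<tau>'\<close> in \<open>T\<close> outweighs everything off \<open>T\<close>,
        which is below \<open>\<tau>\<close>, and contradicts robust injectivity of the columns in
        \<open>T\<close>.\<close>
      proof (cases "\<forall>p\<in>triple_index b. cmod (y p) < \<tau>'")
        case True
        have "vanish_event b m (E \<omega>) \<tau>' x"
          unfolding vanish_event_def
        proof (intro conjI ballI)
          fix j a assume "j \<in> {..<m - 2}" "a \<in> {..<b}"
          then show "cmod (row_value b (E \<omega> (j + 1)) a (x j) (x (j + 1)) (x (j + 2))) < \<tau>'"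
            using rows \<tau>'(2) by (metis lessThan_iff less_le_trans)
        next
          fix p assume "p \<in> triple_index b"
          then show "cmod (x (triple_block m (fst p)) (snd p)) < \<tau>'" using True by (simp add: y_def)
        next
          show "\<exists>i\<in>{..<m}. \<exists>c\<in>{..<b}. 1 / 2 < cmod (x i c)" using big by auto
        qed
        moreover have "\<omega> \<in> Bd" unfolding Bd_def using bd \<omega> N by auto
        ultimately have "\<omega> \<in> Z1" using \<omega> by (auto simp: Z1_def)
        then show False using \<omega> by (simp add: B_def)
      next
        case False
        then obtain k0 where k0: "k0 \<in> triple_index b" "\<tau>' \<le> cmod (y k0)" by (auto simp: not_less)
        have k0T: "k0 \<in> T" using off[of k0] k0 \<tau>'(3) by force
        have "(\<Sum>k\<in>T. E \<omega> 0 (fst k) a (snd k) * y k) =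
            row_value b (E \<omega> 0) a (x (m - 1)) (x 0) (x 1) - (\<Sum>k\<in>triple_index b - T. E \<omega> 0 (fst k) a (snd k) * y k)" for a
          unfolding row_value_triple y_def using T(2) by (simp add: sum.subset_diff)
        moreover have "cmod (\<Sum>k\<in>triple_index b - T. E \<omega> 0 (fst k) a (snd k) * y k) \<le> (3 * b) * (\<Lambda> * \<tau>)" if "a \<in> A" for a
        proof (rule norm_sum_mult_le)
          have "card (triple_index b - T) \<le> card (triple_index b)" by (intro card_mono) auto
          then show "card (triple_index b - T) \<le> 3 * b" by simp
          fix i assume i: "i \<in> triple_index b - T"
          then show "cmod (y i) \<le> \<tau>" using off by (simp add: less_imp_le)
          have "fst i < 3" "snd i < b" using i by (auto simp: triple_index_def)
          then show "cmod (E \<omega> 0 (fst i) a (snd i)) \<le> \<Lambda>" using bd that m by (auto simp: A_def)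
        qed (use \<Lambda> \<tau>' in auto)
        ultimately have "cmod (\<Sum>k\<in>T. E \<omega> 0 (fst k) a (snd k) * y k) \<le> \<eta> + (3 * b) * (\<Lambda> * \<tau>)" if "a \<in> A" for a
        proof -
          assume h: "\<And>a. (\<Sum>k\<in>T. E \<omega> 0 (fst k) a (snd k) * y k) =
              row_value b (E \<omega> 0) a (x (m - 1)) (x 0) (x 1) - (\<Sum>k\<in>triple_index b - T. E \<omega> 0 (fst k) a (snd k) * y k)"
            "\<And>a. a \<in> A \<Longrightarrow> cmod (\<Sum>k\<in>triple_index b - T. E \<omega> 0 (fst k) a (snd k) * y k) \<le> (3 * b) * (\<Lambda> * \<tau>)"
          have "cmod (row_value b (E \<omega> 0) a (x (m - 1)) (x 0) (x 1)) < \<eta>" using row0 that by (auto simp: A_def)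
          then show ?thesis unfolding h(1) using h(2)[OF that]
              norm_triangle_ineq4[of "row_value b (E \<omega> 0) a (x (m - 1)) (x 0) (x 1)" "\<Sum>k\<in>triple_index b - T. E \<omega> 0 (fst k) a (snd k) * y k"] by linarith
        qed
        then have "(\<Sum>a\<in>A. cmod (\<Sum>k\<in>T. E \<omega> 0 (fst k) a (snd k) * y k)) \<le> b * (\<eta> + (3 * b) * (\<Lambda> * \<tau>))"
          using \<tau>' \<Lambda> by (intro sum_le_const) (auto simp: A_def card_Diff_singleton_if)
        also have "\<dots> < r * \<tau>'" using \<tau>'(6) by simp
        also have "\<dots> \<le> r * cmod (y k0)" using k0 r by simp
        finally have "\<omega> \<in> Z2 T" unfolding Z2_def using \<omega> k0T by (auto simp: E_def)
        then show False using \<omega> TT by (auto simp: B_def)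
      qed
    qed
    then show "s < card {p \<in> triple_index b. \<tau> \<le> cmod (x (triple_block m (fst p)) (snd p))}"
      by (simp add: Lg_def y_def)
  qed
qed

end

section \<open>The Littlewood--Offord bound\<close>


text \<open>Induction by deleting a point: the members avoiding \<open>x\<close> form an antichain
  in \<open>X - {x}\<close>. Summing over \<open>x\<close> counts each \<open>A\<close> once per
  point outside it, and the absorption identity turns the weights for \<open>n\<close> into those
  for \<open>card X\<close>. The member \<open>X\<close> itself avoids no point, so it is treated
  first; it can only occur alone.\<close>

lemma LYM_inequality:
  fixes F :: "'a set set"
  assumes "finite X" "F \<subseteq> Pow X" "\<And>A B. A \<in> F \<Longrightarrow> B \<in> F \<Longrightarrow> A \<subseteq> B \<Longrightarrow> A = B"
  shows "(\<Sum>A\<in>F. 1 / real (card X choose card A)) \<le> 1"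
  using assms
proof (induction "card X" arbitrary: X F)
  case 0
  then have "F \<subseteq> {{}}" by auto
  then have "F = {} \<or> F = {{}}" by auto
  then show ?case by auto
next
  case (Suc n)
  have finF: "finite F" by (rule finite_subset[OF Suc.prems(2)]) (use Suc.prems(1) in simp)
  show ?case
  proof (cases "X \<in> F")
    case True
    have "A = X" if "A \<in> F" for A using Suc.prems(2) Suc.prems(3)[OF that True] that by blast
    then have "F = {X}" using True by blast
    then show ?thesis by simp
  next
    case False
    have sub: "A \<subseteq> X" "A \<noteq> X" if "A \<in> F" for A using that False Suc.prems by auto
    have lt: "card A < card X" if "A \<in> F" for A
      using sub[OF that] Suc.prems(1) by (simp add: psubset_card_mono psubset_eq)
    have each: "(\<Sum>A\<in>{A\<in>F. x \<notin> A}. 1 / real (n choose card A)) \<le> 1" if "x \<in> X" for x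
    proof -
      have "(\<Sum>A\<in>{A\<in>F. x \<notin> A}. 1 / real (card (X - {x}) choose card A)) \<le> 1"
        using Suc.prems Suc.hyps(2) that by (intro Suc.hyps(1)) auto
      moreover have "card (X - {x}) = n" using Suc.hyps(2) that Suc.prems(1) by simp
      ultimately show ?thesis by simp
    qed
    have "(\<Sum>x\<in>X. \<Sum>A\<in>{A\<in>F. x \<notin> A}. 1 / real (n choose card A)) = (\<Sum>A\<in>F. \<Sum>x\<in>{x\<in>X. x \<notin> A}. 1 / real (n choose card A))"
      using Suc.prems(1) finF by (rule sum.swap_restrict)
    also have "\<dots> = (\<Sum>A\<in>F. card X * (1 / real (card X choose card A)))"
    proof (rule sum.cong[OF refl])
      fix A assume A: "A \<in> F"
      have "{x\<in>X. x \<notin> A} = X - A" by auto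
      then have c: "card {x\<in>X. x \<notin> A} = card X - card A"
        using sub[OF A] Suc.prems(1) by (simp add: card_Diff_subset finite_subset)
      have "(card X - card A) * (card X choose card A) = card X * (n choose card A)"
        using binomial_absorb_comp[of "card X" "card A"] Suc.hyps(2)[symmetric] by simp
      then have e: "real (card X - card A) * real (card X choose card A) = real (card X) * real (n choose card A)"
        by (metis of_nat_mult)
      have "0 < n choose card A" "0 < card X choose card A" using lt[OF A] Suc.hyps(2) by (auto intro: zero_less_binomial)
      then have "real (card X - card A) / real (n choose card A) = real (card X) / real (card X choose card A)"
        using e by (simp add: field_simps)
      then show "(\<Sum>x\<in>{x\<in>X. x \<notin> A}. 1 / real (n choose card A)) = card X * (1 / real (card X choose card A))"
        by (simp add: c)
    qed
    also have "\<dots> = card X * (\<Sum>A\<in>F. 1 / real (card X choose card A))" by (simp add: sum_distrib_left)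
    finally have "card X * (\<Sum>A\<in>F. 1 / real (card X choose card A)) \<le> (\<Sum>x\<in>X. 1)"
      using each by (metis (no_types, lifting) sum_mono)
    then have le: "real (card X) * (\<Sum>A\<in>F. 1 / real (card X choose card A)) \<le> real (card X) * 1" by simp
    have c0: "0 < real (card X)" using Suc.hyps(2)[symmetric] by simp
    show ?thesis by (rule mult_le_cancel_left_pos[OF c0, THEN iffD1, OF le])
  qed
qed

lemma Sperner_bound:
  fixes F :: "'a set set"
  assumes "finite X" "F \<subseteq> Pow X" "\<And>A B. A \<in> F \<Longrightarrow> B \<in> F \<Longrightarrow> A \<subseteq> B \<Longrightarrow> A = B"
  shows "card F \<le> card X choose (card X div 2)"
proof -
  define M where "M = card X choose (card X div 2)"
  have M0: "0 < M" by (simp add: M_def zero_less_binomial)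
  have "(\<Sum>A\<in>F. 1 / real M) \<le> (\<Sum>A\<in>F. 1 / real (card X choose card A))"
  proof (rule sum_mono)
    fix A assume "A \<in> F"
    then have "card A \<le> card X" using assms by (intro card_mono) auto
    then have "0 < card X choose card A" by (simp add: zero_less_binomial)
    moreover have "card X choose card A \<le> M" unfolding M_def by (rule binomial_maximum)
    ultimately show "1 / real M \<le> 1 / real (card X choose card A)" by (simp add: frac_le)
  qed
  also have "\<dots> \<le> 1" by (rule LYM_inequality[OF assms])
  finally have "real (card F) \<le> real M" using M0 by (simp add: field_simps)
  then show ?thesis by (simp add: M_def)
qed

text \<open>The ratio of consecutive normalised coefficients is
  \<open>(2 * k + 1) / (2 * k + 2)\<close>; since \<open>(2 * k + 1) * (2 * k + 3)\<close> is below
  \<open>(2 * k + 2) ^ 2\<close>, the quantity \<open>(a k) ^ 2 * (2 * k + 1)\<close> decreases from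
  its value 1 at \<open>k = 0\<close>.\<close>

lemma central_binomial_even: "real ((2 * k) choose k) \<le> 4 ^ k / sqrt (2 * k + 1)"
proof -
  define a where "a k = real ((2 * k) choose k) / 4 ^ k" for k
  have "(a k)\<^sup>2 * (2 * k + 1) \<le> 1" for k
  proof (induction k)
    case 0
    show ?case by (simp add: a_def)
  next
    case (Suc k)
    have "Suc k * ((2 * Suc k) choose Suc k) = (2 * Suc k) * ((2 * k + 1) choose k)"
      using Suc_times_binomial_eq[of "2 * k + 1" k] by simp
    also have "\<dots> = 2 * (Suc k * ((2 * k + 1) choose k))" by (simp only: mult.assoc)
    also have "Suc k * ((2 * k + 1) choose k) = (2 * k + 1) * ((2 * k) choose k)"
      using binomial_absorb_comp[of "2 * k + 1" k] by simp
    finally have "real (Suc k * ((2 * Suc k) choose Suc k)) = real (2 * ((2 * k + 1) * ((2 * k) choose k)))"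
      by (rule arg_cong)
    then have "real (Suc k) * real ((2 * Suc k) choose Suc k) = 2 * real (2 * k + 1) * real ((2 * k) choose k)"
      by (simp only: of_nat_mult of_nat_numeral mult.assoc)
    moreover define C Y where "C = real ((2 * Suc k) choose Suc k)" and "Y = real ((2 * k) choose k)"
    ultimately have "C = Y * (2 * (2 * real k + 1) / (real k + 1))" by (simp add: field_simps)
    then have "C / 4 ^ Suc k = Y / 4 ^ k * ((2 * (2 * real k + 1) / (real k + 1)) / 4)" by simp
    also have "(2 * (2 * real k + 1) / (real k + 1)) / 4 = (2 * real k + 1) / (2 * real k + 2)" by (simp add: field_simps)
    finally have s: "a (Suc k) = a k * ((2 * real k + 1) / (2 * real k + 2))" by (simp only: a_def C_def Y_def)
    have "(a (Suc k))\<^sup>2 * (2 * Suc k + 1) = ((a k)\<^sup>2 * (2 * k + 1)) * ((2 * real k + 1) * (2 * real k + 3) / (2 * real k + 2)\<^sup>2)"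
      unfolding s by (simp add: power2_eq_square field_simps)
    also have "\<dots> \<le> 1 * 1"
    proof (rule mult_mono[OF Suc])
      have "0 < (2 * real k + 2)\<^sup>2" by simp
      then show "(2 * real k + 1) * (2 * real k + 3) / (2 * real k + 2)\<^sup>2 \<le> 1"
        by (subst divide_le_eq_1_pos) (simp_all add: power2_eq_square algebra_simps)
    qed simp_all
    finally show ?case by simp
  qed
  then have "(a k * sqrt (2 * k + 1))\<^sup>2 \<le> 1" by (simp add: power_mult_distrib)
  then have "a k * sqrt (2 * k + 1) \<le> 1" by (simp add: abs_square_le_1 abs_le_iff)
  then show ?thesis by (simp add: a_def field_simps)
qed

lemma central_binomial_bound: "real (n choose (n div 2)) \<le> 2 ^ n / sqrt (n + 1)"
proof (cases "even n")
  case True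
  then obtain k where "n = 2 * k" by auto
  then show ?thesis using central_binomial_even[of k] by (simp add: power_mult)
next
  case False
  then obtain k where n: "n = 2 * k + 1" by (auto elim: oddE)
  have "(2 * Suc k) choose Suc k = 2 * ((2 * k + 1) choose k)"
    using binomial_symmetric[of k "2 * k + 1"] by simp
  then have "2 * real (n choose (n div 2)) = real ((2 * Suc k) choose Suc k)" using n by simp
  also have "\<dots> \<le> 4 ^ Suc k / sqrt (2 * Suc k + 1)" by (rule central_binomial_even)
  also have "\<dots> \<le> 4 ^ Suc k / sqrt (n + 1)" using n by (intro divide_left_mono) auto
  also have "4 ^ Suc k = 2 * (2::real) ^ n" using n by (simp add: power_mult)
  finally show ?thesis by simp
qed

text \<open>The argument of Erdos: taking symmetric differences with the set \<open>P\<close> of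
  negative coefficients makes all coefficients positive up to a constant shift of the sums.
  Enlarging a set then raises its sum by at least \<open>\<rho>\<close>, which an open window of
  length \<open>\<rho>\<close> does not allow, so Sperner's theorem applies.\<close>

lemma real_Littlewood_Offord:
  fixes a :: "'a \<Rightarrow> real"
  assumes fin: "finite K" and big: "\<And>i. i \<in> K \<Longrightarrow> \<rho> \<le> \<bar>a i\<bar>" and \<rho>: "0 < \<rho>"
  shows "card {A. A \<subseteq> K \<and> sum a A \<in> {u<..<u + \<rho>}} \<le> card K choose (card K div 2)"
proof -
  define P where "P = {i \<in> K. a i < 0}"
  define f where "f A = (A - P) \<union> (P - A)" for A
  have ff: "f (f A) = A" for A by (auto simp: f_def)
  define F where "F = f ` {A. A \<subseteq> K \<and> sum a A \<in> {u<..<u + \<rho>}}"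
  have inj: "inj_on f S" for S by (metis ff inj_onI)
  have sumf: "sum a A = (\<Sum>i\<in>f A. \<bar>a i\<bar>) + sum a P" if "A \<subseteq> K" for A
  proof -
    have finA: "finite A" "finite P" using that fin finite_subset by (auto simp: P_def)
    have "(\<Sum>i\<in>f A. \<bar>a i\<bar>) = (\<Sum>i\<in>A - P. \<bar>a i\<bar>) + (\<Sum>i\<in>P - A. \<bar>a i\<bar>)"
      unfolding f_def using finA by (intro sum.union_disjoint) auto
    moreover have "(\<Sum>i\<in>A - P. \<bar>a i\<bar>) = sum a (A - P)"
      using that by (intro sum.cong) (auto simp: P_def)
    moreover have "(\<Sum>i\<in>P - A. \<bar>a i\<bar>) = - sum a (P - A)"
      unfolding sum_negf[symmetric] by (intro sum.cong) (auto simp: P_def)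
    moreover have "sum a A = sum a (A \<inter> P) + sum a (A - P)" using finA(1) by (rule sum.Int_Diff)
    moreover have "sum a P = sum a (P \<inter> A) + sum a (P - A)" using finA(2) by (rule sum.Int_Diff)
    moreover have "A \<inter> P = P \<inter> A" by auto
    ultimately show ?thesis by simp
  qed
  have "card F \<le> card K choose (card K div 2)"
  proof (rule Sperner_bound[OF fin])
    show "F \<subseteq> Pow K" by (auto simp: F_def f_def P_def)
    fix B C assume B: "B \<in> F" and C: "C \<in> F" and BC: "B \<subseteq> C"
    show "B = C"
    proof (rule ccontr)
      assume "B \<noteq> C"
      then obtain j where j: "j \<in> C - B" using BC by auto
      have BK: "B \<subseteq> K" "C \<subseteq> K" using B C by (auto simp: F_def f_def P_def)
      have finC: "finite C" using BK fin finite_subset by auto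
      have s: "u < (\<Sum>i\<in>B. \<bar>a i\<bar>) + sum a P" "(\<Sum>i\<in>C. \<bar>a i\<bar>) + sum a P < u + \<rho>"
        using B C sumf by (auto simp: F_def)
      have "(\<Sum>i\<in>B. \<bar>a i\<bar>) + \<bar>a j\<bar> = (\<Sum>i\<in>insert j B. \<bar>a i\<bar>)"
        using j finite_subset[OF BC finC] by simp
      also have "\<dots> \<le> (\<Sum>i\<in>C. \<bar>a i\<bar>)" using j BC finC by (intro sum_mono2) auto
      finally show False using s big[of j] j BK by auto
    qed
  qed
  moreover have "card F = card {A. A \<subseteq> K \<and> sum a A \<in> {u<..<u + \<rho>}}"
    unfolding F_def by (rule card_image[OF inj])
  ultimately show ?thesis by simp
qed

text \<open>The part of a subset outside \<open>K\<close> is fixed first; it only translates the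
  window, and there are \<open>2 ^ (card T - card K)\<close> choices for it.\<close>

lemma real_Littlewood_Offord_superset:
  fixes a :: "'a \<Rightarrow> real"
  assumes fin: "finite T" and K: "K \<subseteq> T" and big: "\<And>i. i \<in> K \<Longrightarrow> \<rho> \<le> \<bar>a i\<bar>" and \<rho>: "0 < \<rho>"
  shows "real (card {A. A \<subseteq> T \<and> sum a A \<in> {u<..<u + \<rho>}}) \<le> 2 ^ card T / sqrt (card K + 1)"
proof -
  have finK: "finite K" using K fin finite_subset by auto
  define G where "G D = {A. A \<subseteq> K \<and> sum a A \<in> {(u - sum a D)<..<(u - sum a D) + \<rho>}}" for D
  have "{A. A \<subseteq> T \<and> sum a A \<in> {u<..<u + \<rho>}} \<subseteq> (\<lambda>(D, A). D \<union> A) ` (SIGMA D : Pow (T - K). G D)"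
  proof
    fix A assume A: "A \<in> {A. A \<subseteq> T \<and> sum a A \<in> {u<..<u + \<rho>}}"
    have finA: "finite A" using A fin finite_subset by auto
    have "sum a A = sum a (A \<inter> K) + sum a (A - K)" using finA by (rule sum.Int_Diff)
    then have "A \<inter> K \<in> G (A - K)" using A by (auto simp: G_def)
    then have "(A - K, A \<inter> K) \<in> (SIGMA D : Pow (T - K). G D)" using A by blast
    moreover have "A = (\<lambda>(D, A). D \<union> A) (A - K, A \<inter> K)" by auto
    ultimately show "A \<in> (\<lambda>(D, A). D \<union> A) ` (SIGMA D : Pow (T - K). G D)" by (rule rev_image_eqI)
  qed
  moreover have finG: "finite (G D)" for D unfolding G_def using finK by simp
  ultimately have "card {A. A \<subseteq> T \<and> sum a A \<in> {u<..<u + \<rho>}} \<le> card (SIGMA D : Pow (T - K). G D)"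
    using fin by (intro surj_card_le[of _ _ "\<lambda>(D, A). D \<union> A"]) auto
  also have "\<dots> = (\<Sum>D\<in>Pow (T - K). card (G D))" using fin finG by (intro card_SigmaI) auto
  also have "\<dots> \<le> (\<Sum>D\<in>Pow (T - K). card K choose (card K div 2))"
    unfolding G_def by (intro sum_mono real_Littlewood_Offord[OF finK _ \<rho>] big)
  also have "\<dots> = 2 ^ (card T - card K) * (card K choose (card K div 2))"
    using fin finK K by (simp add: card_Pow card_Diff_subset)
  finally have "real (card {A. A \<subseteq> T \<and> sum a A \<in> {u<..<u + \<rho>}}) \<le> real (2 ^ (card T - card K) * (card K choose (card K div 2)))"
    by (rule of_nat_mono)
  also have "\<dots> = 2 ^ (card T - card K) * real (card K choose (card K div 2))" by simp
  also have "\<dots> \<le> 2 ^ (card T - card K) * (2 ^ card K / sqrt (card K + 1))"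
    by (intro mult_left_mono central_binomial_bound) auto
  also have "\<dots> = 2 ^ card T / sqrt (card K + 1)"
    using card_mono[OF fin K] by (simp add: power_add[symmetric])
  finally show ?thesis .
qed

text \<open>A coefficient of modulus at least \<open>2 * \<rho>\<close> has real or imaginary part
  at least \<open>\<rho>\<close>, so one of the two projections keeps half of the large
  coefficients. A disc of radius \<open>\<rho> / 2\<close> projects into a window of length
  \<open>\<rho>\<close>.\<close>

lemma complex_Littlewood_Offord:
  fixes a :: "'a \<Rightarrow> complex"
  assumes fin: "finite T" and \<rho>: "0 < \<rho>" and t: "t \<le> card {i \<in> T. 2 * \<rho> \<le> cmod (a i)}"
  shows "real (card {A. A \<subseteq> T \<and> cmod (v + sum a A) < \<rho> / 2}) \<le> 2 ^ card T / sqrt (t / 2 + 1)"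
proof -
  define K1 where "K1 = {i \<in> T. \<rho> \<le> \<bar>Re (a i)\<bar>}"
  define K2 where "K2 = {i \<in> T. \<rho> \<le> \<bar>Im (a i)\<bar>}"
  have finK: "finite K1" "finite K2" using fin by (auto simp: K1_def K2_def)
  have "{i \<in> T. 2 * \<rho> \<le> cmod (a i)} \<subseteq> K1 \<union> K2"
  proof
    fix i assume i: "i \<in> {i \<in> T. 2 * \<rho> \<le> cmod (a i)}"
    then show "i \<in> K1 \<union> K2" using cmod_le[of "a i"] by (auto simp: K1_def K2_def)
  qed
  then have "t \<le> card (K1 \<union> K2)" using t finK card_mono[of "K1 \<union> K2"] by (meson finite_UnI order_trans)
  then have tK: "t \<le> card K1 + card K2" using card_Un_le order_trans by blast
  have finP: "finite {A. A \<subseteq> T \<and> P A}" for P using fin by simp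
  have mono: "2 ^ card T / sqrt (real k + 1) \<le> 2 ^ card T / sqrt (t / 2 + 1)" if "t / 2 \<le> real k" for k
    using that by (intro divide_left_mono) auto
  show ?thesis
  proof (cases "t / 2 \<le> real (card K1)")
    case True
    have "{A. A \<subseteq> T \<and> cmod (v + sum a A) < \<rho> / 2} \<subseteq>
      {A. A \<subseteq> T \<and> sum (\<lambda>i. Re (a i)) A \<in> {(- Re v - \<rho> / 2)<..<(- Re v - \<rho> / 2) + \<rho>}}"
    proof (rule subsetI)
      fix A assume A: "A \<in> {A. A \<subseteq> T \<and> cmod (v + sum a A) < \<rho> / 2}"
      have "\<bar>Re (v + sum a A)\<bar> < \<rho> / 2" using A abs_Re_le_cmod[of "v + sum a A"] by simp
      then have "- (\<rho> / 2) < Re v + (\<Sum>i\<in>A. Re (a i))" "Re v + (\<Sum>i\<in>A. Re (a i)) < \<rho> / 2"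
        unfolding plus_complex.sel Re_sum by linarith+
      then show "A \<in> {A. A \<subseteq> T \<and> sum (\<lambda>i. Re (a i)) A \<in> {(- Re v - \<rho> / 2)<..<(- Re v - \<rho> / 2) + \<rho>}}"
        using A by simp
    qed
    then have "real (card {A. A \<subseteq> T \<and> cmod (v + sum a A) < \<rho> / 2}) \<le>
      real (card {A. A \<subseteq> T \<and> sum (\<lambda>i. Re (a i)) A \<in> {(- Re v - \<rho> / 2)<..<(- Re v - \<rho> / 2) + \<rho>}})"
      by (intro of_nat_mono card_mono finP)
    also have "\<dots> \<le> 2 ^ card T / sqrt (card K1 + 1)"
      by (rule real_Littlewood_Offord_superset[OF fin _ _ \<rho>]) (auto simp: K1_def)
    also have "\<dots> \<le> 2 ^ card T / sqrt (t / 2 + 1)" using mono[OF True] by (simp add: add.commute)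
    finally show ?thesis .
  next
    case False
    then have F: "t / 2 \<le> real (card K2)" using tK by linarith
    have "{A. A \<subseteq> T \<and> cmod (v + sum a A) < \<rho> / 2} \<subseteq>
      {A. A \<subseteq> T \<and> sum (\<lambda>i. Im (a i)) A \<in> {(- Im v - \<rho> / 2)<..<(- Im v - \<rho> / 2) + \<rho>}}"
    proof (rule subsetI)
      fix A assume A: "A \<in> {A. A \<subseteq> T \<and> cmod (v + sum a A) < \<rho> / 2}"
      have "\<bar>Im (v + sum a A)\<bar> < \<rho> / 2" using A abs_Im_le_cmod[of "v + sum a A"] by simp
      then have "- (\<rho> / 2) < Im v + (\<Sum>i\<in>A. Im (a i))" "Im v + (\<Sum>i\<in>A. Im (a i)) < \<rho> / 2"
        unfolding plus_complex.sel Im_sum by linarith+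
      then show "A \<in> {A. A \<subseteq> T \<and> sum (\<lambda>i. Im (a i)) A \<in> {(- Im v - \<rho> / 2)<..<(- Im v - \<rho> / 2) + \<rho>}}"
        using A by simp
    qed
    then have "real (card {A. A \<subseteq> T \<and> cmod (v + sum a A) < \<rho> / 2}) \<le>
      real (card {A. A \<subseteq> T \<and> sum (\<lambda>i. Im (a i)) A \<in> {(- Im v - \<rho> / 2)<..<(- Im v - \<rho> / 2) + \<rho>}})"
      by (intro of_nat_mono card_mono finP)
    also have "\<dots> \<le> 2 ^ card T / sqrt (card K2 + 1)"
      by (rule real_Littlewood_Offord_superset[OF fin _ _ \<rho>]) (auto simp: K2_def)
    also have "\<dots> \<le> 2 ^ card T / sqrt (t / 2 + 1)" using mono[OF F] by (simp add: add.commute)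
    finally show ?thesis .
  qed
qed

context atom_dist
begin

text \<open>Each coordinate is drawn from two independent copies according to a fair coin; given the
  copies, the linear form is a random subset sum.\<close>
lemma linear_form_small_ball:
  fixes w :: "'i \<Rightarrow> complex" and r \<tau> q :: real
  assumes finT: "finite T" and w: "\<And>i. i \<in> T \<Longrightarrow> \<tau> \<le> cmod (w i)" and \<tau>: "0 < \<tau>" and r: "0 < r"
    and conc: "\<And>a. measure \<mu> (ball a r) \<le> q" and t: "t \<le> card T"
  shows "measure (iid T) {\<omega> \<in> space (iid T). cmod (v + (\<Sum>i\<in>T. w i * \<omega> i)) < \<tau> * r / 4} \<le>
    1 / sqrt (t / 2 + 1) + (card T choose t) * q ^ (card T - t)"
proof -
  define s where "s = card T"
  define D where "D = {\<omega> \<in> space (iid T). cmod (v + (\<Sum>i\<in>T. w i * \<omega> i)) < \<tau> * r / 4}"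
  have D: "D \<in> sets (iid T)"
  proof -
    have [measurable]: "(\<lambda>\<omega>. v + (\<Sum>i\<in>T. w i * \<omega> i)) \<in> borel_measurable (iid T)"
      by (intro borel_measurable_add borel_measurable_sum borel_measurable_times coord_measurable) auto
    show ?thesis unfolding D_def by measurable
  qed
  define I where "I = T \<times> (UNIV :: bool set)"
  have finI: "finite I" using finT by (simp add: I_def)
  define pick where "pick A \<omega> = (\<lambda>i\<in>T. \<omega> (i, i \<in> A))" for A and \<omega> :: "'i \<times> bool \<Rightarrow> complex"
  have pickm: "pick A \<in> measurable (iid I) (iid T)" for A
    unfolding pick_def by (intro measurable_restrict measurable_component_singleton) (auto simp: I_def)
  define DA where "DA A = pick A -` D \<inter> space (iid I)" for A
  have DAm: "DA A \<in> sets (iid I)" for A unfolding DA_def by (rule measurable_sets[OF pickm D])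
  \<comment> \<open>For each fixed \<open>A\<close> the selected coordinates are again an iid
    family, so all events \<open>DA A\<close> have the probability to be estimated.\<close>
  have law: "measure (iid I) (DA A) = measure (iid T) D" for A
  proof -
    have "distr (iid I) (iid T) (\<lambda>\<omega>. \<lambda>i\<in>T. \<omega> (i, i \<in> A)) = iid T"
      by (rule distr_PiM_reindex[of I "\<lambda>_. \<mu>" "\<lambda>i. (i, i \<in> A)" T]) (auto simp: inj_on_def I_def intro: prob_space_axioms)
    moreover have "(\<lambda>\<omega>. \<lambda>i\<in>T. \<omega> (i, i \<in> A)) = pick A" by (rule ext) (simp add: pick_def)
    ultimately have "measure (iid T) D = measure (distr (iid I) (iid T) (pick A)) D" by simp
    also have "\<dots> = measure (iid I) (DA A)" unfolding DA_def by (rule measure_distr[OF pickm D])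
    finally show ?thesis by simp
  qed
  define few where "few = {\<omega> \<in> space (iid I). card {i \<in> T. r \<le> cmod (\<omega> (i, True) - \<omega> (i, False))} < t}"
  define bad where "bad K = {\<omega> \<in> space (iid I). \<forall>i\<in>K. cmod (\<omega> (i, True) - \<omega> (i, False)) < r}" for K
  \<comment> \<open>Fewer than \<open>t\<close> large differences leave at least
    \<open>s - t\<close> small ones. At each of those positions one copy confines the other to a
    ball of radius \<open>r\<close>, which costs \<open>q\<close>; the choice of the positions costs
    the binomial coefficient.\<close>
  define KK where "KK = {K. K \<subseteq> T \<and> card K = s - t}"
  have finKK: "finite KK" and cKK: "card KK = s choose t"
    unfolding KK_def s_def using n_subsets[OF finT, of "card T - t"] finT t by (auto simp: binomial_symmetric[symmetric])
  have badm: "bad K \<in> sets (iid I)" if "K \<in> KK" for K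
    unfolding bad_def
  proof (intro sets.sets_Collect_finite_All)
    show "finite K" using that finT finite_subset by (auto simp: KK_def)
    fix i assume "i \<in> K"
    then have [measurable]: "(\<lambda>\<omega>. \<omega> (i, True)) \<in> borel_measurable (iid I)" "(\<lambda>\<omega>. \<omega> (i, False)) \<in> borel_measurable (iid I)"
      using that by (auto simp: KK_def I_def intro!: coord_measurable)
    show "{\<omega> \<in> space (iid I). cmod (\<omega> (i, True) - \<omega> (i, False)) < r} \<in> sets (iid I)" by measurable
  qed
  have badP: "measure (iid I) (bad K) \<le> q ^ (s - t)" if K: "K \<in> KK" for K
  proof -
    define J where "J = (\<lambda>i. (i, True)) ` K"
    have "card J = s - t" unfolding J_def using K by (subst card_image) (auto simp: inj_on_def KK_def)
    have JI: "J \<subseteq> I" using K by (auto simp: J_def I_def KK_def)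
    have "measure (iid I) (bad K) \<le> q ^ card J"
    proof (rule small_ball_product[OF finI JI badm[OF K] conc])
      fix x :: "'i \<times> bool \<Rightarrow> complex"
      show "\<exists>a. \<forall>y\<in>space (iid J). merge (I - J) J (x, y) \<in> bad K \<longrightarrow> (\<forall>j\<in>J. cmod (y j - a j) < r)"
      proof (intro exI[of _ "\<lambda>j. x (fst j, False)"] ballI impI)
        fix y j assume y: "merge (I - J) J (x, y) \<in> bad K" and j: "j \<in> J"
        then obtain i where i: "i \<in> K" "j = (i, True)" by (auto simp: J_def)
        have "(i, False) \<in> I - J" using i K by (auto simp: I_def J_def KK_def)
        moreover have "cmod (merge (I - J) J (x, y) (i, True) - merge (I - J) J (x, y) (i, False)) < r"
          using y i by (auto simp: bad_def)
        ultimately show "cmod (y j - x (fst j, False)) < r" using j i by (simp add: merge_def)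
      qed
    qed
    then show ?thesis using \<open>card J = s - t\<close> by simp
  qed
  have few_sub: "few \<subseteq> (\<Union>K\<in>KK. bad K)"
  proof
    fix \<omega> assume \<omega>: "\<omega> \<in> few"
    define Gd where "Gd = {i \<in> T. r \<le> cmod (\<omega> (i, True) - \<omega> (i, False))}"
    have "s - t \<le> card (T - Gd)" using \<omega> finT by (subst card_Diff_subset) (auto simp: Gd_def few_def s_def)
    then obtain K where "K \<subseteq> T - Gd" "card K = s - t" by (meson obtain_subset_with_card_n)
    then show "\<omega> \<in> (\<Union>K\<in>KK. bad K)" using \<omega> by (intro UN_I[of K]) (auto simp: KK_def bad_def few_def Gd_def not_le)
  qed
  define S1 where "S1 = (\<Union>K\<in>KK. bad K)"
  have S1: "S1 \<in> sets (iid I)" unfolding S1_def using finKK badm by (intro sets.finite_UN) auto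
  have PS1: "measure (iid I) S1 \<le> (s choose t) * q ^ (s - t)"
  proof -
    have "measure (iid I) S1 \<le> (\<Sum>K\<in>KK. measure (iid I) (bad K))" unfolding S1_def
      using finKK badm by (intro finite_measure.finite_measure_subadditive_finite[OF prob_space.finite_measure[OF prob_space_iid]]) auto
    also have "\<dots> \<le> (\<Sum>K\<in>KK. q ^ (s - t))" by (intro sum_mono badP)
    finally show ?thesis by (simp add: cKK)
  qed
  define \<beta> where "\<beta> = 1 / sqrt (t / 2 + 1)"
  have \<beta>0: "0 \<le> \<beta>" by (simp add: \<beta>_def)
  have count: "real (card {A. A \<subseteq> T \<and> \<omega> \<in> DA A}) \<le> 2 ^ s * \<beta> + 2 ^ s * indicator S1 \<omega>" if \<omega>: "\<omega> \<in> space (iid I)" for \<omega>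
  proof (cases "\<omega> \<in> S1")
    case True
    have "card {A. A \<subseteq> T \<and> \<omega> \<in> DA A} \<le> card (Pow T)" using finT by (intro card_mono) auto
    then have "real (card {A. A \<subseteq> T \<and> \<omega> \<in> DA A}) \<le> 2 ^ s" using finT by (simp add: card_Pow s_def numeral_power_le_of_nat_cancel_iff)
    then show ?thesis using True \<beta>0 by (simp add: add_increasing)
  next
    case False
    then have nf: "\<omega> \<notin> few" using few_sub by (auto simp: S1_def)
    define a where "a i = w i * (\<omega> (i, True) - \<omega> (i, False))" for i
    define u where "u = v + (\<Sum>i\<in>T. w i * \<omega> (i, False))"
    have "(\<Sum>i\<in>T. w i * \<omega> (i, i \<in> A)) = (\<Sum>i\<in>T. w i * \<omega> (i, False)) + sum a A" if "A \<subseteq> T" for A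
    proof -
      have "(\<Sum>i\<in>T. w i * \<omega> (i, i \<in> A)) = (\<Sum>i\<in>T. w i * \<omega> (i, False) + (if i \<in> A then a i else 0))"
        by (intro sum.cong refl) (auto simp: a_def algebra_simps)
      also have "\<dots> = (\<Sum>i\<in>T. w i * \<omega> (i, False)) + sum a (T \<inter> A)"
        using finT by (simp add: sum.distrib sum.inter_restrict)
      finally show ?thesis using that by (simp add: Int_absorb1)
    qed
    then have "{A. A \<subseteq> T \<and> \<omega> \<in> DA A} \<subseteq> {A. A \<subseteq> T \<and> cmod (u + sum a A) < (\<tau> * r / 2) / 2}"
      by (auto simp: DA_def D_def pick_def u_def add.assoc)
    then have "card {A. A \<subseteq> T \<and> \<omega> \<in> DA A} \<le> card {A. A \<subseteq> T \<and> cmod (u + sum a A) < (\<tau> * r / 2) / 2}"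
      using finT by (intro card_mono) auto
    then have "real (card {A. A \<subseteq> T \<and> \<omega> \<in> DA A}) \<le> real (card {A. A \<subseteq> T \<and> cmod (u + sum a A) < (\<tau> * r / 2) / 2})" by simp
    \<comment> \<open>Weights of size \<open>\<tau>\<close> and differences of size \<open>r\<close>
      give coefficients of size \<open>\<tau> * r\<close>, which is twice the parameter
      \<open>\<tau> * r / 2\<close> used here; this explains the radius
      \<open>\<tau> * r / 4\<close> of the statement.\<close>
    also have "\<dots> \<le> 2 ^ card T / sqrt (t / 2 + 1)"
    proof (rule complex_Littlewood_Offord[OF finT])
      show "0 < \<tau> * r / 2" using \<tau> r by simp
      have "{i \<in> T. r \<le> cmod (\<omega> (i, True) - \<omega> (i, False))} \<subseteq> {i \<in> T. 2 * (\<tau> * r / 2) \<le> cmod (a i)}"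
        using w \<tau> r by (auto simp: a_def norm_mult intro!: mult_mono)
      then have "card {i \<in> T. r \<le> cmod (\<omega> (i, True) - \<omega> (i, False))} \<le> card {i \<in> T. 2 * (\<tau> * r / 2) \<le> cmod (a i)}"
        using finT by (intro card_mono) auto
      then show "t \<le> card {i \<in> T. 2 * (\<tau> * r / 2) \<le> cmod (a i)}" using nf \<omega> by (auto simp: few_def)
    qed
    also have "\<dots> = 2 ^ s * \<beta>" by (simp add: \<beta>_def s_def)
    finally show ?thesis using False by simp
  qed
  \<comment> \<open>Averaging over the coins: the sum of the equal probabilities over all
    \<open>A\<close> is the expected number of subsets whose sum falls into the disc, and
    \<open>count\<close> bounds that number pointwise.\<close>
  have "2 ^ s * measure (iid T) D = (\<Sum>A\<in>Pow T. measure (iid I) (DA A))"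
    unfolding law using finT by (simp add: card_Pow s_def)
  also have "\<dots> \<le> 2 ^ s * \<beta> + 2 ^ s * measure (iid I) S1"
  proof -
    interpret PI: prob_space "iid I" by (rule prob_space_iid)
    have "(\<Sum>A\<in>Pow T. measure (iid I) (DA A)) = (\<Sum>A\<in>Pow T. \<integral>\<omega>. indicator (DA A) \<omega> \<partial>iid I)"
      using DAm sets.sets_into_space by (intro sum.cong refl) (simp add: Int_absorb2)
    also have "\<dots> = (\<integral>\<omega>. (\<Sum>A\<in>Pow T. indicator (DA A) \<omega>) \<partial>iid I)"
      using DAm by (intro Bochner_Integration.integral_sum[symmetric]) (auto simp: PI.emeasure_finite less_top[symmetric])
    also have "\<dots> \<le> (\<integral>\<omega>. 2 ^ s * \<beta> + 2 ^ s * indicator S1 \<omega> \<partial>iid I)"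
    proof (rule integral_mono)
      show "integrable (iid I) (\<lambda>\<omega>. \<Sum>A\<in>Pow T. indicator (DA A) \<omega> :: real)"
        using DAm by (intro Bochner_Integration.integrable_sum) (auto simp: PI.emeasure_finite less_top[symmetric])
      show "integrable (iid I) (\<lambda>\<omega>. 2 ^ s * \<beta> + 2 ^ s * indicator S1 \<omega> :: real)"
        using S1 by (auto simp: PI.emeasure_finite less_top[symmetric])
      fix \<omega> assume "\<omega> \<in> space (iid I)"
      have "(\<Sum>A\<in>Pow T. indicator (DA A) \<omega> :: real) = (\<Sum>A\<in>Pow T. if \<omega> \<in> DA A then 1 else 0)"
        by (intro sum.cong refl) (simp add: indicator_def)
      also have "\<dots> = real (card {A. A \<subseteq> T \<and> \<omega> \<in> DA A})"
        using finT by (simp add: sum.If_cases Int_def Pow_def)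
      finally show "(\<Sum>A\<in>Pow T. indicator (DA A) \<omega>) \<le> 2 ^ s * \<beta> + 2 ^ s * indicator S1 \<omega>"
        using count[OF \<open>\<omega> \<in> space (iid I)\<close>] by simp
    qed
    also have "\<dots> = 2 ^ s * \<beta> + 2 ^ s * measure (iid I) S1"
      using S1 sets.sets_into_space[OF S1] by (subst Bochner_Integration.integral_add) (auto simp: PI.emeasure_finite less_top[symmetric] PI.prob_space Int_absorb2)
    finally show ?thesis .
  qed
  also have "\<dots> = 2 ^ s * (\<beta> + measure (iid I) S1)" by (simp add: distrib_left)
  finally have "measure (iid T) D \<le> \<beta> + measure (iid I) S1" by simp
  then show ?thesis using PS1 by (simp add: D_def \<beta>_def s_def)
qed

end

section \<open>The periodic band matrix\<close>


text \<open>The shift is scaled instead of the matrix: for \<open>\<zeta> = z * sqrt (3 * b)\<close>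
  this is \<open>sqrt (3 * b)\<close> times the matrix of the theorem, and the atoms keep unit
  variance.\<close>

definition shifted_band :: "nat \<Rightarrow> nat \<Rightarrow> complex \<Rightarrow> (nat \<times> nat \<times> nat \<Rightarrow> complex) \<Rightarrow> nat \<Rightarrow> nat \<Rightarrow> complex" where
  "shifted_band m b \<zeta> \<omega> r s = band_entry m b \<omega> r s - (if r = s then \<zeta> else 0)"

text \<open>Position of the atom that multiplies coordinate \<open>c\<close> of neighbour
  \<open>t\<close> (previous, own, next) in equation \<open>a\<close> of row block
  \<open>I0 + j\<close>. Counting from \<open>I0\<close> allows every row block to be the
  distinguished block \<open>0\<close> of the cyclic system.\<close>

definition row_system :: "nat \<Rightarrow> nat \<Rightarrow> nat \<Rightarrow> nat \<Rightarrow> nat \<Rightarrow> nat \<Rightarrow> nat \<times> nat \<times> nat" where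
  "row_system m I0 j t a c = (let I = (I0 + j) mod m in
     (if t = 0 then 3 * ((I + m - 1) mod m) + 2 else if t = 1 then 3 * I else 3 * ((I + 1) mod m) + 1, a, c))"

text \<open>The same for the transposed matrix, so that rows and columns become instances of one
  cyclic system. The three blocks of block column \<open>J\<close> are those numbered
  \<open>3 * J\<close>, \<open>3 * J + 1\<close> and \<open>3 * J + 2\<close>; the entry is read as
  \<open>(c, a)\<close> because the equation index is now the column.\<close>

definition column_system :: "nat \<Rightarrow> nat \<Rightarrow> nat \<Rightarrow> nat \<Rightarrow> nat \<Rightarrow> nat \<Rightarrow> nat \<times> nat \<times> nat" where
  "column_system m I0 j t a c = (let J = (I0 + j) mod m in
     (if t = 0 then 3 * J + 1 else if t = 1 then 3 * J else 3 * J + 2, c, a))"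

definition diagonal_shift :: "complex \<Rightarrow> nat \<Rightarrow> nat \<Rightarrow> nat \<Rightarrow> complex" where
  "diagonal_shift \<zeta> t a c = (if t = 1 \<and> a = c then - \<zeta> else 0)"

definition cyclic_blocks :: "nat \<Rightarrow> nat \<Rightarrow> nat \<Rightarrow> (nat \<Rightarrow> complex) \<Rightarrow> nat \<Rightarrow> nat \<Rightarrow> complex" where
  "cyclic_blocks m b I0 v i c = v (((I0 + i) mod m) * b + c)"

lemma mod_shift_inj:
  fixes m :: nat
  assumes "j < m" "j' < m" "(I0 + j) mod m = (I0 + j') mod m"
  shows "j = j'"
  using assms
proof (induction j j' rule: linorder_wlog)
  case (le j j')
  then have "m dvd (I0 + j') - (I0 + j)" by (subst mod_eq_dvd_iff_nat[symmetric]) auto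
  then have "m dvd j' - j" by simp
  then show ?case using le by (auto dest: dvd_imp_le)
next
  case (sym j j')
  then show ?case by simp
qed

lemma mod_prev: "0 < m \<Longrightarrow> ((I0 + Suc j) mod m + m - 1) mod m = (I0 + j) mod m"
proof -
  assume m: "0 < m"
  have "((I0 + Suc j) mod m + m - 1) mod m = ((I0 + Suc j) mod m + (m - 1)) mod m" using m by simp
  also have "\<dots> = (I0 + Suc j + (m - 1)) mod m" by (rule mod_add_left_eq)
  also have "I0 + Suc j + (m - 1) = (I0 + j) + m" using m by simp
  finally show ?thesis by simp
qed

lemma mod_pred_inj:
  fixes m :: nat
  assumes "I < m" "I' < m" "(I + m - 1) mod m = (I' + m - 1) mod m"
  shows "I = I'"
proof -
  have "(I + m - 1) mod m = (if I = 0 then m - 1 else I - 1)" if "I < m" for I :: nat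
  proof (cases I)
    case (Suc i)
    then have "I + m - 1 = i + m" by simp
    then show ?thesis using Suc that by simp
  qed (use that in auto)
  then show ?thesis using assms by (auto split: if_splits)
qed

lemma mod_succ_inj:
  fixes m :: nat
  assumes "I < m" "I' < m" "(I + 1) mod m = (I' + 1) mod m"
  shows "I = I'"
  using assms by (auto simp: mod_Suc split: if_splits)

lemma block_sum:
  fixes f :: "nat \<Rightarrow> 'a::comm_monoid_add"
  shows "(\<Sum>s<m * b. f s) = (\<Sum>J<m. \<Sum>c<b. f (J * b + c))"
proof -
  have "(\<Sum>s<m * b. f s) = (\<Sum>J<m. sum f {J * b..<J * b + b})" by (rule sum.nat_group[symmetric])
  also have "\<dots> = (\<Sum>J<m. \<Sum>c<b. f (J * b + c))"
  proof (rule sum.cong[OF refl])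
    fix J
    have "sum f {J * b..<J * b + b} = (\<Sum>c\<in>{0..<b}. f (J * b + c))"
      using sum.shift_bounds_nat_ivl[of f 0 "J * b" b] by (simp add: add.commute)
    then show "sum f {J * b..<J * b + b} = (\<Sum>c<b. f (J * b + c))" by (simp add: atLeast0LessThan)
  qed
  finally show ?thesis .
qed

lemma block_eq_iff: "c < b \<Longrightarrow> c' < b \<Longrightarrow> J * b + c = J' * b + c' \<longleftrightarrow> J = J' \<and> c = (c' :: nat)"
  by (metis div_mult_self3 div_less add.commute add_cancel_right_left mod_mult_self3 mod_less not_less_zero mult.commute)

lemma block_less: "J < m \<Longrightarrow> c < b \<Longrightarrow> J * b + c < m * (b::nat)"
proof -
  assume "J < m" "c < b"
  then have "J * b + c < Suc J * b" by simp
  also have "\<dots> \<le> m * b" using \<open>J < m\<close> by (intro mult_le_mono1) simp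
  finally show ?thesis .
qed

lemma shifted_band_block:
  assumes "c < b" "a < b"
  shows "shifted_band m b \<zeta> \<omega> (I * b + a) (J * b + c) =
    (if J = I then \<omega> (3 * I, a, c) - (if a = c then \<zeta> else 0)
     else if J = (I + m - 1) mod m then \<omega> (3 * J + 2, a, c)
     else if J = (I + 1) mod m then \<omega> (3 * J + 1, a, c) else 0)"
proof -
  have "(I * b + a) div b = I" "(I * b + a) mod b = a" "(J * b + c) div b = J" "(J * b + c) mod b = c"
    using assms by auto
  moreover have "(I * b + a = J * b + c) = (J = I \<and> a = c)" using block_eq_iff[OF assms(2,1), of I J] by auto
  ultimately show ?thesis by (auto simp: shifted_band_def band_entry_def Let_def)
qed

text \<open>For \<open>m = 2\<close> the previous and the next block would coincide; this is the
  origin of the condition \<open>3 \<le> m\<close>.\<close>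

lemma neighbours_distinct:
  fixes m :: nat
  assumes "3 \<le> m" "I < m"
  shows "(I + m - 1) mod m \<noteq> I" "(I + 1) mod m \<noteq> I" "(I + m - 1) mod m \<noteq> (I + 1) mod m"
    "(I + m - 1) mod m < m" "(I + 1) mod m < m"
proof -
  have p: "(I + m - 1) mod m = (if I = 0 then m - 1 else I - 1)"
  proof (cases I)
    case (Suc i)
    then have "I + m - 1 = i + m" by simp
    then show ?thesis using Suc assms by simp
  qed (use assms in auto)
  have n: "(I + 1) mod m = (if I + 1 = m then 0 else I + 1)" using assms by auto
  show "(I + m - 1) mod m \<noteq> I" "(I + 1) mod m \<noteq> I" "(I + m - 1) mod m \<noteq> (I + 1) mod m"
    unfolding p n using assms by (auto split: if_splits)
qed (use assms in auto)

lemma neighbour_swap: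
  fixes m :: nat
  assumes "I < m" "J < m"
  shows "(J = (I + m - 1) mod m) = (I = (J + 1) mod m)"
proof -
  have p: "(I + m - 1) mod m = (if I = 0 then m - 1 else I - 1)"
  proof (cases I)
    case (Suc i)
    then have "I + m - 1 = i + m" by simp
    then show ?thesis using Suc assms by simp
  qed (use assms in auto)
  have n: "(J + 1) mod m = (if J + 1 = m then 0 else J + 1)" using assms by auto
  show ?thesis unfolding p n using assms by auto
qed

section \<open>Matrix rows and columns as equations of the cyclic system\<close>

lemma row_equation:
  assumes m: "3 \<le> m" and I: "I < m" and a: "a < b"
  shows "(\<Sum>s<m * b. shifted_band m b \<zeta> \<omega> (I * b + a) s * v s) =
    row_value b (\<lambda>t a c. \<omega> (row_system m I 0 t a c) + diagonal_shift \<zeta> t a c) a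
      (\<lambda>c. v (((I + m - 1) mod m) * b + c)) (\<lambda>c. v (I * b + c)) (\<lambda>c. v (((I + 1) mod m) * b + c))"
proof -
  define P where "P = (I + m - 1) mod m"
  define Q where "Q = (I + 1) mod m"
  have d: "P \<noteq> I" "Q \<noteq> I" "P \<noteq> Q" "P < m" "Q < m" using neighbours_distinct[OF m I] by (auto simp: P_def Q_def)
  define g where "g J = (\<Sum>c<b. shifted_band m b \<zeta> \<omega> (I * b + a) (J * b + c) * v (J * b + c))" for J
  have "(\<Sum>s<m * b. shifted_band m b \<zeta> \<omega> (I * b + a) s * v s) = (\<Sum>J<m. g J)"
    unfolding g_def by (rule block_sum)
  also have "\<dots> = (\<Sum>J\<in>{P, I, Q}. g J)"
    using d I a by (intro sum.mono_neutral_right) (auto simp: g_def shifted_band_block P_def Q_def intro!: sum.neutral)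
  also have "\<dots> = g P + g I + g Q" using d by (simp add: add.assoc)
  also have "g P = (\<Sum>c<b. \<omega> (row_system m I 0 0 a c) * v (P * b + c))"
    unfolding g_def using d a I by (intro sum.cong refl) (auto simp: shifted_band_block row_system_def P_def)
  also have "g Q = (\<Sum>c<b. \<omega> (row_system m I 0 2 a c) * v (Q * b + c))"
    unfolding g_def using d a I by (intro sum.cong refl) (auto simp: shifted_band_block row_system_def P_def Q_def)
  also have "g I = (\<Sum>c<b. (\<omega> (row_system m I 0 1 a c) + diagonal_shift \<zeta> 1 a c) * v (I * b + c))"
    unfolding g_def using a I by (intro sum.cong refl) (auto simp: shifted_band_block row_system_def diagonal_shift_def)
  finally show ?thesis by (simp add: row_value_def diagonal_shift_def P_def Q_def)
qed

lemma column_equation: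
  assumes m: "3 \<le> m" and J: "J < m" and c: "c < b"
  shows "(\<Sum>r<m * b. w r * shifted_band m b \<zeta> \<omega> r (J * b + c)) =
    row_value b (\<lambda>t a c. \<omega> (column_system m J 0 t a c) + diagonal_shift \<zeta> t a c) c
      (\<lambda>a. w (((J + m - 1) mod m) * b + a)) (\<lambda>a. w (J * b + a)) (\<lambda>a. w (((J + 1) mod m) * b + a))"
proof -
  define P where "P = (J + m - 1) mod m"
  define Q where "Q = (J + 1) mod m"
  have d: "P \<noteq> J" "Q \<noteq> J" "P \<noteq> Q" "P < m" "Q < m" using neighbours_distinct[OF m J] by (auto simp: P_def Q_def)
  define g where "g I = (\<Sum>a<b. w (I * b + a) * shifted_band m b \<zeta> \<omega> (I * b + a) (J * b + c))" for I
  have sb: "shifted_band m b \<zeta> \<omega> (I * b + a) (J * b + c) =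
     (if I = J then \<omega> (3 * J, a, c) - (if a = c then \<zeta> else 0)
     else if I = Q then \<omega> (3 * J + 2, a, c)
     else if I = P then \<omega> (3 * J + 1, a, c) else 0)" if "I < m" "a < b" for I a
    unfolding shifted_band_block[OF c that(2)] P_def Q_def
    using neighbour_swap[OF that(1) J] neighbour_swap[OF J that(1)] by auto
  have "(\<Sum>r<m * b. w r * shifted_band m b \<zeta> \<omega> r (J * b + c)) = (\<Sum>I<m. g I)"
    unfolding g_def by (rule block_sum)
  also have "\<dots> = (\<Sum>I\<in>{P, J, Q}. g I)"
    using d J by (intro sum.mono_neutral_right) (auto simp: g_def sb intro!: sum.neutral)
  also have "\<dots> = g P + g J + g Q" using d by (simp add: add.assoc)
  also have "g P = (\<Sum>a<b. \<omega> (column_system m J 0 0 c a) * w (P * b + a))"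
    unfolding g_def using d J by (intro sum.cong refl) (auto simp: sb column_system_def)
  also have "g Q = (\<Sum>a<b. \<omega> (column_system m J 0 2 c a) * w (Q * b + a))"
    unfolding g_def using d J by (intro sum.cong refl) (auto simp: sb column_system_def)
  also have "g J = (\<Sum>a<b. (\<omega> (column_system m J 0 1 c a) + diagonal_shift \<zeta> 1 c a) * w (J * b + a))"
    unfolding g_def using J by (intro sum.cong refl) (auto simp: sb column_system_def diagonal_shift_def)
  finally show ?thesis by (simp add: row_value_def diagonal_shift_def P_def Q_def)
qed

lemma row_system_mod: "row_system m I0 j = row_system m ((I0 + j) mod m) 0"
  by (intro ext) (simp add: row_system_def)

lemma column_system_mod: "column_system m I0 j = column_system m ((I0 + j) mod m) 0"
  by (intro ext) (simp add: column_system_def)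

lemma row_system_equations:
  fixes \<omega> v I0 \<zeta>
  assumes m: "3 \<le> m" and I0: "I0 < m" and a: "a < b"
  defines "E \<equiv> (\<lambda>j t a c. \<omega> (row_system m I0 j t a c) + diagonal_shift \<zeta> t a c)" and "x \<equiv> cyclic_blocks m b I0 v"
  shows "row_value b (E (j + 1)) a (x j) (x (j + 1)) (x (j + 2)) =
      (\<Sum>s<m * b. shifted_band m b \<zeta> \<omega> (((I0 + (j + 1)) mod m) * b + a) s * v s)"
    and "row_value b (E 0) a (x (m - 1)) (x 0) (x 1) = (\<Sum>s<m * b. shifted_band m b \<zeta> \<omega> (I0 * b + a) s * v s)"
proof -
  define I where "I = (I0 + (j + 1)) mod m"
  have "I < m" using m by (simp add: I_def)
  have "(I + m - 1) mod m = (I0 + j) mod m" unfolding I_def using mod_prev[of m I0 j] m by simp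
  moreover have "(I + 1) mod m = (I0 + (j + 2)) mod m" unfolding I_def by (simp add: mod_Suc_eq)
  ultimately show "row_value b (E (j + 1)) a (x j) (x (j + 1)) (x (j + 2)) =
      (\<Sum>s<m * b. shifted_band m b \<zeta> \<omega> (((I0 + (j + 1)) mod m) * b + a) s * v s)"
    unfolding I_def[symmetric] row_equation[OF m \<open>I < m\<close> a] E_def x_def cyclic_blocks_def
    by (simp only: row_system_mod[of m I0 "j + 1"] I_def[symmetric])
  show "row_value b (E 0) a (x (m - 1)) (x 0) (x 1) = (\<Sum>s<m * b. shifted_band m b \<zeta> \<omega> (I0 * b + a) s * v s)"
    unfolding row_equation[OF m I0 a] E_def x_def cyclic_blocks_def using I0 m by simp
qed

lemma column_system_equations:
  fixes \<omega> w I0 \<zeta>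
  assumes m: "3 \<le> m" and I0: "I0 < m" and a: "a < b"
  defines "E \<equiv> (\<lambda>j t a c. \<omega> (column_system m I0 j t a c) + diagonal_shift \<zeta> t a c)" and "x \<equiv> cyclic_blocks m b I0 w"
  shows "row_value b (E (j + 1)) a (x j) (x (j + 1)) (x (j + 2)) =
      (\<Sum>r<m * b. w r * shifted_band m b \<zeta> \<omega> r (((I0 + (j + 1)) mod m) * b + a))"
    and "row_value b (E 0) a (x (m - 1)) (x 0) (x 1) = (\<Sum>r<m * b. w r * shifted_band m b \<zeta> \<omega> r (I0 * b + a))"
proof -
  define I where "I = (I0 + (j + 1)) mod m"
  have "I < m" using m by (simp add: I_def)
  have "(I + m - 1) mod m = (I0 + j) mod m" unfolding I_def using mod_prev[of m I0 j] m by simp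
  moreover have "(I + 1) mod m = (I0 + (j + 2)) mod m" unfolding I_def by (simp add: mod_Suc_eq)
  ultimately show "row_value b (E (j + 1)) a (x j) (x (j + 1)) (x (j + 2)) =
      (\<Sum>r<m * b. w r * shifted_band m b \<zeta> \<omega> r (((I0 + (j + 1)) mod m) * b + a))"
    unfolding I_def[symmetric] column_equation[OF m \<open>I < m\<close> a] E_def x_def cyclic_blocks_def
    by (simp only: column_system_mod[of m I0 "j + 1"] I_def[symmetric])
  show "row_value b (E 0) a (x (m - 1)) (x 0) (x 1) = (\<Sum>r<m * b. w r * shifted_band m b \<zeta> \<omega> r (I0 * b + a))"
    unfolding column_equation[OF m I0 a] E_def x_def cyclic_blocks_def using I0 m by simp
qed

lemma row_system_index: "0 < m \<Longrightarrow> a < b \<Longrightarrow> c < b \<Longrightarrow> row_system m I0 j t a c \<in> band_index m b"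
proof -
  assume h: "0 < m" "a < b" "c < b"
  have "x mod m < m" for x using h by simp
  then have "3 * (x mod m) + 2 < 3 * m" for x using less_imp_Suc_add[of "x mod m" m] by fastforce
  then have "3 * (x mod m) + 2 < 3 * m" "3 * (x mod m) + 1 < 3 * m" "3 * (x mod m) < 3 * m" for x
    by (meson add_lessD1 less_trans nat_add_left_cancel_less one_less_numeral_iff semiring_norm(76))+
  then show ?thesis using h by (auto simp: row_system_def band_index_def Let_def)
qed

lemma column_system_index: "0 < m \<Longrightarrow> a < b \<Longrightarrow> c < b \<Longrightarrow> column_system m I0 j t a c \<in> band_index m b"
proof -
  assume h: "0 < m" "a < b" "c < b"
  have "(I0 + j) mod m < m" using h by simp
  then have "3 * ((I0 + j) mod m) + 2 < 3 * m" by linarith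
  then show ?thesis using h by (auto simp: column_system_def band_index_def Let_def)
qed

lemma row_system_inj:
  assumes "0 < m" "j < m" "t < 3" "j' < m" "t' < 3" and eq: "row_system m I0 j t a c = row_system m I0 j' t' a' c'"
  shows "j = j' \<and> t = t' \<and> a = a' \<and> c = c'"
proof -
  define k where "k t I = (if t = 0 then 3 * ((I + m - 1) mod m) + 2 else if t = 1 then 3 * I else 3 * ((I + 1) mod m) + 1)" for t I :: nat
  have e: "k t ((I0 + j) mod m) = k t' ((I0 + j') mod m)" "a = a'" "c = c'"
    using eq by (auto simp: row_system_def k_def Let_def)
  have ac: "t = 0 \<or> t = 1 \<or> t = 2" "t' = 0 \<or> t' = 1 \<or> t' = 2" using assms by auto
  have h: "(3 * x + 2) mod 3 = (2::nat)" "(3 * x) mod 3 = (0::nat)" "(3 * x + 1) mod 3 = (1::nat)" for x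
    by presburger+
  have k3: "k t I mod 3 = (if t = 0 then 2 else if t = 1 then 0 else 1)" for t I
    unfolding k_def if_distrib[where f = "\<lambda>x. x mod 3"] h ..
  have "(if t = 0 then 2 else if t = 1 then 0 else 1 :: nat) = (if t' = 0 then 2 else if t' = 1 then 0 else 1)"
    using arg_cong[OF e(1), of "\<lambda>x. x mod 3"] unfolding k3 .
  then have tt: "t = t'" using ac by (elim disjE) simp_all
  have lt: "(I0 + j) mod m < m" "(I0 + j') mod m < m" using assms by auto
  have "(I0 + j) mod m = (I0 + j') mod m"
  proof -
    consider "t' = 0" | "t' = 1" | "t' = 2" using ac by blast
    then show ?thesis
    proof cases
      case 1
      then show ?thesis using e(1) unfolding tt k_def by (intro mod_pred_inj[OF lt]) simp
    next
      case 2
      then show ?thesis using e(1) unfolding tt k_def by simp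
    next
      case 3
      then show ?thesis using e(1) unfolding tt k_def by (intro mod_succ_inj[OF lt]) simp
    qed
  qed
  then have "j = j'" by (rule mod_shift_inj[OF assms(2,4)])
  then show ?thesis using e tt by blast
qed

lemma column_system_inj:
  assumes "0 < m" "j < m" "t < 3" "j' < m" "t' < 3" and eq: "column_system m I0 j t a c = column_system m I0 j' t' a' c'"
  shows "j = j' \<and> t = t' \<and> a = a' \<and> c = c'"
proof -
  define k where "k t I = (if t = 0 then 3 * I + 1 else if t = 1 then 3 * I else 3 * I + 2)" for t I :: nat
  have e: "k t ((I0 + j) mod m) = k t' ((I0 + j') mod m)" "a = a'" "c = c'"
    using eq by (auto simp: column_system_def k_def Let_def)
  have ac: "t = 0 \<or> t = 1 \<or> t = 2" "t' = 0 \<or> t' = 1 \<or> t' = 2" using assms by auto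
  have "t = t' \<and> I = I'" if "k t I = k t' I'" for I I'
    using that ac unfolding k_def by presburger
  then have "t = t' \<and> (I0 + j) mod m = (I0 + j') mod m" using e(1) by blast
  then show ?thesis using mod_shift_inj[OF assms(2,4)] e by blast
qed


text \<open>An entry of column \<open>s\<close> reads only atoms of the three blocks in its block
  column, and there only those in column \<open>s mod b\<close>. In this form the independence of
  distinct columns is used.\<close>

lemma shifted_band_cong:
  assumes "\<And>x a. x div 3 = s div b \<Longrightarrow> \<omega> (x, a, s mod b) = \<omega>' (x, a, s mod b)"
  shows "shifted_band m b \<zeta> \<omega> r s = shifted_band m b \<zeta> \<omega>' r s"
  using assms by (auto simp: shifted_band_def band_entry_def Let_def)

lemma cyclic_surj:
  assumes "I0 < m" "J < (m::nat)"
  shows "\<exists>i<m. (I0 + i) mod m = J"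
proof (cases "I0 \<le> J")
  case True
  then show ?thesis using assms by (intro exI[of _ "J - I0"]) auto
next
  case False
  then show ?thesis using assms by (intro exI[of _ "J + m - I0"]) auto
qed

lemma cyclic_blocks_surj:
  assumes "0 < b" "I0 < m" "k < m * b"
  shows "\<exists>i<m. \<exists>c<b. cyclic_blocks m b I0 v i c = v k"
proof -
  have "k div b < m" using assms by (simp add: less_mult_imp_div_less)
  then obtain i where "i < m" "(I0 + i) mod m = k div b" using cyclic_surj[OF assms(2)] by blast
  then show ?thesis using assms by (intro exI[of _ i] conjI exI[of _ "k mod b"]) (auto simp: cyclic_blocks_def)
qed

text \<open>Every coordinate lies in three consecutive cyclic triples.\<close>
lemma triple_count:
  assumes m: "3 \<le> m"
  shows "(\<Sum>I<m. card {p \<in> triple_index b. P (cyclic_blocks m b I v (triple_block m (fst p)) (snd p))}) =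
    3 * card {k. k < m * b \<and> P (v k)}"
proof -
  define f where "f k = (if P (v k) then 1 else 0 :: nat)" for k
  have "(\<Sum>I<m. card {p \<in> triple_index b. P (cyclic_blocks m b I v (triple_block m (fst p)) (snd p))}) =
    (\<Sum>I<m. \<Sum>p\<in>triple_index b. f (((I + triple_block m (fst p)) mod m) * b + snd p))"
  proof (rule sum.cong[OF refl])
    fix I
    have "card {p \<in> triple_index b. P (cyclic_blocks m b I v (triple_block m (fst p)) (snd p))} =
      (\<Sum>p\<in>{p \<in> triple_index b. P (cyclic_blocks m b I v (triple_block m (fst p)) (snd p))}. 1)" by simp
    also have "\<dots> = (\<Sum>p\<in>triple_index b. if P (cyclic_blocks m b I v (triple_block m (fst p)) (snd p)) then 1 else 0)"
      by (rule sum.inter_filter) simp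
    finally show "card {p \<in> triple_index b. P (cyclic_blocks m b I v (triple_block m (fst p)) (snd p))} =
      (\<Sum>p\<in>triple_index b. f (((I + triple_block m (fst p)) mod m) * b + snd p))"
      by (simp add: f_def cyclic_blocks_def)
  qed
  also have "\<dots> = (\<Sum>t<3. \<Sum>I<m. \<Sum>c<b. f (((I + triple_block m t) mod m) * b + c))"
    unfolding triple_index_def by (subst sum.swap) (simp add: sum.cartesian_product' sum.swap[of _ "{..<b}" "{..<m}"])
  also have "\<dots> = (\<Sum>t<(3::nat). \<Sum>J<m. \<Sum>c<b. f (J * b + c))"
  proof (rule sum.cong[OF refl])
    fix t :: nat
    define x where "x = triple_block m t"
    have inj: "inj_on (\<lambda>I. (I + x) mod m) {..<m}"
    proof (rule inj_onI)
      fix I I' assume "I \<in> {..<m}" "I' \<in> {..<m}" "(I + x) mod m = (I' + x) mod m"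
      then show "I = I'" using mod_shift_inj[of I m I' x] by (simp add: add.commute)
    qed
    moreover have "(\<lambda>I. (I + x) mod m) ` {..<m} \<subseteq> {..<m}" using m by auto
    ultimately have "bij_betw (\<lambda>I. (I + x) mod m) {..<m} {..<m}"
      unfolding bij_betw_def using endo_inj_surj[of "{..<m}"] by auto
    then show "(\<Sum>I<m. \<Sum>c<b. f (((I + triple_block m t) mod m) * b + c)) = (\<Sum>J<m. \<Sum>c<b. f (J * b + c))"
      unfolding x_def by (rule sum.reindex_bij_betw[where g = "\<lambda>J. \<Sum>c<b. f (J * b + c)"])
  qed
  also have "\<dots> = 3 * (\<Sum>k<m * b. f k)" by (simp add: block_sum)
  also have "(\<Sum>k<m * b. f k) = card {k. k < m * b \<and> P (v k)}"
  proof -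
    have "(\<Sum>k<m * b. f k) = (\<Sum>k\<in>{k \<in> {..<m * b}. P (v k)}. 1)"
      unfolding f_def by (rule sum.inter_filter[symmetric]) simp
    also have "{k \<in> {..<m * b}. P (v k)} = {k. k < m * b \<and> P (v k)}" by auto
    finally show ?thesis by simp
  qed
  finally show ?thesis .
qed

text \<open>Here \<open>d\<close> is the dimension carried along the blocks, \<open>s\<close> the
  number of large coordinates guaranteed in a triple, \<open>t\<close> the number of large
  differences in the linear form, and \<open>\<Lambda>0\<close> the truncation level. Of the scales,
  \<open>\<eta>\<close> is the residual, \<open>\<tau>\<close> counts as large,
  \<open>\<tau>'\<close> as not vanishing. \<open>sparse\<close> separates \<open>\<tau>\<close>
  from \<open>\<tau>'\<close> on sparse triples, \<open>total\<close> says that the loss along the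
  chain cannot lift \<open>\<tau>'\<close> above 1/2, and \<open>small\<close> that the residual,
  summed over \<open>m * b\<close> rows and divided by \<open>\<tau> / 2\<close>, stays within the
  radius \<open>\<tau> * r / 4\<close> of the linear form.\<close>

locale band_params = atom_dist \<mu> for \<mu> :: "complex measure" +
  fixes b m d s t :: nat and q r \<Lambda>0 \<eta> \<tau> \<tau>' :: real and \<zeta> :: complex
  assumes db: "d \<le> b" and sb: "s < b" and ts: "t \<le> s" and s1: "1 \<le> s" and m3: "3 \<le> m" and r0: "0 < r"
    and conc: "\<And>a. measure \<mu> (ball a r) \<le> q" and q1: "q \<le> 1" and \<Lambda>1: "1 \<le> \<Lambda>0"
    and \<tau>0: "0 < \<tau>" and \<tau>\<tau>': "\<tau> \<le> \<tau>'" and \<eta>0: "0 < \<eta>" and \<eta>\<tau>': "\<eta> \<le> \<tau>'"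
    and sparse: "real b * (\<eta> + 3 * real b * ((\<Lambda>0 + cmod \<zeta>) * \<tau>)) < r * \<tau>'"
    and total: "(2 * (1 + 3 * real b ^ 3 * (\<Lambda>0 + cmod \<zeta>) / r)) ^ ((m - 2) div 2 + 1) *
      ((1 + 6 * real b ^ 4 * (b / r * (2 + real b ^ 3 * (\<Lambda>0 + cmod \<zeta>) / r)) * (\<Lambda>0 + cmod \<zeta>)) ^ (m - 2) * \<tau>') \<le> 1 / 2"
    and small: "8 * (real m * real b) * \<eta> \<le> \<tau> * \<tau> * r"
begin

definition spread_error :: real where
  "spread_error = m * (real d * q ^ (b + 1 - d) + real (b - d) * q ^ (d + 1)) + ((3 * b) choose s) * (s * q ^ (b - s))"

definition form_error :: real where
  "form_error = 1 / sqrt (t / 2 + 1) + (s choose t) * q ^ (s - t)"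

abbreviation "idx \<equiv> band_index m b"
abbreviation "entry \<equiv> shifted_band m b \<zeta>"

definition bounded_entries :: "(nat \<times> nat \<times> nat \<Rightarrow> complex) \<Rightarrow> bool" where
  "bounded_entries \<omega> \<longleftrightarrow> (\<forall>i\<in>idx. cmod (\<omega> i) \<le> \<Lambda>0)"

lemma fin_idx: "finite idx" by (simp add: band_index_def)

lemma q_nonneg: "0 \<le> q"
  using conc[of 0] measure_nonneg[of \<mu> "ball 0 r"] by linarith

lemma spread_error_nonneg: "0 \<le> spread_error" and form_error_nonneg: "0 \<le> form_error"
  using q_nonneg by (auto simp: spread_error_def form_error_def)

lemma shift_bound: "cmod x \<le> \<Lambda>0 \<Longrightarrow> cmod (x + diagonal_shift \<zeta> k a c) \<le> \<Lambda>0 + cmod \<zeta>"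
  using norm_triangle_ineq[of x "diagonal_shift \<zeta> k a c"] norm_ge_zero[of \<zeta>]
  by (auto simp: diagonal_shift_def split: if_splits intro: order_trans)

lemma b1: "1 \<le> b" and m0: "0 < m" using sb m3 by auto

lemma row_spread:
  assumes I0: "I0 < m"
  shows "\<exists>B\<in>sets (iid idx). measure (iid idx) B \<le> spread_error \<and>
    (\<forall>\<omega>\<in>space (iid idx) - B. bounded_entries \<omega> \<longrightarrow>
      (\<forall>v. (\<forall>i<m * b. cmod (\<Sum>j<m * b. entry \<omega> i j * v j) < \<eta>) \<longrightarrow> (\<exists>k<m * b. 1 / 2 < cmod (v k)) \<longrightarrow>
        s < card {p \<in> triple_index b. \<tau> \<le> cmod (cyclic_blocks m b I0 v (triple_block m (fst p)) (snd p))}))"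
proof -
  define \<psi> where "\<psi> = row_system m I0"
  have pos: "0 < \<tau>'" "0 \<le> \<eta>" "0 \<le> \<tau>" using \<tau>0 \<tau>\<tau>' \<eta>0 by auto
  have one: "1 \<le> \<Lambda>0 + cmod \<zeta>" using \<Lambda>1 by (simp add: add_increasing2)
  have \<psi>I: "\<psi> j k a c \<in> idx" if "j < m" "k < 3" "a < b" "c < b" for j k a c
    unfolding \<psi>_def using that m0 by (intro row_system_index)
  have \<psi>inj: "j = j' \<and> k = k' \<and> a = a' \<and> c = c'" if "j < m" "k < 3" "a < b" "c < b" "j' < m" "k' < 3" "a' < b" "c' < b"
    "\<psi> j k a c = \<psi> j' k' a' c'" for j k a c j' k' a' c'
    using row_system_inj[OF m0 that(1,2,5,6)] that(9) unfolding \<psi>_def by blast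
  \<comment> \<open>With \<open>a0 = b\<close> the clause \<open>a \<noteq> a0\<close> is always
    true for \<open>a < b\<close>, so all equations of the distinguished block are used.\<close>
  have "\<exists>B\<in>sets (iid idx). measure (iid idx) B \<le> spread_error \<and>
    (\<forall>\<omega>\<in>space (iid idx) - B.
      (\<forall>j<m. \<forall>k<3. \<forall>a<b. \<forall>c<b. (j = 0 \<longrightarrow> a \<noteq> b) \<longrightarrow> cmod (\<omega> (\<psi> j k a c) + diagonal_shift \<zeta> k a c) \<le> \<Lambda>0 + cmod \<zeta>) \<longrightarrow>
      (\<forall>x. (\<forall>j<m - 2. \<forall>a<b. cmod (row_value b (\<lambda>k a c. \<omega> (\<psi> (j + 1) k a c) + diagonal_shift \<zeta> k a c) a (x j) (x (j + 1)) (x (j + 2))) < \<eta>) \<longrightarrow>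
        (\<forall>a<b. a \<noteq> b \<longrightarrow> cmod (row_value b (\<lambda>k a c. \<omega> (\<psi> 0 k a c) + diagonal_shift \<zeta> k a c) a (x (m - 1)) (x 0) (x 1)) < \<eta>) \<longrightarrow>
        (\<exists>i<m. \<exists>c<b. 1 / 2 < cmod (x i c)) \<longrightarrow>
        s < card {p \<in> triple_index b. \<tau> \<le> cmod (x (triple_block m (fst p)) (snd p))}))"
    unfolding spread_error_def
    by (rule cyclic_spread[where \<psi> = \<psi> and sh = "diagonal_shift \<zeta>" and ?a0.0 = b and \<tau>' = \<tau>' and r = r])
      (fact fin_idx db b1 r0 one m3 conc q1 sb pos \<eta>\<tau>' \<tau>\<tau>' sparse total | (rule \<psi>I; assumption) | (rule \<psi>inj; assumption))+
  then obtain B where B: "B \<in> sets (iid idx)" "measure (iid idx) B \<le> spread_error"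
    and H: "\<forall>\<omega>\<in>space (iid idx) - B.
      (\<forall>j<m. \<forall>k<3. \<forall>a<b. \<forall>c<b. (j = 0 \<longrightarrow> a \<noteq> b) \<longrightarrow> cmod (\<omega> (\<psi> j k a c) + diagonal_shift \<zeta> k a c) \<le> \<Lambda>0 + cmod \<zeta>) \<longrightarrow>
      (\<forall>x. (\<forall>j<m - 2. \<forall>a<b. cmod (row_value b (\<lambda>k a c. \<omega> (\<psi> (j + 1) k a c) + diagonal_shift \<zeta> k a c) a (x j) (x (j + 1)) (x (j + 2))) < \<eta>) \<longrightarrow>
        (\<forall>a<b. a \<noteq> b \<longrightarrow> cmod (row_value b (\<lambda>k a c. \<omega> (\<psi> 0 k a c) + diagonal_shift \<zeta> k a c) a (x (m - 1)) (x 0) (x 1)) < \<eta>) \<longrightarrow>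
        (\<exists>i<m. \<exists>c<b. 1 / 2 < cmod (x i c)) \<longrightarrow>
        s < card {p \<in> triple_index b. \<tau> \<le> cmod (x (triple_block m (fst p)) (snd p))})"
    by (elim bexE conjE)
  show ?thesis
  proof (intro bexI[OF _ B(1)] conjI B(2) ballI impI allI)
    fix \<omega> v assume \<omega>: "\<omega> \<in> space (iid idx) - B" and bd: "bounded_entries \<omega>"
      and v: "\<forall>i<m * b. cmod (\<Sum>j<m * b. entry \<omega> i j * v j) < \<eta>" "\<exists>k<m * b. 1 / 2 < cmod (v k)"
    show "s < card {p \<in> triple_index b. \<tau> \<le> cmod (cyclic_blocks m b I0 v (triple_block m (fst p)) (snd p))}"
    proof (rule H[rule_format, OF \<omega>])
      show "cmod (\<omega> (\<psi> j k a c) + diagonal_shift \<zeta> k a c) \<le> \<Lambda>0 + cmod \<zeta>" if "j < m" "k < 3" "a < b" "c < b" for j k a c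
        by (rule shift_bound) (use bd \<psi>I[OF that] in \<open>auto simp: bounded_entries_def\<close>)
      fix a assume a: "a < b"
      show "cmod (row_value b (\<lambda>k a c. \<omega> (\<psi> (j + 1) k a c) + diagonal_shift \<zeta> k a c) a (cyclic_blocks m b I0 v j) (cyclic_blocks m b I0 v (j + 1)) (cyclic_blocks m b I0 v (j + 2))) < \<eta>" for j
        unfolding \<psi>_def row_system_equations(1)[OF m3 I0 a] using v(1) a m0 by (simp add: block_less)
      show "cmod (row_value b (\<lambda>k a c. \<omega> (\<psi> 0 k a c) + diagonal_shift \<zeta> k a c) a (cyclic_blocks m b I0 v (m - 1)) (cyclic_blocks m b I0 v 0) (cyclic_blocks m b I0 v 1)) < \<eta>"
        unfolding \<psi>_def row_system_equations(2)[OF m3 I0 a] using v(1) a I0 by (simp add: block_less)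
    next
      obtain k where "k < m * b" "1 / 2 < cmod (v k)" using v(2) by blast
      then show "\<exists>i<m. \<exists>c<b. 1 / 2 < cmod (cyclic_blocks m b I0 v i c)"
      proof -
        have "0 < b" using b1 by simp
        then obtain i c where "i < m" "c < b" "cyclic_blocks m b I0 v i c = v k"
          using cyclic_blocks_surj[OF _ I0 \<open>k < m * b\<close>] by blast
        then show ?thesis using \<open>1 / 2 < cmod (v k)\<close> by (intro exI[of _ i] conjI exI[of _ c]) simp_all
      qed
    qed
  qed
qed

text \<open>A vector orthogonal to all columns except one solves the transposed system exactly,
  apart from one equation of the distinguished block; dropping that equation is the purpose of
  \<open>a0\<close> in \<open>cyclic_spread\<close>.\<close>

lemma column_spread:
  assumes I0: "I0 < m" and c0: "c0 < b"
  shows "\<exists>B\<in>sets (iid idx). measure (iid idx) B \<le> spread_error \<and>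
    (\<forall>\<omega>\<in>space (iid idx) - B. bounded_entries \<omega> \<longrightarrow>
      (\<forall>w. (\<forall>j<m * b. j \<noteq> I0 * b + c0 \<longrightarrow> (\<Sum>i<m * b. w i * entry \<omega> i j) = 0) \<longrightarrow> (\<exists>k<m * b. 1 / 2 < cmod (w k)) \<longrightarrow>
        s < card {p \<in> triple_index b. \<tau> \<le> cmod (cyclic_blocks m b I0 w (triple_block m (fst p)) (snd p))}))"
proof -
  define \<psi> where "\<psi> = column_system m I0"
  have pos: "0 < \<tau>'" "0 \<le> \<eta>" "0 \<le> \<tau>" using \<tau>0 \<tau>\<tau>' \<eta>0 by auto
  have one: "1 \<le> \<Lambda>0 + cmod \<zeta>" using \<Lambda>1 by (simp add: add_increasing2)
  have \<psi>I: "\<psi> j k a c \<in> idx" if "j < m" "k < 3" "a < b" "c < b" for j k a c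
    unfolding \<psi>_def using that m0 by (intro column_system_index)
  have \<psi>inj: "j = j' \<and> k = k' \<and> a = a' \<and> c = c'" if "j < m" "k < 3" "a < b" "c < b" "j' < m" "k' < 3" "a' < b" "c' < b"
    "\<psi> j k a c = \<psi> j' k' a' c'" for j k a c j' k' a' c'
    using column_system_inj[OF m0 that(1,2,5,6)] that(9) unfolding \<psi>_def by blast
  have "\<exists>B\<in>sets (iid idx). measure (iid idx) B \<le> spread_error \<and>
    (\<forall>\<omega>\<in>space (iid idx) - B.
      (\<forall>j<m. \<forall>k<3. \<forall>a<b. \<forall>c<b. (j = 0 \<longrightarrow> a \<noteq> c0) \<longrightarrow> cmod (\<omega> (\<psi> j k a c) + diagonal_shift \<zeta> k a c) \<le> \<Lambda>0 + cmod \<zeta>) \<longrightarrow>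
      (\<forall>x. (\<forall>j<m - 2. \<forall>a<b. cmod (row_value b (\<lambda>k a c. \<omega> (\<psi> (j + 1) k a c) + diagonal_shift \<zeta> k a c) a (x j) (x (j + 1)) (x (j + 2))) < \<eta>) \<longrightarrow>
        (\<forall>a<b. a \<noteq> c0 \<longrightarrow> cmod (row_value b (\<lambda>k a c. \<omega> (\<psi> 0 k a c) + diagonal_shift \<zeta> k a c) a (x (m - 1)) (x 0) (x 1)) < \<eta>) \<longrightarrow>
        (\<exists>i<m. \<exists>c<b. 1 / 2 < cmod (x i c)) \<longrightarrow>
        s < card {p \<in> triple_index b. \<tau> \<le> cmod (x (triple_block m (fst p)) (snd p))}))"
    unfolding spread_error_def
    by (rule cyclic_spread[where \<psi> = \<psi> and sh = "diagonal_shift \<zeta>" and ?a0.0 = c0 and \<tau>' = \<tau>' and r = r])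
      (fact fin_idx db b1 r0 one m3 conc q1 sb pos \<eta>\<tau>' \<tau>\<tau>' sparse total | (rule \<psi>I; assumption) | (rule \<psi>inj; assumption))+
  then obtain B where B: "B \<in> sets (iid idx)" "measure (iid idx) B \<le> spread_error"
    and H: "\<forall>\<omega>\<in>space (iid idx) - B.
      (\<forall>j<m. \<forall>k<3. \<forall>a<b. \<forall>c<b. (j = 0 \<longrightarrow> a \<noteq> c0) \<longrightarrow> cmod (\<omega> (\<psi> j k a c) + diagonal_shift \<zeta> k a c) \<le> \<Lambda>0 + cmod \<zeta>) \<longrightarrow>
      (\<forall>x. (\<forall>j<m - 2. \<forall>a<b. cmod (row_value b (\<lambda>k a c. \<omega> (\<psi> (j + 1) k a c) + diagonal_shift \<zeta> k a c) a (x j) (x (j + 1)) (x (j + 2))) < \<eta>) \<longrightarrow>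
        (\<forall>a<b. a \<noteq> c0 \<longrightarrow> cmod (row_value b (\<lambda>k a c. \<omega> (\<psi> 0 k a c) + diagonal_shift \<zeta> k a c) a (x (m - 1)) (x 0) (x 1)) < \<eta>) \<longrightarrow>
        (\<exists>i<m. \<exists>c<b. 1 / 2 < cmod (x i c)) \<longrightarrow>
        s < card {p \<in> triple_index b. \<tau> \<le> cmod (x (triple_block m (fst p)) (snd p))})"
    by (elim bexE conjE)
  show ?thesis
  proof (intro bexI[OF _ B(1)] conjI B(2) ballI impI allI)
    fix \<omega> w assume \<omega>: "\<omega> \<in> space (iid idx) - B" and bd: "bounded_entries \<omega>"
      and w: "\<forall>j<m * b. j \<noteq> I0 * b + c0 \<longrightarrow> (\<Sum>i<m * b. w i * entry \<omega> i j) = 0" "\<exists>k<m * b. 1 / 2 < cmod (w k)"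
    show "s < card {p \<in> triple_index b. \<tau> \<le> cmod (cyclic_blocks m b I0 w (triple_block m (fst p)) (snd p))}"
    proof (rule H[rule_format, OF \<omega>])
      show "cmod (\<omega> (\<psi> j k a c) + diagonal_shift \<zeta> k a c) \<le> \<Lambda>0 + cmod \<zeta>" if "j < m" "k < 3" "a < b" "c < b" for j k a c
        by (rule shift_bound) (use bd \<psi>I[OF that] in \<open>auto simp: bounded_entries_def\<close>)
      fix a assume a: "a < b"
      show "cmod (row_value b (\<lambda>k a c. \<omega> (\<psi> (j + 1) k a c) + diagonal_shift \<zeta> k a c) a (cyclic_blocks m b I0 w j) (cyclic_blocks m b I0 w (j + 1)) (cyclic_blocks m b I0 w (j + 2))) < \<eta>"
        if j: "j < m - 2" for j
      proof -
        have "(I0 + (j + 1)) mod m \<noteq> I0"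
        proof
          assume "(I0 + (j + 1)) mod m = I0"
          then have "(I0 + (j + 1)) mod m = (I0 + 0) mod m" using I0 by simp
          then have "j + 1 = 0" by (rule mod_shift_inj[rotated 2]) (use j m0 in auto)
          then show False by simp
        qed
        then have "((I0 + (j + 1)) mod m) * b + a \<noteq> I0 * b + c0" using block_eq_iff[OF a c0] by auto
        then have "(\<Sum>i<m * b. w i * entry \<omega> i (((I0 + (j + 1)) mod m) * b + a)) = 0"
          using w(1) a m0 by (simp add: block_less)
        then show ?thesis unfolding \<psi>_def column_system_equations(1)[OF m3 I0 a] using \<eta>0 by simp
      qed
      show "cmod (row_value b (\<lambda>k a c. \<omega> (\<psi> 0 k a c) + diagonal_shift \<zeta> k a c) a (cyclic_blocks m b I0 w (m - 1)) (cyclic_blocks m b I0 w 0) (cyclic_blocks m b I0 w 1)) < \<eta>"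
        if "a \<noteq> c0"
      proof -
        have "(\<Sum>i<m * b. w i * entry \<omega> i (I0 * b + a)) = 0"
          using w(1) a I0 that by (simp add: block_less)
        then show ?thesis unfolding \<psi>_def column_system_equations(2)[OF m3 I0 a] using \<eta>0 by simp
      qed
    next
      obtain k where "k < m * b" "1 / 2 < cmod (w k)" using w(2) by blast
      then show "\<exists>i<m. \<exists>c<b. 1 / 2 < cmod (cyclic_blocks m b I0 w i c)"
      proof -
        have "0 < b" using b1 by simp
        then obtain i c where "i < m" "c < b" "cyclic_blocks m b I0 w i c = w k"
          using cyclic_blocks_surj[OF _ I0 \<open>k < m * b\<close>] by blast
        then show ?thesis using \<open>1 / 2 < cmod (w k)\<close> by (intro exI[of _ i] conjI exI[of _ c]) simp_all
      qed
    qed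
  qed
qed


section \<open>Testing a near-kernel vector against one column, and averaging over columns\<close>

lemma entry_measurable: "(\<lambda>\<omega>. entry \<omega> i j) \<in> borel_measurable (iid idx)" if "i < m * b" "j < m * b"
proof -
  have b: "0 < b" using b1 by simp
  have "i div b < m" "j div b < m" using that by (auto simp: less_mult_imp_div_less)
  moreover have "i mod b < b" "j mod b < b" using b by auto
  ultimately have mem: "(3 * (j div b) + e, i mod b, j mod b) \<in> idx" "(3 * (i div b), i mod b, j mod b) \<in> idx" if "e \<le> 2" for e
    using that by (auto simp: band_index_def)
  have "(\<lambda>\<omega>. band_entry m b \<omega> i j) \<in> borel_measurable (iid idx)"
    unfolding band_entry_def Let_def
    using coord_measurable[OF mem(1)[of 2]] coord_measurable[OF mem(1)[of 1]] coord_measurable[OF mem(2)[of 0]]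
    by (cases "j div b = i div b"; cases "j div b = (i div b + m - 1) mod m"; cases "j div b = (i div b + 1) mod m") simp_all
  then show ?thesis unfolding shifted_band_def by (intro borel_measurable_diff) auto
qed

text \<open>The threshold is \<open>\<tau> / 2\<close> so that a strict, hence open, condition still
  covers every \<open>v\<close> with \<open>\<tau> \<le> cmod (v k)\<close>.\<close>

definition column_near_kernel :: "nat \<Rightarrow> (nat \<times> nat \<times> nat \<Rightarrow> complex) set" where
  "column_near_kernel k = {\<omega> \<in> space (iid idx). bounded_entries \<omega> \<and>
    (\<exists>v. \<tau> / 2 < cmod (v k) \<and> (\<forall>i\<in>{..<m * b}. cmod (\<Sum>j<m * b. entry \<omega> i j * v j) < \<eta>))}"

lemma bounded_entries_measurable: "{\<omega> \<in> space (iid idx). bounded_entries \<omega>} \<in> sets (iid idx)"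
  unfolding bounded_entries_def
proof (intro sets.sets_Collect_finite_All fin_idx)
  fix i assume "i \<in> idx"
  then have [measurable]: "(\<lambda>\<omega>. \<omega> i) \<in> borel_measurable (iid idx)" by (rule coord_measurable)
  show "{\<omega> \<in> space (iid idx). cmod (\<omega> i) \<le> \<Lambda>0} \<in> sets (iid idx)" by measurable
qed

lemma column_near_kernel_measurable: "column_near_kernel k \<in> sets (iid idx)"
proof -
  have "{\<omega> \<in> space (iid idx). \<exists>v. \<tau> / 2 < cmod (v k) \<and> (\<forall>i\<in>{..<m * b}. cmod (\<Sum>j<m * b. entry \<omega> i j * v j) < \<eta>)} \<in> sets (iid idx)"
  proof (rule ex_open_measurable)
    fix \<omega> show "open {v. \<tau> / 2 < cmod (v k) \<and> (\<forall>i\<in>{..<m * b}. cmod (\<Sum>j<m * b. entry \<omega> i j * v j) < \<eta>)}"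
      by (intro open_Collect_conj open_Collect_ball_finite open_Collect_less continuous_intros continuous_on_product_coordinates) auto
  next
    fix v :: "nat \<Rightarrow> complex"
    have "{\<omega> \<in> space (iid idx). \<forall>i\<in>{..<m * b}. cmod (\<Sum>j<m * b. entry \<omega> i j * v j) < \<eta>} \<in> sets (iid idx)"
    proof (intro sets.sets_Collect_finite_All)
      fix i assume i: "i \<in> {..<m * b}"
      have [measurable]: "(\<lambda>\<omega>. \<Sum>j<m * b. entry \<omega> i j * v j) \<in> borel_measurable (iid idx)"
        using i by (intro borel_measurable_sum borel_measurable_times entry_measurable) auto
      show "{\<omega> \<in> space (iid idx). cmod (\<Sum>j<m * b. entry \<omega> i j * v j) < \<eta>} \<in> sets (iid idx)" by measurable
    qed auto
    then show "{\<omega> \<in> space (iid idx). \<tau> / 2 < cmod (v k) \<and> (\<forall>i\<in>{..<m * b}. cmod (\<Sum>j<m * b. entry \<omega> i j * v j) < \<eta>)} \<in> sets (iid idx)"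
      by (intro sets.sets_Collect_conj sets.sets_Collect_const)
  qed
  then have "{\<omega> \<in> space (iid idx). bounded_entries \<omega>} \<inter> {\<omega> \<in> space (iid idx). \<exists>v. \<tau> / 2 < cmod (v k) \<and> (\<forall>i\<in>{..<m * b}. cmod (\<Sum>j<m * b. entry \<omega> i j * v j) < \<eta>)} \<in> sets (iid idx)"
    by (intro sets.Int bounded_entries_measurable)
  moreover have "column_near_kernel k = {\<omega> \<in> space (iid idx). bounded_entries \<omega>} \<inter> {\<omega> \<in> space (iid idx). \<exists>v. \<tau> / 2 < cmod (v k) \<and> (\<forall>i\<in>{..<m * b}. cmod (\<Sum>j<m * b. entry \<omega> i j * v j) < \<eta>)}"
    by (auto simp: column_near_kernel_def)
  ultimately show ?thesis by simp
qed

text \<open>A vector orthogonal to all columns but the \<open>k\<close>-th pairs with a near-kernel vector \<open>v\<close> to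
  \<open>v k\<close> times its inner product with column \<open>k\<close>, which is independent of the other columns.\<close>
lemma column_near_kernel_probability:
  assumes k: "k < m * b"
  shows "measure (iid idx) (column_near_kernel k) \<le> spread_error + form_error"
proof -
  define J0 c0 where "J0 = k div b" and "c0 = k mod b"
  have J0: "J0 < m" and c0: "c0 < b" and kJ: "k = J0 * b + c0"
    using k b1 by (auto simp: J0_def c0_def less_mult_imp_div_less)
  define n where "n = m * b"
  have n0: "0 < n" using m0 b1 by (simp add: n_def)
  obtain B where B: "B \<in> sets (iid idx)" "measure (iid idx) B \<le> spread_error"
    and spread: "\<forall>\<omega>\<in>space (iid idx) - B. bounded_entries \<omega> \<longrightarrow>
      (\<forall>w. (\<forall>j<m * b. j \<noteq> J0 * b + c0 \<longrightarrow> (\<Sum>i<m * b. w i * entry \<omega> i j) = 0) \<longrightarrow> (\<exists>k<m * b. 1 / 2 < cmod (w k)) \<longrightarrow>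
        s < card {p \<in> triple_index b. \<tau> \<le> cmod (cyclic_blocks m b J0 w (triple_block m (fst p)) (snd p))})"
    using column_spread[OF J0 c0] by (elim bexE conjE)
  define \<phi> where "\<phi> = (\<lambda>(e, a). column_system m J0 0 e c0 a)"
  define C where "C = \<phi> ` triple_index b"
  have C: "C \<subseteq> idx"
    unfolding C_def \<phi>_def triple_index_def by (auto intro!: column_system_index m0 c0)
  have finC: "finite C" by (simp add: C_def)
  have \<phi>inj: "inj_on \<phi> (triple_index b)"
  proof (rule inj_onI)
    fix p p' assume p: "p \<in> triple_index b" "p' \<in> triple_index b" "\<phi> p = \<phi> p'"
    obtain e a e' a' where [simp]: "p = (e, a)" "p' = (e', a')" by (cases p, cases p')
    have "e = e' \<and> a = a'"
      using column_system_inj[OF m0 m0 _ m0, of e e' J0 c0 a c0 a'] p by (auto simp: \<phi>_def triple_index_def)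
    then show "p = p'" by simp
  qed
  have Cdiv: "x div 3 = J0 \<and> c = c0" if "(x, a, c) \<in> C" for x a c
    using that J0 by (auto simp: C_def \<phi>_def column_system_def triple_index_def Let_def split: if_splits)
  define A where "A = column_near_kernel k - B"
  have A: "A \<in> sets (iid idx)" using column_near_kernel_measurable B(1) by (simp add: A_def sets.Diff)
  have "measure (iid idx) A \<le> form_error"
  proof (rule prob_le_sections[OF fin_idx C A form_error_nonneg])
    fix x0 :: "nat \<times> nat \<times> nat \<Rightarrow> complex"
    define mg where "mg y = merge (idx - C) C (x0, y)" for y :: "nat \<times> nat \<times> nat \<Rightarrow> complex"
    have mgC: "mg y i = y i" if "i \<in> C" for y i using that by (auto simp: mg_def merge_def)
    have other: "entry (mg y) i j = entry (mg y') i j" if "j < n" "j \<noteq> k" for y y' i j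
    proof (rule shifted_band_cong)
      fix x a assume "x div 3 = j div b"
      then have "(x, a, j mod b) \<notin> C"
        using Cdiv[of x a "j mod b"] that by (metis J0_def c0_def div_mult_mod_eq)
      then show "mg y (x, a, j mod b) = mg y' (x, a, j mod b)" by (simp add: mg_def merge_def)
    qed
    show "measure (iid C) {y \<in> space (iid C). merge (idx - C) C (x0, y) \<in> A} \<le> form_error"
    proof (cases "\<exists>y. mg y \<in> A")
      case False
      then have none: "{y \<in> space (iid C). merge (idx - C) C (x0, y) \<in> A} = {}" by (auto simp: mg_def)
      show ?thesis unfolding none using form_error_nonneg by simp
    next
      case True
      then obtain y0 where y0: "mg y0 \<in> A" by blast
      define \<omega>0 where "\<omega>0 = mg y0"
      have cK: "card ({..<n} - {k}) \<le> card {..<n}" by (intro card_mono) auto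
      have fK: "finite ({..<n} - {k})" by simp
      obtain S L where S: "S \<subseteq> {..<n}" "card S = card ({..<n} - {k})"
        and L: "\<And>i l. i \<in> {..<n} \<Longrightarrow> l \<in> S \<Longrightarrow> cmod (L i l) \<le> 1"
        and UL: "\<And>i c. i \<in> {..<n} \<Longrightarrow> c \<in> {..<n} - {k} \<Longrightarrow> entry \<omega>0 i c = (\<Sum>l\<in>S. L i l * entry \<omega>0 l c)"
        by (rule bounded_row_basis[OF fK finite_lessThan cK, where U = "entry \<omega>0"]) blast
      have "card S < card {..<n}" using S k n0 by (simp add: n_def)
      then obtain i0 where i0: "i0 < n" "i0 \<notin> S" using S(1) by (metis lessThan_iff less_irrefl subset_antisym subsetI)
      \<comment> \<open>The row \<open>i0\<close> left over by a bounded row basis of the other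
        columns, minus its expansion in that basis. This vector is orthogonal to all columns but
        \<open>k\<close>, has entries of modulus at most 1 and attains 1 at \<open>i0\<close>; in
        particular it is normalised without any division.\<close>
      define w where "w i = (if i = i0 then 1 else if i \<in> S then - L i0 i else 0)" for i
      have w1: "cmod (w i) \<le> 1" for i using L i0 by (auto simp: w_def)
      have orth0: "(\<Sum>i<n. w i * entry \<omega>0 i j) = 0" if j: "j < n" "j \<noteq> k" for j
      proof -
        have "(\<Sum>i<n. w i * entry \<omega>0 i j) = (\<Sum>i\<in>insert i0 S. w i * entry \<omega>0 i j)"
          using S i0 by (intro sum.mono_neutral_right) (auto simp: w_def)
        also have "\<dots> = entry \<omega>0 i0 j + (\<Sum>i\<in>S. w i * entry \<omega>0 i j)"
          using i0 finite_subset[OF S(1)] by (simp add: w_def)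
        also have "(\<Sum>i\<in>S. w i * entry \<omega>0 i j) = (\<Sum>i\<in>S. - (L i0 i * entry \<omega>0 i j))"
          using i0 by (intro sum.cong refl) (auto simp: w_def)
        also have "\<dots> = - entry \<omega>0 i0 j"
          unfolding sum_negf by (subst UL[symmetric]) (use i0 j in auto)
        finally show ?thesis by simp
      qed
      have orth: "(\<Sum>i<n. w i * entry (mg y) i j) = 0" if "j < n" "j \<noteq> k" for y j
      proof -
        have "entry (mg y) i j = entry \<omega>0 i j" for i unfolding \<omega>0_def by (rule other[OF that])
        then show ?thesis using orth0[OF that] by simp
      qed
      have \<omega>0: "\<omega>0 \<in> space (iid idx) - B" "bounded_entries \<omega>0"
        using y0 by (auto simp: A_def column_near_kernel_def \<omega>0_def)
      define x where "x p = cyclic_blocks m b J0 w (triple_block m (fst p)) (snd p)" for p :: "nat \<times> nat"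
      have "s < card {p \<in> triple_index b. \<tau> \<le> cmod (x p)}"
        unfolding x_def
      proof (rule spread[rule_format, OF \<omega>0])
        show "(\<Sum>i<m * b. w i * entry \<omega>0 i j) = 0" if "j < m * b" "j \<noteq> J0 * b + c0" for j
          using orth0[of j] that by (simp add: n_def kJ)
        show "\<exists>k<m * b. 1 / 2 < cmod (w k)" using i0 by (intro exI[of _ i0]) (simp add: w_def n_def)
      qed
      then obtain T where T: "T \<subseteq> {p \<in> triple_index b. \<tau> \<le> cmod (x p)}" "card T = s"
        by (meson obtain_subset_with_card_n less_imp_le)
      then have Ttri: "T \<subseteq> triple_index b" by auto
      \<comment> \<open>Only \<open>s\<close> atoms of column \<open>k\<close>, those with a large
        weight, stay random; the remaining ones are frozen into the constant
        \<open>v0\<close>.\<close>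
      define J where "J = \<phi> ` T"
      have JC: "J \<subseteq> C" using Ttri by (auto simp: J_def C_def)
      have finJ: "finite J" using finite_subset[OF JC finC] .
      have cJ: "card J = s" unfolding J_def using T card_image[OF inj_on_subset[OF \<phi>inj Ttri]] by simp
      define u where "u i = x (the_inv_into (triple_index b) \<phi> i)" for i
      have u\<phi>: "u (\<phi> p) = x p" if "p \<in> triple_index b" for p using that \<phi>inj by (simp add: u_def the_inv_into_f_f)
      have form: "(\<Sum>i<n. w i * entry (mg y) i k) =
        (\<Sum>p\<in>triple_index b. diagonal_shift \<zeta> (fst p) c0 (snd p) * x p) + (\<Sum>i\<in>C. u i * y i)" for y
      proof -
        have "(\<Sum>i<n. w i * entry (mg y) i k) =
          row_value b (\<lambda>e a c. mg y (column_system m J0 0 e a c) + diagonal_shift \<zeta> e a c) c0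
            (cyclic_blocks m b J0 w (m - 1)) (cyclic_blocks m b J0 w 0) (cyclic_blocks m b J0 w 1)"
          unfolding column_system_equations(2)[OF m3 J0 c0] by (simp add: n_def kJ)
        also have "\<dots> = (\<Sum>p\<in>triple_index b. (mg y (column_system m J0 0 (fst p) c0 (snd p)) + diagonal_shift \<zeta> (fst p) c0 (snd p)) * x p)"
          unfolding row_value_triple x_def ..
        also have "\<dots> = (\<Sum>p\<in>triple_index b. diagonal_shift \<zeta> (fst p) c0 (snd p) * x p) + (\<Sum>p\<in>triple_index b. u (\<phi> p) * y (\<phi> p))"
        proof -
          have "mg y (column_system m J0 0 (fst p) c0 (snd p)) * x p = u (\<phi> p) * y (\<phi> p)" if "p \<in> triple_index b" for p
          proof -
            have e: "\<phi> p = column_system m J0 0 (fst p) c0 (snd p)" by (simp add: \<phi>_def case_prod_beta)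
            have "\<phi> p \<in> C" using that by (simp add: C_def)
            then have "mg y (column_system m J0 0 (fst p) c0 (snd p)) = y (\<phi> p)" unfolding e[symmetric] by (rule mgC)
            then show ?thesis by (simp add: u\<phi>[OF that])
          qed
          then show ?thesis by (simp add: distrib_right sum.distrib add.commute cong: sum.cong)
        qed
        also have "(\<Sum>p\<in>triple_index b. u (\<phi> p) * y (\<phi> p)) = (\<Sum>i\<in>C. u i * y i)"
          unfolding C_def by (simp add: sum.reindex[OF \<phi>inj])
        finally show ?thesis .
      qed
      have smallform: "cmod (\<Sum>i<n. w i * entry (mg y) i k) < \<tau> * r / 4" if y: "mg y \<in> A" for y
      proof -
        obtain v where v: "\<tau> / 2 < cmod (v k)" "\<And>i. i < n \<Longrightarrow> cmod (\<Sum>j<n. entry (mg y) i j * v j) < \<eta>"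
          using y by (auto simp: A_def column_near_kernel_def n_def)
        define z where "z = (\<Sum>i<n. w i * entry (mg y) i k)"
        have "(\<Sum>i<n. w i * (\<Sum>j<n. entry (mg y) i j * v j)) = (\<Sum>j<n. (\<Sum>i<n. w i * entry (mg y) i j) * v j)"
          unfolding sum_distrib_left sum_distrib_right by (subst sum.swap) (simp add: mult.assoc)
        also have "\<dots> = (\<Sum>j\<in>{k}. (\<Sum>i<n. w i * entry (mg y) i j) * v j)"
          using k orth by (intro sum.mono_neutral_right) (auto simp: n_def)
        finally have "z * v k = (\<Sum>i<n. w i * (\<Sum>j<n. entry (mg y) i j * v j))" by (simp add: z_def)
        then have "cmod z * cmod (v k) = cmod (\<Sum>i<n. w i * (\<Sum>j<n. entry (mg y) i j * v j))" by (metis norm_mult)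
        also have "\<dots> \<le> (\<Sum>i<n. cmod (\<Sum>j<n. entry (mg y) i j * v j))"
          using w1 by (intro order_trans[OF norm_sum] sum_mono) (simp add: norm_mult mult_left_le_one_le)
        also have "\<dots> < (\<Sum>i<n. \<eta>)" using v(2) n0 by (intro sum_strict_mono) auto
        finally have zv: "cmod z * cmod (v k) < n * \<eta>" by simp
        show ?thesis
        proof (rule ccontr)
          assume "\<not> ?thesis"
          then have "\<tau> * r / 4 \<le> cmod z" by (simp add: z_def)
          then have "\<tau> * r / 4 * (\<tau> / 2) \<le> cmod z * cmod (v k)"
            using v(1) \<tau>0 r0 by (intro mult_mono) auto
          then have "\<tau> * \<tau> * r / 8 < n * \<eta>" using zv by (simp add: mult_ac)
          then show False using small by (simp add: n_def)
        qed
      qed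
      define A1 where "A1 = {y \<in> space (iid C). merge (idx - C) C (x0, y) \<in> A}"
      have A1: "A1 \<in> sets (iid C)" unfolding A1_def by (rule section_measurable[OF fin_idx C A])
      have "measure (iid C) A1 \<le> form_error"
      proof (rule prob_le_sections[OF finC JC A1 form_error_nonneg])
        fix x1 :: "nat \<times> nat \<times> nat \<Rightarrow> complex"
        define v0 where "v0 = (\<Sum>p\<in>triple_index b. diagonal_shift \<zeta> (fst p) c0 (snd p) * x p) + (\<Sum>i\<in>C - J. u i * x1 i)"
        have "{y \<in> space (iid J). merge (C - J) J (x1, y) \<in> A1} \<subseteq>
          {y \<in> space (iid J). cmod (v0 + (\<Sum>i\<in>J. u i * y i)) < \<tau> * r / 4}"
        proof
          fix y assume y: "y \<in> {y \<in> space (iid J). merge (C - J) J (x1, y) \<in> A1}"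
          define y' where "y' = merge (C - J) J (x1, y)"
          have "mg y' \<in> A" using y by (simp add: A1_def mg_def y'_def)
          then have "cmod ((\<Sum>p\<in>triple_index b. diagonal_shift \<zeta> (fst p) c0 (snd p) * x p) + (\<Sum>i\<in>C. u i * y' i)) < \<tau> * r / 4"
            using smallform form by metis
          moreover have "(\<Sum>i\<in>C. u i * y' i) = (\<Sum>i\<in>C - J. u i * y' i) + (\<Sum>i\<in>J. u i * y' i)"
            using JC finC by (rule sum.subset_diff)
          moreover have "(\<Sum>i\<in>C - J. u i * y' i) = (\<Sum>i\<in>C - J. u i * x1 i)"
            by (intro sum.cong refl) (simp add: y'_def merge_def)
          moreover have "(\<Sum>i\<in>J. u i * y' i) = (\<Sum>i\<in>J. u i * y i)"
            by (intro sum.cong refl) (simp add: y'_def merge_def)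
          ultimately show "y \<in> {y \<in> space (iid J). cmod (v0 + (\<Sum>i\<in>J. u i * y i)) < \<tau> * r / 4}"
            using y by (simp add: v0_def add.assoc)
        qed
        moreover have "{y \<in> space (iid J). cmod (v0 + (\<Sum>i\<in>J. u i * y i)) < \<tau> * r / 4} \<in> sets (iid J)"
        proof -
          have [measurable]: "(\<lambda>y. v0 + (\<Sum>i\<in>J. u i * y i)) \<in> borel_measurable (iid J)"
            by (intro borel_measurable_add borel_measurable_sum borel_measurable_times coord_measurable) auto
          show ?thesis by measurable
        qed
        ultimately have "measure (iid J) {y \<in> space (iid J). merge (C - J) J (x1, y) \<in> A1} \<le>
          measure (iid J) {y \<in> space (iid J). cmod (v0 + (\<Sum>i\<in>J. u i * y i)) < \<tau> * r / 4}"
          by (intro finite_measure.finite_measure_mono[OF prob_space.finite_measure[OF prob_space_iid]])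
        also have "\<dots> \<le> 1 / sqrt (t / 2 + 1) + (card J choose t) * q ^ (card J - t)"
        proof (rule linear_form_small_ball[OF finJ _ \<tau>0 r0 conc])
          show "t \<le> card J" using ts cJ by simp
          fix i assume "i \<in> J"
          then obtain p where "p \<in> T" "i = \<phi> p" by (auto simp: J_def)
          then show "\<tau> \<le> cmod (u i)" using T u\<phi>[of p] by auto
        qed
        finally show "measure (iid J) {y \<in> space (iid J). merge (C - J) J (x1, y) \<in> A1} \<le> form_error"
          by (simp add: form_error_def cJ)
      qed
      then show ?thesis by (simp add: A1_def)
    qed
  qed
  moreover have "measure (iid idx) (column_near_kernel k) \<le> measure (iid idx) (B \<union> A)"
    by (rule finite_measure.finite_measure_mono[OF prob_space.finite_measure[OF prob_space_iid] _ sets.Un[OF B(1) A]])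
      (auto simp: A_def)
  moreover have "measure (iid idx) (B \<union> A) \<le> measure (iid idx) B + measure (iid idx) A"
    by (rule measure_Un_le[OF B(1) A])
  ultimately show ?thesis using B(2) by linarith
qed

text \<open>A union over the columns would cost a factor \<open>m * b\<close>. A near-kernel vector,
  however, puts \<open>\<omega>\<close> into at least \<open>m * s / 3\<close> of the events
  \<open>column_near_kernel k\<close> at once, so Markov's inequality for their number leaves only
  the factor \<open>3 * b / s\<close>, which stays bounded when \<open>s\<close> is proportional to
  \<open>b\<close>.\<close>

lemma near_kernel_probability:
  "\<exists>G\<in>sets (iid idx). measure (iid idx) G \<le>
      measure (iid idx) {\<omega> \<in> space (iid idx). \<not> bounded_entries \<omega>} + m * spread_error + 3 * b / s * (spread_error + form_error) \<and>
    (\<forall>\<omega>\<in>space (iid idx). (\<exists>v. (\<forall>i<m * b. cmod (\<Sum>j<m * b. entry \<omega> i j * v j) < \<eta>) \<and> (\<exists>k<m * b. 1 / 2 < cmod (v k))) \<longrightarrow> \<omega> \<in> G)"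
proof -
  interpret PI: prob_space "iid idx" by (rule prob_space_iid)
  define n where "n = m * b"
  have "\<forall>I0. \<exists>B. I0 < m \<longrightarrow> B \<in> sets (iid idx) \<and> measure (iid idx) B \<le> spread_error \<and>
    (\<forall>\<omega>\<in>space (iid idx) - B. bounded_entries \<omega> \<longrightarrow>
      (\<forall>v. (\<forall>i<m * b. cmod (\<Sum>j<m * b. entry \<omega> i j * v j) < \<eta>) \<longrightarrow> (\<exists>k<m * b. 1 / 2 < cmod (v k)) \<longrightarrow>
        s < card {p \<in> triple_index b. \<tau> \<le> cmod (cyclic_blocks m b I0 v (triple_block m (fst p)) (snd p))}))"
    using row_spread by blast
  then obtain B where B: "\<forall>I0<m. B I0 \<in> sets (iid idx) \<and> measure (iid idx) (B I0) \<le> spread_error \<and>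
    (\<forall>\<omega>\<in>space (iid idx) - B I0. bounded_entries \<omega> \<longrightarrow>
      (\<forall>v. (\<forall>i<m * b. cmod (\<Sum>j<m * b. entry \<omega> i j * v j) < \<eta>) \<longrightarrow> (\<exists>k<m * b. 1 / 2 < cmod (v k)) \<longrightarrow>
        s < card {p \<in> triple_index b. \<tau> \<le> cmod (cyclic_blocks m b I0 v (triple_block m (fst p)) (snd p))}))"
    unfolding choice_iff by blast
  define F where "F = column_near_kernel"
  have F: "F k \<in> sets (iid idx)" for k unfolding F_def by (rule column_near_kernel_measurable)
  define G1 where "G1 = {\<omega> \<in> space (iid idx). \<not> bounded_entries \<omega>}"
  have G1: "G1 \<in> sets (iid idx)" unfolding G1_def by (intro sets.sets_Collect_neg bounded_entries_measurable)
  define G2 where "G2 = (\<Union>I0<m. B I0)"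
  have G2: "G2 \<in> sets (iid idx)" unfolding G2_def using B by (intro sets.finite_UN) auto
  have P2: "measure (iid idx) G2 \<le> m * spread_error"
  proof -
    have "measure (iid idx) G2 \<le> (\<Sum>I0<m. measure (iid idx) (B I0))"
      unfolding G2_def using B by (intro PI.finite_measure_subadditive_finite) auto
    also have "\<dots> \<le> (\<Sum>I0<m. spread_error)" using B by (intro sum_mono) auto
    finally show ?thesis by simp
  qed
  define X where "X \<omega> = (\<Sum>k<n. indicator (F k) \<omega> :: real)" for \<omega>
  have X: "X \<in> borel_measurable (iid idx)" unfolding X_def using F by (intro borel_measurable_sum borel_measurable_indicator) auto
  \<comment> \<open>Each of the \<open>m\<close> triples contains more than \<open>s\<close> large
    coordinates, and every coordinate belongs to three triples.\<close>
  define l where "l = m * s / (3 :: real)"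
  have l0: "0 < l" using m0 s1 by (simp add: l_def)
  define G3 where "G3 = {\<omega> \<in> space (iid idx). l \<le> X \<omega>}"
  have G3: "G3 \<in> sets (iid idx)" unfolding G3_def using X by measurable
  have P3: "measure (iid idx) G3 \<le> 3 * b / s * (spread_error + form_error)"
  proof -
    have fin: "emeasure (iid idx) A < \<infinity>" for A by (simp add: emeasure_iid)
    have "l * measure (iid idx) G3 = (\<integral>\<omega>. l * indicator G3 \<omega> \<partial>iid idx)"
      using G3 sets.sets_into_space[OF G3] by (simp add: Int_absorb2)
    also have "\<dots> \<le> (\<integral>\<omega>. X \<omega> \<partial>iid idx)"
    proof (rule integral_mono)
      show "integrable (iid idx) (\<lambda>\<omega>. l * indicator G3 \<omega>)"
        using G3 fin by (intro integrable_mult_right integrable_real_indicator) auto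
      show "integrable (iid idx) X" unfolding X_def
        using F fin by (intro Bochner_Integration.integrable_sum integrable_real_indicator) auto
      show "l * indicator G3 \<omega> \<le> X \<omega>" for \<omega>
        by (auto simp: indicator_def G3_def X_def intro!: sum_nonneg)
    qed
    also have "\<dots> = (\<Sum>k<n. \<integral>\<omega>. indicator (F k) \<omega> \<partial>iid idx)" unfolding X_def
      using F fin by (intro Bochner_Integration.integral_sum integrable_real_indicator) auto
    also have "\<dots> = (\<Sum>k<n. measure (iid idx) (F k))"
      using F sets.sets_into_space by (intro sum.cong refl) (simp add: Int_absorb2)
    also have "\<dots> \<le> (\<Sum>k<n. spread_error + form_error)"
      unfolding F_def by (intro sum_mono column_near_kernel_probability) (simp add: n_def)
    finally have "l * measure (iid idx) G3 \<le> n * (spread_error + form_error)" by simp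
    then have "measure (iid idx) G3 \<le> n * (spread_error + form_error) / l" using l0 by (simp add: field_simps)
    also have "\<dots> = 3 * b / s * (spread_error + form_error)" using m0 s1 by (simp add: n_def l_def)
    finally show ?thesis .
  qed
  define G where "G = G1 \<union> (G2 \<union> G3)"
  show ?thesis
  proof (intro bexI[of _ G] conjI ballI impI)
    show "G \<in> sets (iid idx)" unfolding G_def using G1 G2 G3 by auto
    have "measure (iid idx) G \<le> measure (iid idx) G1 + measure (iid idx) (G2 \<union> G3)"
      unfolding G_def using G1 G2 G3 by (intro measure_Un_le) auto
    also have "measure (iid idx) (G2 \<union> G3) \<le> measure (iid idx) G2 + measure (iid idx) G3"
      by (rule measure_Un_le[OF G2 G3])
    finally show "measure (iid idx) G \<le> measure (iid idx) {\<omega> \<in> space (iid idx). \<not> bounded_entries \<omega>} +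
      m * spread_error + 3 * b / s * (spread_error + form_error)"
      using P2 P3 by (simp add: G1_def)
    fix \<omega> assume \<omega>: "\<omega> \<in> space (iid idx)"
      and "\<exists>v. (\<forall>i<m * b. cmod (\<Sum>j<m * b. entry \<omega> i j * v j) < \<eta>) \<and> (\<exists>k<m * b. 1 / 2 < cmod (v k))"
    then obtain v where v: "\<forall>i<m * b. cmod (\<Sum>j<m * b. entry \<omega> i j * v j) < \<eta>" "\<exists>k<m * b. 1 / 2 < cmod (v k)" by blast
    show "\<omega> \<in> G"
    proof (rule ccontr)
      assume "\<omega> \<notin> G"
      then have n1: "bounded_entries \<omega>" and n2: "\<And>I0. I0 < m \<Longrightarrow> \<omega> \<notin> B I0" and n3: "X \<omega> < l"
        using \<omega> by (auto simp: G_def G1_def G2_def G3_def)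
      have "s < card {p \<in> triple_index b. \<tau> \<le> cmod (cyclic_blocks m b I0 v (triple_block m (fst p)) (snd p))}" if "I0 < m" for I0
        using B[rule_format, OF that] n1 n2[OF that] \<omega> v by blast
      then have "(\<Sum>I0<m. s) \<le> (\<Sum>I0<m. card {p \<in> triple_index b. \<tau> \<le> cmod (cyclic_blocks m b I0 v (triple_block m (fst p)) (snd p))})"
        by (intro sum_mono) (simp add: less_imp_le)
      also have "\<dots> = 3 * card {k. k < m * b \<and> \<tau> \<le> cmod (v k)}"
        by (rule triple_count[OF m3, where P = "\<lambda>x. \<tau> \<le> cmod x"])
      finally have "m * s \<le> 3 * card {k. k < m * b \<and> \<tau> \<le> cmod (v k)}" by simp
      then have "real (m * s) \<le> real (3 * card {k. k < m * b \<and> \<tau> \<le> cmod (v k)})" by (rule of_nat_mono)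
      then have "l \<le> real (card {k. k < m * b \<and> \<tau> \<le> cmod (v k)})" by (simp add: l_def)
      also have "\<dots> = (\<Sum>k\<in>{k. k < m * b \<and> \<tau> \<le> cmod (v k)}. 1)" by simp
      also have "\<dots> \<le> (\<Sum>k\<in>{k. k < m * b \<and> \<tau> \<le> cmod (v k)}. indicator (F k) \<omega>)"
      proof (rule sum_mono)
        fix k assume k: "k \<in> {k. k < m * b \<and> \<tau> \<le> cmod (v k)}"
        then have "\<tau> / 2 < cmod (v k)" using \<tau>0 by auto
        then have "\<omega> \<in> F k" using \<omega> n1 v(1) by (auto simp: F_def column_near_kernel_def)
        then show "1 \<le> (indicator (F k) \<omega> :: real)" by simp
      qed
      also have "\<dots> \<le> X \<omega>" unfolding X_def n_def by (intro sum_mono2) auto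
      finally show False using n3 by simp
    qed
  qed
qed

end

section \<open>Moments, singular values and entropy\<close>


lemma fourth_moment:
  fixes \<mu> :: "complex measure"
  assumes "prob_space \<mu>" "sets \<mu> = sets borel" "0 < \<epsilon>" "0 < C"
    and mom: "(\<integral>\<^sup>+ x. ennreal (cmod x powr (4 + \<epsilon>)) \<partial>\<mu>) \<le> ennreal C"
  shows "integrable \<mu> (\<lambda>x. cmod x ^ 4)" "(\<integral>x. cmod x ^ 4 \<partial>\<mu>) \<le> 1 + C"
proof -
  interpret prob_space \<mu> by fact
  have m: "(\<lambda>x. f x) \<in> borel_measurable \<mu>" if "f \<in> borel_measurable borel" for f :: "complex \<Rightarrow> real"
    using that by (simp add: measurable_cong_sets[OF assms(2) refl])
  have m4: "(\<lambda>x. cmod x ^ 4) \<in> borel_measurable \<mu>" by (rule m) measurable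
  have mp: "(\<lambda>x. cmod x powr (4 + \<epsilon>)) \<in> borel_measurable \<mu>" by (rule m) measurable
  have le: "cmod x ^ 4 \<le> 1 + cmod x powr (4 + \<epsilon>)" for x
  proof (cases "cmod x \<le> 1")
    case True
    then have "cmod x ^ 4 \<le> 1" by (simp add: power_le_one)
    then show ?thesis by (simp add: add_increasing2)
  next
    case False
    then have "cmod x powr 4 \<le> cmod x powr (4 + \<epsilon>)" using \<open>0 < \<epsilon>\<close> by (intro powr_mono) auto
    moreover have "cmod x powr 4 = cmod x ^ 4" using False powr_realpow[of "cmod x" 4] by simp
    ultimately show ?thesis by simp
  qed
  have nn: "(\<integral>\<^sup>+ x. ennreal (cmod x ^ 4) \<partial>\<mu>) \<le> ennreal (1 + C)"
  proof -
    have "(\<integral>\<^sup>+ x. ennreal (cmod x ^ 4) \<partial>\<mu>) \<le> (\<integral>\<^sup>+ x. 1 + ennreal (cmod x powr (4 + \<epsilon>)) \<partial>\<mu>)"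
    proof (rule nn_integral_mono)
      fix x
      have "ennreal (cmod x ^ 4) \<le> ennreal (1 + cmod x powr (4 + \<epsilon>))" using le by (intro ennreal_leI)
      then show "ennreal (cmod x ^ 4) \<le> 1 + ennreal (cmod x powr (4 + \<epsilon>))" by simp
    qed
    also have "\<dots> = 1 + (\<integral>\<^sup>+ x. ennreal (cmod x powr (4 + \<epsilon>)) \<partial>\<mu>)"
      using mp by (subst nn_integral_add) (auto simp: emeasure_space_1)
    also have "\<dots> \<le> 1 + ennreal C" by (intro add_left_mono mom)
    also have "\<dots> = ennreal (1 + C)" using \<open>0 < C\<close> by simp
    finally show ?thesis .
  qed
  then have "(\<integral>\<^sup>+ x. ennreal (cmod x ^ 4) \<partial>\<mu>) < \<infinity>" using le_less_trans ennreal_less_top by (metis infinity_ennreal_def)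
  then show int: "integrable \<mu> (\<lambda>x. cmod x ^ 4)"
    using m4 by (intro integrableI_nonneg) auto
  have "ennreal (\<integral>x. cmod x ^ 4 \<partial>\<mu>) \<le> ennreal (1 + C)"
    using nn nn_integral_eq_integral[OF int] by simp
  then show "(\<integral>x. cmod x ^ 4 \<partial>\<mu>) \<le> 1 + C" using \<open>0 < C\<close> by (subst (asm) ennreal_le_iff) auto
qed

text \<open>Paley--Zygmund for \<open>X = \<bar>x - a\<bar>\<^sup>2\<close>, in the linearised form
  \<open>X \<le> 1/4 + (l X\<^sup>2 + 1/l) / 2\<close> off the ball.\<close>
lemma small_ball_atom:
  fixes \<mu> :: "complex measure" and a :: complex
  assumes "prob_space \<mu>" "sets \<mu> = sets borel" "1 \<le> \<kappa>"
    and int1: "integrable \<mu> (\<lambda>x. x)" and mean: "(\<integral>x. x \<partial>\<mu>) = 0"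
    and var: "(\<integral>\<^sup>+ x. ennreal ((cmod x)\<^sup>2) \<partial>\<mu>) = 1"
    and int4: "integrable \<mu> (\<lambda>x. cmod x ^ 4)" and mom4: "(\<integral>x. cmod x ^ 4 \<partial>\<mu>) \<le> \<kappa>"
  shows "measure \<mu> (ball a (1 / 2)) \<le> 1 - 1 / (16 * \<kappa>)"
proof -
  interpret prob_space \<mu> by fact
  have m: "f \<in> borel_measurable \<mu>" if "f \<in> borel_measurable borel" for f :: "complex \<Rightarrow> real"
    using that by (simp add: measurable_cong_sets[OF assms(2) refl])
  have sp: "space \<mu> = UNIV" using sets_eq_imp_space_eq[OF assms(2)] by simp
  have m2: "(\<lambda>x. (cmod x)\<^sup>2) \<in> borel_measurable \<mu>" by (rule m) measurable
  have int2: "integrable \<mu> (\<lambda>x. (cmod x)\<^sup>2)" using m2 var by (intro integrableI_nonneg) auto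
  have E2: "(\<integral>x. (cmod x)\<^sup>2 \<partial>\<mu>) = 1"
    using nn_integral_eq_integral[OF int2] var by simp
  define A where "A = (cmod a)\<^sup>2"
  have A0: "0 \<le> A" by (simp add: A_def)
  have expand: "(cmod (x - a))\<^sup>2 = (cmod x)\<^sup>2 + A - 2 * Re (x * cnj a)" for x
    unfolding A_def cmod_power2 by (simp add: power2_eq_square algebra_simps)
  have intx: "integrable \<mu> (\<lambda>x. x * cnj a)" using int1 by (rule integrable_mult_left)
  have EX: "(\<integral>x. (cmod (x - a))\<^sup>2 \<partial>\<mu>) = 1 + A" and intX: "integrable \<mu> (\<lambda>x. (cmod (x - a))\<^sup>2)"
  proof -
    have "(\<integral>x. Re (x * cnj a) \<partial>\<mu>) = Re (\<integral>x. x * cnj a \<partial>\<mu>)" by (rule integral_Re[OF intx])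
    also have "\<dots> = 0" using mean int1 by simp
    moreover define R where "R x = Re (x * cnj a)" for x
    ultimately have z: "(\<integral>x. R x \<partial>\<mu>) = 0" by simp
    have i: "integrable \<mu> R" unfolding R_def using intx by (rule integrable_Re)
    show "integrable \<mu> (\<lambda>x. (cmod (x - a))\<^sup>2)" unfolding expand R_def[symmetric] using int2 i
      by (intro Bochner_Integration.integrable_diff Bochner_Integration.integrable_add integrable_mult_right) auto
    show "(\<integral>x. (cmod (x - a))\<^sup>2 \<partial>\<mu>) = 1 + A" unfolding expand R_def[symmetric]
      using int2 i z E2 by (simp add: prob_space)
  qed
  \<comment> \<open>Chosen to make \<open>4 * l * (\<kappa> + A\<^sup>2)\<close> equal to half of
    the second moment \<open>1 + A\<close>, so that the fourth-moment terms leave a definite share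
    for the indicator.\<close>
  define l where "l = (1 + A) / (8 * (\<kappa> + A\<^sup>2))"
  have den: "0 < \<kappa> + A\<^sup>2" using \<open>1 \<le> \<kappa>\<close> by (simp add: add_pos_nonneg)
  have l0: "0 < l" using den A0 by (simp add: l_def)
  define p where "p = measure \<mu> (- ball a (1 / 2))"
  have "ball a (1 / 2) \<in> sets \<mu>" by (simp add: assms(2))
  then have "space \<mu> - ball a (1 / 2) \<in> sets \<mu>" by (rule sets.compl_sets)
  then have ballm: "- ball a (1 / 2) \<in> sets \<mu>" by (simp add: sp Compl_eq_Diff_UNIV)
  have pt: "(cmod (x - a))\<^sup>2 \<le> 1 / 4 + 4 * l * cmod x ^ 4 + 4 * l * A\<^sup>2 + 1 / (2 * l) * indicator (- ball a (1 / 2)) x" for x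
  proof (cases "x \<in> ball a (1 / 2)")
    case True
    then have "cmod (x - a) \<le> 1 / 2" by (simp add: dist_norm norm_minus_commute less_imp_le)
    then have "(cmod (x - a))\<^sup>2 \<le> (1 / 2)\<^sup>2" by (rule power_mono) simp
    also have "\<dots> = 1 / 4" by (simp add: power2_eq_square)
    finally have "(cmod (x - a))\<^sup>2 \<le> 1 / 4" .
    moreover have "0 \<le> 4 * l * cmod x ^ 4" "0 \<le> 4 * l * A\<^sup>2" using l0 by auto
    ultimately have "(cmod (x - a))\<^sup>2 \<le> 1 / 4 + 4 * l * cmod x ^ 4 + 4 * l * A\<^sup>2" by linarith
    then show ?thesis using True by simp
  next
    case False
    define X where "X = (cmod (x - a))\<^sup>2"
    have "0 \<le> (l * X - 1)\<^sup>2" by simp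
    then have "2 * (l * X) \<le> l\<^sup>2 * X\<^sup>2 + 1" by (simp add: power2_eq_square algebra_simps)
    then have "X \<le> (l\<^sup>2 * X\<^sup>2 + 1) / (2 * l)" using l0 by (simp add: field_simps)
    also have "\<dots> = l / 2 * X\<^sup>2 + 1 / (2 * l)" using l0 by (simp add: field_simps power2_eq_square)
    also have "X\<^sup>2 \<le> 8 * (cmod x ^ 4 + A\<^sup>2)"
    proof -
      have "cmod (x - a) \<le> cmod x + cmod a" by (rule norm_triangle_ineq4)
      then have "X \<le> (cmod x + cmod a)\<^sup>2" unfolding X_def by (rule power_mono) simp
      also have "\<dots> \<le> 2 * (cmod x)\<^sup>2 + 2 * A"
        unfolding A_def using sum_squares_bound[of "cmod x" "cmod a"] by (simp add: power2_sum)
      finally have "X\<^sup>2 \<le> (2 * (cmod x)\<^sup>2 + 2 * A)\<^sup>2" by (rule power_mono) (simp add: X_def)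
      also have "\<dots> \<le> 8 * ((cmod x)\<^sup>2)\<^sup>2 + 8 * A\<^sup>2"
        using sum_squares_bound[of "(cmod x)\<^sup>2" A] by (simp add: power2_eq_square algebra_simps)
      finally show ?thesis by (simp add: power_mult[symmetric])
    qed
    finally have "X \<le> l / 2 * (8 * (cmod x ^ 4 + A\<^sup>2)) + 1 / (2 * l)" using l0 by simp
    then show ?thesis using False by (simp add: X_def algebra_simps)
  qed
  have intI: "integrable \<mu> (indicator (- ball a (1 / 2)) :: complex \<Rightarrow> real)"
    using ballm emeasure_finite by (intro integrable_real_indicator) (auto simp: less_top[symmetric])
  have EI: "(\<integral>x. indicator (- ball a (1 / 2)) x \<partial>\<mu>) = p" using sp by (simp add: p_def)
  have "1 + A \<le> (\<integral>x. 1 / 4 + 4 * l * cmod x ^ 4 + 4 * l * A\<^sup>2 + 1 / (2 * l) * indicator (- ball a (1 / 2)) x \<partial>\<mu>)"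
    unfolding EX[symmetric]
  proof (rule integral_mono[OF intX _ pt])
    show "integrable \<mu> (\<lambda>x. 1 / 4 + 4 * l * cmod x ^ 4 + 4 * l * A\<^sup>2 + 1 / (2 * l) * indicator (- ball a (1 / 2)) x)"
      using int4 intI by (intro Bochner_Integration.integrable_add integrable_mult_right) auto
  qed
  also have "\<dots> = 1 / 4 + 4 * l * (\<integral>x. cmod x ^ 4 \<partial>\<mu>) + 4 * l * A\<^sup>2 + 1 / (2 * l) * p"
    using int4 intI prob_space by (simp add: p_def sp)
  also have "\<dots> \<le> 1 / 4 + 4 * l * \<kappa> + 4 * l * A\<^sup>2 + 1 / (2 * l) * p"
    using mom4 l0 by simp
  finally have "1 + A \<le> 1 / 4 + 4 * l * \<kappa> + 4 * l * A\<^sup>2 + 1 / (2 * l) * p" .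
  moreover have "4 * l * \<kappa> + 4 * l * A\<^sup>2 = 4 * (l * (\<kappa> + A\<^sup>2))" by (simp add: algebra_simps)
  moreover have "l * (\<kappa> + A\<^sup>2) = (1 + A) / 8"
  proof -
    have *: "x / (8 * D) * D = x / 8" if "D \<noteq> 0" for x D :: real using that by simp
    show ?thesis unfolding l_def by (rule *) (use den in linarith)
  qed
  ultimately have "1 + A \<le> 1 / 4 + (1 + A) / 2 + 1 / (2 * l) * p" by linarith
  then have "(1 + A) / 4 \<le> 1 / (2 * l) * p"
  proof -
    have "(1 + A) / 4 \<le> x" if "1 + A \<le> 1 / 4 + (1 + A) / 2 + x" for x :: real
      using that A0 by (simp add: field_simps)
    then show "1 + A \<le> 1 / 4 + (1 + A) / 2 + 1 / (2 * l) * p \<Longrightarrow> ?thesis" .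
  qed
  then have "l * (1 + A) / 2 \<le> p" using l0 by (simp add: field_simps)
  moreover have "1 / (16 * \<kappa>) \<le> l * (1 + A) / 2"
  proof -
    \<comment> \<open>Makes the bound uniform in the centre: the numerator
      \<open>(1 + A)\<^sup>2\<close> grows as fast as the denominator
      \<open>\<kappa> + A\<^sup>2\<close>.\<close>
    have "\<kappa> + A\<^sup>2 \<le> \<kappa> * (1 + A)\<^sup>2"
    proof -
      have "A\<^sup>2 \<le> \<kappa> * A\<^sup>2" "0 \<le> \<kappa> * A" using \<open>1 \<le> \<kappa>\<close> A0 by (auto simp: mult_le_cancel_right1)
      then show ?thesis by (simp add: power2_sum distrib_left)
    qed
    then have "(\<kappa> + A\<^sup>2) / (16 * \<kappa> * (\<kappa> + A\<^sup>2)) \<le> (\<kappa> * (1 + A)\<^sup>2) / (16 * \<kappa> * (\<kappa> + A\<^sup>2))"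
      using den \<open>1 \<le> \<kappa>\<close> by (intro divide_right_mono) auto
    moreover have "(\<kappa> + A\<^sup>2) / (16 * \<kappa> * (\<kappa> + A\<^sup>2)) = 1 / (16 * \<kappa>)" using den by simp
    moreover have "(\<kappa> * (1 + A)\<^sup>2) / (16 * \<kappa> * (\<kappa> + A\<^sup>2)) = l * (1 + A) / 2"
      using den \<open>1 \<le> \<kappa>\<close> by (simp add: l_def power2_eq_square)
    ultimately show ?thesis by simp
  qed
  moreover have "measure \<mu> (ball a (1 / 2)) = 1 - p"
    using prob_compl[OF ballm] sp by (simp add: p_def Compl_eq_Diff_UNIV[symmetric])
  ultimately show ?thesis by simp
qed

lemma large_atom:
  fixes \<mu> :: "complex measure"
  assumes "prob_space \<mu>" "sets \<mu> = sets borel" and \<Lambda>: "0 < \<Lambda>"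
    and int4: "integrable \<mu> (\<lambda>x. cmod x ^ 4)" and mom4: "(\<integral>x. cmod x ^ 4 \<partial>\<mu>) \<le> \<kappa>"
  shows "measure \<mu> {x. \<Lambda> < cmod x} \<le> \<kappa> / \<Lambda> ^ 4"
proof -
  interpret prob_space \<mu> by fact
  have sp: "space \<mu> = UNIV" using sets_eq_imp_space_eq[OF assms(2)] by simp
  have "open {x :: complex. \<Lambda> < cmod x}" by (intro open_Collect_less continuous_intros)
  then have ms: "{x. \<Lambda> < cmod x} \<in> sets \<mu>" using assms(2) by (simp add: borel_open)
  have "\<Lambda> ^ 4 * measure \<mu> {x. \<Lambda> < cmod x} = (\<integral>x. \<Lambda> ^ 4 * indicator {x. \<Lambda> < cmod x} x \<partial>\<mu>)"
    using sp by simp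
  also have "\<dots> \<le> (\<integral>x. cmod x ^ 4 \<partial>\<mu>)"
  proof (rule integral_mono[OF _ int4])
    show "integrable \<mu> (\<lambda>x. \<Lambda> ^ 4 * indicator {x. \<Lambda> < cmod x} x)"
      using ms emeasure_finite by (intro integrable_mult_right integrable_real_indicator) (auto simp: less_top[symmetric])
    show "\<Lambda> ^ 4 * indicator {x. \<Lambda> < cmod x} x \<le> cmod x ^ 4" for x
      using \<Lambda> by (auto simp: indicator_def intro: power_mono)
  qed
  finally show ?thesis using mom4 \<Lambda> by (simp add: field_simps)
qed

context band_params
begin

lemma unbounded_probability:
  fixes p :: real
  assumes large: "measure \<mu> {x. \<Lambda>0 < cmod x} \<le> p"
  shows "measure (iid idx) {\<omega> \<in> space (iid idx). \<not> bounded_entries \<omega>} \<le> 3 * m * b * b * p"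
proof -
  define U where "U i = {\<omega> \<in> space (iid idx). \<Lambda>0 < cmod (\<omega> i)}" for i
  have ms: "{x. \<Lambda>0 < cmod x} \<in> sets \<mu>"
  proof -
    have "open {x :: complex. \<Lambda>0 < cmod x}" by (intro open_Collect_less continuous_intros)
    then show ?thesis using sets_atom by (simp add: borel_open)
  qed
  have U: "U i \<in> sets (iid idx)" if "i \<in> idx" for i
  proof -
    have [measurable]: "(\<lambda>\<omega>. \<omega> i) \<in> borel_measurable (iid idx)" using that by (rule coord_measurable)
    show ?thesis unfolding U_def by measurable
  qed
  have PU: "measure (iid idx) (U i) \<le> p" if i: "i \<in> idx" for i
  proof -
    have mc: "(\<lambda>\<omega>. \<omega> i) \<in> measurable (iid idx) \<mu>" using i by (rule measurable_component_singleton)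
    have "distr (iid idx) \<mu> (\<lambda>\<omega>. \<omega> i) = \<mu>"
      using i by (intro distr_PiM_component) (auto intro: prob_space_axioms)
    then have "measure \<mu> {x. \<Lambda>0 < cmod x} = measure (distr (iid idx) \<mu> (\<lambda>\<omega>. \<omega> i)) {x. \<Lambda>0 < cmod x}" by simp
    also have "\<dots> = measure (iid idx) ((\<lambda>\<omega>. \<omega> i) -` {x. \<Lambda>0 < cmod x} \<inter> space (iid idx))"
      by (rule measure_distr[OF mc ms])
    also have "(\<lambda>\<omega>. \<omega> i) -` {x. \<Lambda>0 < cmod x} \<inter> space (iid idx) = U i" by (auto simp: U_def)
    finally show ?thesis using large by simp
  qed
  have "{\<omega> \<in> space (iid idx). \<not> bounded_entries \<omega>} = (\<Union>i\<in>idx. U i)"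
    by (auto simp: bounded_entries_def U_def not_le)
  then have "measure (iid idx) {\<omega> \<in> space (iid idx). \<not> bounded_entries \<omega>} \<le> (\<Sum>i\<in>idx. measure (iid idx) (U i))"
    using U fin_idx by (simp only:) (intro finite_measure.finite_measure_subadditive_finite[OF prob_space.finite_measure[OF prob_space_iid]], auto)
  also have "\<dots> \<le> (\<Sum>i\<in>idx. p)" by (intro sum_mono PU)
  also have "\<dots> = 3 * m * b * b * p" by (simp add: band_index_def)
  finally show ?thesis .
qed

end

text \<open>An eigenvector of \<open>mat_adjoint A * A\<close> for the minimal eigenvalue, divided
  by its largest coordinate. The block argument works with the maximum norm; the passage from the
  Euclidean norm costs \<open>sqrt n\<close>.\<close>

lemma smallest_singular_value_vector:
  assumes A: "A \<in> carrier_mat n n" and n: "0 < n" and \<sigma>: "smallest_singular_value A \<le> \<sigma>"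
  shows "\<exists>v. (\<forall>i<n. cmod (\<Sum>j<n. A $$ (i, j) * v j) \<le> \<sigma> * sqrt n) \<and> (\<exists>k<n. cmod (v k) = 1)"
proof -
  define B where "B = mat_adjoint A * A"
  have adj: "mat_adjoint A \<in> carrier_mat n n" using A by (auto simp: mat_adjoint_def)
  have adj_entry: "mat_adjoint A $$ (i, j) = cnj (A $$ (j, i))" if "i < n" "j < n" for i j
    using A that by (simp add: mat_adjoint_def mat_of_rows_def)
  have B: "B \<in> carrier_mat n n" using A adj by (simp add: B_def)
  \<comment> \<open>The spectrum is finite and nonempty, so the \<open>Min\<close> in the definition
    of the singular value is attained.\<close>
  have "spectrum B \<noteq> {}" "finite (spectrum B)" using spectrum_non_empty[OF B n] card_finite_spectrum[OF B] by auto
  then have "Min (Re ` spectrum B) \<in> Re ` spectrum B" by (intro Min_in) auto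
  then obtain l where l: "eigenvalue B l" "Min (Re ` spectrum B) = Re l" by (auto simp: spectrum_def)
  have "{Re l | l. eigenvalue (mat_adjoint A * A) l} = Re ` spectrum B" by (auto simp: spectrum_def B_def)
  then have s: "sqrt (Re l) \<le> \<sigma>" using \<sigma> l(2) by (simp add: smallest_singular_value_def)
  obtain u where u: "u \<in> carrier_vec n" "u \<noteq> 0\<^sub>v n" "B *\<^sub>v u = l \<cdot>\<^sub>v u"
    using l(1) B by (auto simp: eigenvalue_def eigenvector_def)
  define Au where "Au i = (\<Sum>j<n. A $$ (i, j) * u $ j)" for i
  have Aui: "(A *\<^sub>v u) $ i = Au i" if "i < n" for i
    using A u that by (auto simp: Au_def scalar_prod_def atLeast0LessThan intro!: sum.cong)
  have Bu: "l * u $ k = (\<Sum>i<n. cnj (A $$ (i, k)) * Au i)" if "k < n" for k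
  proof -
    have "l * u $ k = (B *\<^sub>v u) $ k" using u that by simp
    also have "B *\<^sub>v u = mat_adjoint A *\<^sub>v (A *\<^sub>v u)" unfolding B_def by (rule assoc_mult_mat_vec[OF adj A u(1)])
    also have "(mat_adjoint A *\<^sub>v (A *\<^sub>v u)) $ k = (\<Sum>i<n. mat_adjoint A $$ (k, i) * (A *\<^sub>v u) $ i)"
      using A adj u that by (auto simp: scalar_prod_def atLeast0LessThan intro!: sum.cong)
    also have "\<dots> = (\<Sum>i<n. cnj (A $$ (i, k)) * Au i)"
      using that by (intro sum.cong refl) (simp add: adj_entry Aui)
    finally show ?thesis .
  qed
  define N2 where "N2 = (\<Sum>k<n. (cmod (u $ k))\<^sup>2)"
  have "(\<Sum>k<n. cnj (u $ k) * (l * u $ k)) = (\<Sum>k<n. cnj (u $ k) * (\<Sum>i<n. cnj (A $$ (i, k)) * Au i))"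
    by (intro sum.cong refl) (simp add: Bu)
  also have "\<dots> = (\<Sum>i<n. (\<Sum>k<n. cnj (A $$ (i, k)) * cnj (u $ k)) * Au i)"
    unfolding sum_distrib_left sum_distrib_right by (subst sum.swap) (simp add: mult_ac)
  also have "\<dots> = (\<Sum>i<n. cnj (Au i) * Au i)"
    by (intro sum.cong refl arg_cong2[where f = "(*)"]) (simp add: Au_def)
  also have "\<dots> = of_real (\<Sum>i<n. (cmod (Au i))\<^sup>2)"
    unfolding of_real_sum by (intro sum.cong refl) (simp only: complex_norm_square mult_ac)
  also have "(\<Sum>k<n. cnj (u $ k) * (l * u $ k)) = l * of_real N2"
    unfolding N2_def of_real_sum sum_distrib_left by (intro sum.cong refl) (simp only: complex_norm_square mult_ac)
  finally have "l * of_real N2 = of_real (\<Sum>i<n. (cmod (Au i))\<^sup>2)" .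
  from arg_cong[OF this, of Re] have eq: "Re l * N2 = (\<Sum>i<n. (cmod (Au i))\<^sup>2)" by simp
  obtain k0 where k0: "k0 < n" "u $ k0 \<noteq> 0" using u by (metis eq_vecI carrier_vecD index_zero_vec(1) index_zero_vec(2))
  define K where "K = Max ((\<lambda>k. cmod (u $ k)) ` {..<n})"
  have "K \<in> (\<lambda>k. cmod (u $ k)) ` {..<n}" unfolding K_def using n by (intro Max_in) auto
  then obtain k where k: "k < n" "K = cmod (u $ k)" by auto
  have Kmax: "cmod (u $ j) \<le> K" if "j < n" for j unfolding K_def using that by (intro Max_ge) auto
  have K0: "0 < K" using Kmax[OF k0(1)] k0(2) by (meson less_le_trans zero_less_norm_iff)
  have N2K: "N2 \<le> n * K\<^sup>2"
    unfolding N2_def using sum_bounded_above[of "{..<n}" "\<lambda>k. (cmod (u $ k))\<^sup>2" "K\<^sup>2"] Kmax by (simp add: power_mono)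
  have N20: "0 < N2" unfolding N2_def using k0 by (intro sum_pos2[of _ k0]) auto
  have "0 \<le> Re l * N2" unfolding eq by (intro sum_nonneg) simp
  then have l0: "0 \<le> Re l" using N20 by (simp add: zero_le_mult_iff)
  have \<sigma>0: "0 \<le> \<sigma>" using s l0 by (meson order_trans real_sqrt_ge_zero)
  have l\<sigma>: "Re l \<le> \<sigma>\<^sup>2" using s l0 \<sigma>0 by (metis real_sqrt_le_iff real_sqrt_unique real_sqrt_abs abs_of_nonneg)
  have bound: "cmod (Au i) \<le> \<sigma> * sqrt n * K" if "i < n" for i
  proof -
    have "(cmod (Au i))\<^sup>2 \<le> (\<Sum>i<n. (cmod (Au i))\<^sup>2)" using that by (intro member_le_sum) auto
    also have "\<dots> \<le> \<sigma>\<^sup>2 * (n * K\<^sup>2)" unfolding eq[symmetric] using l\<sigma> N2K N20 by (intro mult_mono) auto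
    also have "\<dots> = (\<sigma> * sqrt n * K)\<^sup>2" by (simp add: power_mult_distrib)
    finally show ?thesis using \<sigma>0 K0 by (simp add: power2_le_iff_abs_le abs_le_square_iff)
  qed
  show ?thesis
  proof (intro exI[of _ "\<lambda>j. u $ j / u $ k"] conjI allI impI)
    fix i assume "i < n"
    have "(\<Sum>j<n. A $$ (i, j) * (u $ j / u $ k)) = Au i / u $ k" by (simp add: Au_def sum_divide_distrib)
    then have "cmod (\<Sum>j<n. A $$ (i, j) * (u $ j / u $ k)) = cmod (Au i) / K" by (simp add: norm_divide k)
    also have "\<dots> \<le> \<sigma> * sqrt n" using bound[OF \<open>i < n\<close>] K0 by (simp add: field_simps)
    finally show "cmod (\<Sum>j<n. A $$ (i, j) * (u $ j / u $ k)) \<le> \<sigma> * sqrt n" .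
  next
    show "\<exists>k'<n. cmod (u $ k' / u $ k) = 1" using k K0 by (intro exI[of _ k]) (auto simp: norm_divide)
  qed
qed

text \<open>Bookkeeping of exponents of \<open>q\<close>: the generating function bounds the
  binomial coefficient by \<open>(1 + x) ^ (3 * n) * (1 / x) ^ (n div k)\<close>. A small
  \<open>x\<close> keeps the first factor within exponent 1/4, then a large \<open>k\<close> keeps
  the second within 1/8. Against this, \<open>q ^ (n - n div k)\<close> contributes at least 1/2, so
  1/8 remains.\<close>

lemma binomial_entropy:
  fixes q :: real
  assumes q: "0 < q" "q < 1"
  shows "\<exists>k\<ge>2. \<forall>n. real ((3 * n) choose (n div k)) * q ^ (n - n div k) \<le> (q powr (1 / 8)) ^ n"
proof -
  define Q where "Q = q powr (- (1 / 4))"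
  \<comment> \<open>The 7 comes from \<open>(1 + x) ^ 3 \<le> 1 + 7 * x\<close> for
    \<open>x \<le> 1\<close>.\<close>
  define x where "x = min 1 ((Q - 1) / 7)"
  have g1: "1 < Q" using q by (simp add: Q_def powr_def)
  have x: "0 < x" "x \<le> 1" using g1 by (auto simp: x_def)
  have "x \<le> (Q - 1) / 7" unfolding x_def by (rule min.cobounded2)
  then have x7: "7 * x \<le> Q - 1" by simp
  have x3: "(1 + x) ^ 3 \<le> q powr (- (1 / 4))"
  proof -
    have "x * x \<le> x * 1" "x * x * x \<le> x * 1 * 1" using x by (intro mult_mono; simp)+
    then have "(1 + x) ^ 3 \<le> 1 + 7 * x" by (simp add: power3_eq_cube algebra_simps)
    then show ?thesis using x7 unfolding Q_def[symmetric] by simp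
  qed
  obtain k0 :: nat where k0: "ln (1 / x) / (- ln q / 8) < real k0" using reals_Archimedean2 by blast
  define k where "k = max 2 k0"
  have k2: "2 \<le> k" by (simp add: k_def)
  have lnq: "0 < - ln q / 8" using q by simp
  have "ln (1 / x) / (- ln q / 8) \<le> real k" using k0 by (simp add: k_def)
  then have lx: "ln (1 / x) \<le> real k * (- ln q / 8)" using lnq by (simp only: pos_divide_le_eq)
  have xk: "(1 / x) powr (1 / k) \<le> q powr (- (1 / 8))"
  proof -
    have "ln (1 / x) / k \<le> - ln q / 8" using lx k2 by (simp add: field_simps)
    then show ?thesis using x q by (simp add: powr_def)
  qed
  have "real ((3 * n) choose (n div k)) * q ^ (n - n div k) \<le> (q powr (1 / 8)) ^ n" for n
  proof -
    define j where "j = n div k"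
    have "j * k \<le> n" unfolding j_def by (rule div_times_less_eq_dividend)
    then have "real j * real k \<le> real n" by (simp flip: of_nat_mult)
    then have jn: "real j \<le> n / k" using k2 by (simp add: field_simps)
    have j3: "j \<le> 3 * n" unfolding j_def using div_le_dividend[of n k] by linarith
    have "real ((3 * n) choose j) * x ^ j \<le> (\<Sum>i\<le>3 * n. real ((3 * n) choose i) * x ^ i)"
      using x j3 by (intro member_le_sum[of j "{..3 * n}" "\<lambda>i. real ((3 * n) choose i) * x ^ i"]) auto
    also have "\<dots> = (1 + x) ^ (3 * n)" using binomial_ring[of x 1 "3 * n"] by (simp add: add.commute)
    finally have c1: "real ((3 * n) choose j) \<le> (1 + x) ^ (3 * n) * (1 / x) ^ j"
      using x by (simp add: field_simps power_divide)
    have "(1 + x) ^ (3 * n) = ((1 + x) ^ 3) ^ n" by (simp add: power_mult)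
    also have "\<dots> \<le> (q powr (- (1 / 4))) ^ n" using x3 x by (intro power_mono) auto
    finally have c2: "(1 + x) ^ (3 * n) \<le> q powr (- (real n / 4))"
      using q by (simp add: powr_powr powr_realpow[symmetric] mult.commute)
    have "(1 / x) ^ j = (1 / x) powr j" using x by (simp add: powr_realpow)
    also have "\<dots> \<le> (1 / x) powr (n / k)" using jn x by (intro powr_mono) auto
    also have "\<dots> = ((1 / x) powr (1 / k)) powr n" by (simp add: powr_powr)
    also have "\<dots> \<le> (q powr (- (1 / 8))) powr n" using xk by (intro powr_mono2) auto
    finally have c3: "(1 / x) ^ j \<le> q powr (- (real n / 8))" by (simp add: powr_powr)
    have "real n / 2 \<le> real (n - j)"
    proof -
      have "real n / k \<le> real n / 2" using k2 by (intro divide_left_mono) auto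
      then have "real j \<le> real n / 2" using jn by linarith
      then show ?thesis by (simp add: of_nat_diff j_def)
    qed
    then have "q powr real (n - j) \<le> q powr (real n / 2)" using q by (intro powr_mono') auto
    then have c4: "q ^ (n - j) \<le> q powr (real n / 2)" using q by (simp add: powr_realpow)
    have "real ((3 * n) choose j) * q ^ (n - j) \<le> (q powr (- (real n / 4)) * q powr (- (real n / 8))) * q powr (real n / 2)"
      using q x by (intro mult_mono c4 order_trans[OF c1] c2 c3) auto
    also have "\<dots> = q powr (real n / 8)" by (simp add: powr_add[symmetric])
    also have "\<dots> = (q powr (1 / 8)) ^ n" using q by (simp add: powr_powr powr_realpow[symmetric] mult.commute)
    finally show ?thesis by (simp add: j_def)
  qed
  then show ?thesis using k2 by blast
qed

section \<open>The theorem\<close>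


text \<open>With \<open>d = b div 2\<close> both exponents \<open>b + 1 - d\<close> and
  \<open>d + 1\<close> are at least half of \<open>b\<close>, so each power of \<open>q\<close> is
  at most \<open>sqrt q ^ b\<close>; the sparse supports are covered by the entropy
  hypothesis.\<close>

lemma spread_error_bound:
  fixes q \<theta> :: real
  assumes q: "0 \<le> q" "q \<le> 1" and "m \<le> b" and s: "s \<le> b" and q\<theta>: "sqrt q \<le> \<theta>"
    and ent: "real ((3 * b) choose s) * q ^ (b - s) \<le> \<theta> ^ b"
  shows "m * (real (b div 2) * q ^ (b + 1 - b div 2) + real (b - b div 2) * q ^ (b div 2 + 1)) +
      ((3 * b) choose s) * (s * q ^ (b - s)) \<le> 2 * real b ^ 2 * \<theta> ^ b"
proof -
  have \<theta>0: "0 \<le> \<theta>" using q\<theta> q by (meson order_trans real_sqrt_ge_zero)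
  have pw: "q ^ e \<le> \<theta> ^ b" if "b \<le> 2 * e" for e
  proof -
    have "q ^ e = sqrt q ^ (2 * e)" using q by (simp add: power_mult)
    also have "\<dots> \<le> sqrt q ^ b" using that q by (intro power_decreasing) auto
    also have "\<dots> \<le> \<theta> ^ b" using q\<theta> q by (intro power_mono) auto
    finally show ?thesis .
  qed
  have "real (b div 2) * q ^ (b + 1 - b div 2) + real (b - b div 2) * q ^ (b div 2 + 1) \<le>
      real (b div 2) * \<theta> ^ b + real (b - b div 2) * \<theta> ^ b"
    by (intro add_mono mult_left_mono pw) auto
  also have "\<dots> = real (b div 2 + (b - b div 2)) * \<theta> ^ b" by (simp only: of_nat_add distrib_right)
  also have "b div 2 + (b - b div 2) = b" by simp
  finally have "m * (real (b div 2) * q ^ (b + 1 - b div 2) + real (b - b div 2) * q ^ (b div 2 + 1)) \<le> b * (b * \<theta> ^ b)"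
    using \<open>m \<le> b\<close> q \<theta>0 by (intro mult_mono) auto
  moreover have "((3 * b) choose s) * (s * q ^ (b - s)) \<le> b * (b * \<theta> ^ b)"
  proof -
    have "real ((3 * b) choose s) * (s * q ^ (b - s)) = s * (real ((3 * b) choose s) * q ^ (b - s))" by simp
    also have "\<dots> \<le> b * \<theta> ^ b" using s ent q by (intro mult_mono) auto
    also have "\<dots> \<le> b * (b * \<theta> ^ b)"
    proof (cases "b = 0")
      case False
      then have "1 * \<theta> ^ b \<le> b * \<theta> ^ b" using \<theta>0 by (intro mult_right_mono) auto
      then show ?thesis by (intro mult_left_mono) auto
    qed simp
    finally show ?thesis .
  qed
  ultimately show ?thesis by (simp add: power2_eq_square)
qed

text \<open>A forward step costs \<open>y ^ 10\<close> and each of the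
  \<open>(m - 2) div 2 + 1\<close> backward double steps \<open>y ^ 4\<close>; the exponents add up
  to at most \<open>12 * m - 1\<close>, and the remaining factor \<open>1 / y\<close> gives the
  1/2.\<close>

lemma total_loss_bound:
  fixes y \<Lambda> V :: real
  assumes y: "2 \<le> y" and m: "3 \<le> m" and \<Lambda>: "0 \<le> \<Lambda>" "\<Lambda> \<le> V"
    and F2: "2 * (1 + 6 * y ^ 3 * V) \<le> y ^ 4"
    and F3: "1 + 6 * y ^ 4 * (2 * y * (2 + 2 * y ^ 3 * V)) * V \<le> y ^ 10"
  shows "(2 * (1 + 3 * y ^ 3 * \<Lambda> / (1 / 2))) ^ ((m - 2) div 2 + 1) *
      ((1 + 6 * y ^ 4 * (y / (1 / 2) * (2 + y ^ 3 * \<Lambda> / (1 / 2))) * \<Lambda>) ^ (m - 2) * (1 / y ^ (12 * m))) \<le> 1 / 2"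
proof -
  have y0: "0 \<le> y" "1 \<le> y" "0 < y" using y by auto
  have V0: "0 \<le> V" using \<Lambda> by simp
  have a: "2 * (1 + 3 * y ^ 3 * \<Lambda> / (1 / 2)) \<le> y ^ 4"
  proof (rule order_trans[OF _ F2])
    have "y ^ 3 * \<Lambda> \<le> y ^ 3 * V" using \<Lambda> y0 by (intro mult_left_mono) auto
    then show "2 * (1 + 3 * y ^ 3 * \<Lambda> / (1 / 2)) \<le> 2 * (1 + 6 * y ^ 3 * V)" by simp
  qed
  have b: "1 + 6 * y ^ 4 * (y / (1 / 2) * (2 + y ^ 3 * \<Lambda> / (1 / 2))) * \<Lambda> \<le> y ^ 10"
  proof (rule order_trans[OF _ F3])
    have "6 * y ^ 4 * (2 * y * (2 + 2 * y ^ 3 * \<Lambda>)) * \<Lambda> \<le> 6 * y ^ 4 * (2 * y * (2 + 2 * y ^ 3 * V)) * V"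
      using \<Lambda> V0 y0 by (intro mult_mono mult_left_mono add_left_mono) auto
    then show "1 + 6 * y ^ 4 * (y / (1 / 2) * (2 + y ^ 3 * \<Lambda> / (1 / 2))) * \<Lambda> \<le> 1 + 6 * y ^ 4 * (2 * y * (2 + 2 * y ^ 3 * V)) * V"
      by (simp add: mult_ac)
  qed
  define e where "e = (m - 2) div 2 + 1"
  have "(2 * (1 + 3 * y ^ 3 * \<Lambda> / (1 / 2))) ^ e *
      ((1 + 6 * y ^ 4 * (y / (1 / 2) * (2 + y ^ 3 * \<Lambda> / (1 / 2))) * \<Lambda>) ^ (m - 2) * (1 / y ^ (12 * m))) \<le>
      (y ^ 4) ^ e * ((y ^ 10) ^ (m - 2) * (1 / y ^ (12 * m)))"
    using \<Lambda> y0 by (intro mult_mono power_mono a b mult_nonneg_nonneg zero_le_power add_nonneg_nonneg) auto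
  also have "\<dots> = y ^ (4 * e + 10 * (m - 2)) / y ^ (12 * m)" by (simp add: power_mult power_add)
  also have "\<dots> \<le> y ^ (12 * m - 1) / y ^ (12 * m)"
  proof -
    have "4 * (x + 1) \<le> 2 * n + 4" if "2 * x \<le> n" for x n :: nat using that by simp
    then have "4 * e \<le> 2 * (m - 2) + 4" unfolding e_def by simp
    then have "4 * e + 10 * (m - 2) \<le> 12 * m - 1" using m by linarith
    then show ?thesis using y0 by (intro divide_right_mono power_increasing) auto
  qed
  also have "\<dots> = 1 / y"
  proof -
    have "12 * m = Suc (12 * m - 1)" using m by simp
    then have "y ^ (12 * m) = y * y ^ (12 * m - 1)" by (metis power_Suc)
    then show ?thesis using y0 by simp
  qed
  also have "\<dots> \<le> 1 / 2" using y by (intro divide_left_mono) auto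
  finally show ?thesis by (simp add: e_def)
qed

text \<open>What holds only for large \<open>b\<close> enters as hypotheses, so that the asymptotics
  can be settled afterwards in one place. \<open>F1\<close> puts the shift below the truncation
  level, \<open>F2\<close> and \<open>F3\<close> bound the backward and forward losses,
  \<open>F4\<close> separates the scales for sparse triples, and \<open>D1\<close> and
  \<open>D2\<close> make the exponentially small terms smaller than the target rate.\<close>

lemma band_instance:
  fixes \<mu> :: "complex measure" and q K' \<kappa> :: real and b m k :: nat and z :: complex
  assumes ps: "prob_space \<mu>" and sets: "sets \<mu> = sets borel"
    and conc: "\<And>a. measure \<mu> (ball a (1 / 2)) \<le> q" and q: "0 < q" "q < 1"
    and large: "\<And>\<Lambda>. 0 < \<Lambda> \<Longrightarrow> measure \<mu> {x. \<Lambda> < cmod x} \<le> \<kappa> / \<Lambda> ^ 4" and \<kappa>: "0 \<le> \<kappa>"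
    and k: "2 \<le> k" and ent: "\<And>n. real ((3 * n) choose (n div k)) * q ^ (n - n div k) \<le> (q powr (1 / 8)) ^ n"
    and m: "25 \<le> m" "m \<le> b" and kb: "2 * k * k \<le> b" and z: "cmod z \<le> K'"
    and F1: "K' * sqrt (3 * real b) \<le> real b powr (7 / 8)"
    and F2: "2 * (1 + 6 * real b ^ 3 * (2 * real b powr (7 / 8))) \<le> real b ^ 4"
    and F3: "1 + 6 * real b ^ 4 * (2 * real b * (2 + 2 * real b ^ 3 * (2 * real b powr (7 / 8)))) * (2 * real b powr (7 / 8)) \<le> real b ^ 10"
    and F4: "real b * (1 / real b ^ 12 + 3 * real b * ((2 * real b powr (7 / 8)) * (1 / real b ^ 4))) < 1 / 2"
    and D1: "2 * real b ^ 3 * (q powr (1 / 8)) powr real b \<le> 1 / sqrt (real b)"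
    and D2: "(q powr (1 / 8)) powr (real b / (2 * k)) \<le> 1 / sqrt (real b)"
  shows "measure (PiM (band_index m b) (\<lambda>_. \<mu>))
      {\<omega> \<in> space (PiM (band_index m b) (\<lambda>_. \<mu>)).
        smallest_singular_value ((1 / complex_of_real (sqrt (real (3 * b)))) \<cdot>\<^sub>m band_matrix m b \<omega> - z \<cdot>\<^sub>m 1\<^sub>m (m * b))
          \<le> real (3 * b) powr (- 25 * real m)}
    \<le> (3 * \<kappa> + 1 + 6 * k * (2 + 2 * k)) / sqrt (real b)"
proof -
  interpret atom_dist \<mu> using ps sets by (simp add: atom_dist_def atom_dist_axioms_def)
  define y where "y = real b"
  \<comment> \<open>Twice the truncation level, to cover the shift as well. The power 7/8 is the one
    for which a fourth moment and at most \<open>3 * y ^ 3\<close> atoms give a truncation cost of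
    order \<open>y ^ 3 / y powr (7 / 2)\<close>, the target rate.\<close>
  define V where "V = 2 * y powr (7 / 8)"
  define \<zeta> where "\<zeta> = z * complex_of_real (sqrt (real (3 * b)))"
  define \<theta> where "\<theta> = q powr (1 / 8)"
  have b25: "25 \<le> b" using m by simp
  then have y25: "25 \<le> y" by (simp add: y_def)
  then have y0: "0 < y" "1 \<le> y" by auto
  have \<theta>: "0 < \<theta>" "\<theta> < 1" using q by (auto simp: \<theta>_def powr_def)
  \<comment> \<open>Both ratios are the same \<open>k\<close>, so one entropy bound controls the
    sparse supports among \<open>3 * b\<close> coordinates and the positions of large differences
    among \<open>s\<close>.\<close>
  define s t where "s = b div k" and "t = s div k"
  have \<zeta>V: "cmod \<zeta> \<le> y powr (7 / 8)"
  proof -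
    have "cmod \<zeta> = cmod z * sqrt (3 * y)" by (simp add: \<zeta>_def y_def norm_mult)
    also have "\<dots> \<le> K' * sqrt (3 * y)" using z y0 by (intro mult_right_mono) auto
    finally show ?thesis using F1 by (simp add: y_def)
  qed
  have \<Lambda>V: "y powr (7 / 8) + cmod \<zeta> \<le> V" "0 \<le> y powr (7 / 8) + cmod \<zeta>" using \<zeta>V by (auto simp: V_def)
  \<comment> \<open>\<open>\<tau>'\<close> is the inverse of the loss along the chain. The gap
    \<open>y ^ 4\<close> down to \<open>\<tau>\<close> beats the factor
    \<open>3 * y\<^sup>2 * V\<close> from the coordinates off the support. Finally
    \<open>\<eta>\<close> is \<open>\<tau>\<^sup>2 / y ^ 4\<close>: the square because the large
    coordinates of both vectors are of size \<open>\<tau>\<close>, the rest to absorb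
    \<open>16 * m * b\<close>.\<close>
  define \<tau>' \<tau> \<eta> where "\<tau>' = 1 / y ^ (12 * m)" and "\<tau> = 1 / y ^ (12 * m + 4)" and "\<eta> = 1 / y ^ (24 * m + 12)"
  have \<tau>'0: "0 < \<tau>'" and \<tau>0: "0 < \<tau>" and \<eta>0: "0 < \<eta>" using y0 by (auto simp: \<tau>'_def \<tau>_def \<eta>_def)
  have \<tau>eq: "\<tau> = \<tau>' * (1 / y ^ 4)" by (simp add: \<tau>_def \<tau>'_def power_add)
  have \<eta>le: "\<eta> \<le> \<tau>' * (1 / y ^ 12)"
  proof -
    have "y ^ (12 * m + 12) \<le> y ^ (24 * m + 12)" using y0 by (intro power_increasing) auto
    then have "\<eta> \<le> 1 / y ^ (12 * m + 12)" unfolding \<eta>_def using y0 by (intro divide_left_mono) auto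
    then show ?thesis by (simp add: \<tau>'_def power_add)
  qed
  have sk: "s * k \<le> b" "b < s * k + k" using k by (auto simp: s_def div_mult_mod_eq[symmetric] intro: div_times_less_eq_dividend)
    (metis add.commute add_strict_left_mono div_mult_mod_eq mod_less_divisor not_numeral_le_zero zero_less_iff_neq_zero)
  have bs: "y / (2 * k) \<le> s" and s1: "1 \<le> s"
  proof -
    have "2 * k \<le> 2 * k * k" using k by simp
    then have "2 * k \<le> b" using kb by (rule order_trans)
    then have "b < 2 * (s * k)" using sk by linarith
    then have "y < 2 * (real s * real k)" unfolding y_def by (metis of_nat_less_iff of_nat_mult of_nat_numeral)
    then show "y / (2 * k) \<le> s" using k by (simp add: field_simps)
    show "1 \<le> s" using \<open>b < 2 * (s * k)\<close> by (cases s) auto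
  qed
  have sb: "s < b" using k b25 by (simp add: s_def)
  interpret band_params \<mu> b m "b div 2" s t q "1 / 2" "y powr (7 / 8)" \<eta> \<tau> \<tau>' \<zeta>
  proof
    show "b div 2 \<le> b" "s < b" "t \<le> s" "1 \<le> s" "3 \<le> m" "(0::real) < 1 / 2" "q \<le> 1"
      using sb s1 m q by (auto simp: t_def)
    show "measure \<mu> (ball a (1 / 2)) \<le> q" for a by (rule conc)
    show "1 \<le> y powr (7 / 8)" using y0 by (intro ge_one_powr_ge_zero) auto
    show "0 < \<tau>" "0 < \<eta>" by fact+
    show "\<tau> \<le> \<tau>'" unfolding \<tau>eq using \<tau>'0 y0 by (intro mult_left_le) (auto simp: divide_le_eq_1 one_le_power)
    have "\<tau>' * (1 / y ^ 12) \<le> \<tau>'" using \<tau>'0 y0 by (intro mult_left_le) (auto simp: divide_le_eq_1 one_le_power)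
    then show "\<eta> \<le> \<tau>'" using \<eta>le by simp
    have "real b * (\<eta> + 3 * real b * ((y powr (7 / 8) + cmod \<zeta>) * \<tau>)) \<le> y * (\<tau>' * (1 / y ^ 12) + 3 * y * (V * \<tau>))"
      unfolding y_def[symmetric] using \<Lambda>V \<eta>le y0 \<tau>0 by (intro mult_left_mono add_mono mult_right_mono) auto
    also have "\<dots> = \<tau>' * (y * (1 / y ^ 12 + 3 * y * (V * (1 / y ^ 4))))" unfolding \<tau>eq by (simp add: algebra_simps)
    also have "\<dots> < \<tau>' * (1 / 2)" using F4 \<tau>'0 by (intro mult_strict_left_mono) (auto simp: V_def y_def)
    finally show "real b * (\<eta> + 3 * real b * ((y powr (7 / 8) + cmod \<zeta>) * \<tau>)) < 1 / 2 * \<tau>'" by simp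
    show "(2 * (1 + 3 * real b ^ 3 * (y powr (7 / 8) + cmod \<zeta>) / (1 / 2))) ^ ((m - 2) div 2 + 1) *
      ((1 + 6 * real b ^ 4 * (real b / (1 / 2) * (2 + real b ^ 3 * (y powr (7 / 8) + cmod \<zeta>) / (1 / 2))) * (y powr (7 / 8) + cmod \<zeta>)) ^ (m - 2) * \<tau>') \<le> 1 / 2"
      unfolding \<tau>'_def y_def[symmetric]
      by (rule total_loss_bound[OF _ _ \<Lambda>V(2,1)]) (use m y25 F2 F3 in \<open>auto simp: V_def y_def\<close>)
    have "8 * (real m * real b) * \<eta> \<le> 8 * (y * y) * \<eta>"
      unfolding y_def using m \<eta>0 by (intro mult_right_mono mult_left_mono mult_mono) auto
    also have "\<dots> \<le> 1 / 2 * y ^ 4 * \<eta>"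
    proof (rule mult_right_mono)
      have "16 * (y * y) \<le> (y * y) * (y * y)" using y25 mult_mono[of 16 "y * y" "y * y" "y * y"] mult_mono[of 25 y 25 y] by simp
      then show "8 * (y * y) \<le> 1 / 2 * y ^ 4" by (simp add: power4_eq_xxxx mult.assoc)
    qed (use \<eta>0 in simp)
    also have "\<dots> = \<tau> * \<tau> * (1 / 2)"
    proof -
      have "24 * m + 12 = (12 * m + 4) + (12 * m + 4) + 4" by simp
      then have "y ^ (24 * m + 12) = y ^ (12 * m + 4) * y ^ (12 * m + 4) * y ^ 4" by (metis power_add)
      then show ?thesis using y0 by (simp add: \<eta>_def \<tau>_def)
    qed
    finally show "8 * (real m * real b) * \<eta> \<le> \<tau> * \<tau> * (1 / 2)" .
  qed
  obtain G where G: "G \<in> sets (iid idx)" and PG: "measure (iid idx) G \<le>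
      measure (iid idx) {\<omega> \<in> space (iid idx). \<not> bounded_entries \<omega>} + m * spread_error + 3 * b / s * (spread_error + form_error)"
    and inG: "\<And>\<omega>. \<omega> \<in> space (iid idx) \<Longrightarrow>
      \<exists>v. (\<forall>i<m * b. cmod (\<Sum>j<m * b. entry \<omega> i j * v j) < \<eta>) \<and> (\<exists>k<m * b. 1 / 2 < cmod (v k)) \<Longrightarrow> \<omega> \<in> G"
    using near_kernel_probability by blast
  define c where "c = real (3 * b)"
  have c: "0 < c" "c = 3 * y" using b25 by (auto simp: c_def y_def)
  define Ev where "Ev = {\<omega> \<in> space (iid idx).
        smallest_singular_value ((1 / complex_of_real (sqrt c)) \<cdot>\<^sub>m band_matrix m b \<omega> - z \<cdot>\<^sub>m 1\<^sub>m (m * b)) \<le> c powr (- 25 * real m)}"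
  have "Ev \<subseteq> G"
  proof
    fix \<omega> assume "\<omega> \<in> Ev"
    then have \<omega>: "\<omega> \<in> space (iid idx)"
      and small: "smallest_singular_value ((1 / complex_of_real (sqrt c)) \<cdot>\<^sub>m band_matrix m b \<omega> - z \<cdot>\<^sub>m 1\<^sub>m (m * b)) \<le> c powr (- 25 * real m)"
      by (auto simp: Ev_def)
    define A where "A = (1 / complex_of_real (sqrt c)) \<cdot>\<^sub>m band_matrix m b \<omega> - z \<cdot>\<^sub>m 1\<^sub>m (m * b)"
    have A: "A \<in> carrier_mat (m * b) (m * b)" by (rule carrier_matI) (simp_all add: A_def band_matrix_def)
    have n: "0 < m * b" using m b25 by simp
    have Aij: "entry \<omega> i j = complex_of_real (sqrt c) * A $$ (i, j)" if "i < m * b" "j < m * b" for i j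
      using that b25 by (simp add: A_def band_matrix_def shifted_band_def \<zeta>_def c(2) y_def right_diff_distrib)
    obtain v where v: "\<forall>i<m * b. cmod (\<Sum>j<m * b. A $$ (i, j) * v j) \<le> c powr (- 25 * real m) * sqrt (m * b)"
      "\<exists>k<m * b. cmod (v k) = 1"
      using smallest_singular_value_vector[OF A n small[folded A_def]] by blast
    \<comment> \<open>Undoing the normalisation and passing to the maximum norm cost at most
      \<open>y\<^sup>2\<close> together, so the exponent must exceed \<open>24 * m + 14\<close>;
      \<open>25 * m\<close> does, as \<open>25 \<le> m\<close>.\<close>
    have less: "sqrt c * (c powr (- 25 * real m) * sqrt (m * b)) < \<eta>"
    proof -
      have "real (m * b) \<le> y * y" using m by (simp add: y_def mult_right_mono)
      then have "sqrt (m * b) \<le> sqrt (y * y)" by (rule real_sqrt_le_mono)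
      then have "sqrt c * sqrt (m * b) \<le> sqrt (3 * y) * sqrt (y * y)"
        unfolding c(2) by (rule mult_left_mono) (use y0 in simp)
      also have "\<dots> \<le> sqrt (y * y) * sqrt (y * y)" using y25 by (intro mult_right_mono real_sqrt_le_mono) auto
      also have "\<dots> = y * y" using y0 by simp
      finally have 1: "sqrt c * sqrt (m * b) \<le> y * y" .
      have "c powr (- 25 * real m) \<le> y powr (- 25 * real m)" using c y0 by (intro powr_mono2') auto
      also have "\<dots> = 1 / y ^ (25 * m)" using y0 powr_realpow[of y "25 * m"] by (simp add: powr_minus_divide)
      finally have 2: "c powr (- 25 * real m) \<le> 1 / y ^ (25 * m)" .
      have "(sqrt c * sqrt (m * b)) * c powr (- 25 * real m) \<le> (y * y) * (1 / y ^ (25 * m))"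
        by (rule mult_mono[OF 1 2]) (use y0 in simp_all)
      also have "\<dots> < \<eta>"
      proof -
        have "y ^ (24 * m + 14) < y ^ (25 * m)" using y25 m by (intro power_strict_increasing) auto
        then have "y * y * y ^ (24 * m + 12) < y ^ (25 * m)" by (simp add: power_add power2_eq_square eval_nat_numeral mult_ac)
        then show ?thesis using y0 by (simp add: \<eta>_def field_simps)
      qed
      finally show ?thesis by (simp add: mult_ac)
    qed
    show "\<omega> \<in> G"
    proof (rule inG[OF \<omega>], intro exI[of _ v] conjI allI impI)
      fix i assume i: "i < m * b"
      have "(\<Sum>j<m * b. entry \<omega> i j * v j) = complex_of_real (sqrt c) * (\<Sum>j<m * b. A $$ (i, j) * v j)"
        unfolding sum_distrib_left by (intro sum.cong refl) (simp add: Aij i)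
      then have "cmod (\<Sum>j<m * b. entry \<omega> i j * v j) = sqrt c * cmod (\<Sum>j<m * b. A $$ (i, j) * v j)"
        using c(1) by (simp add: norm_mult)
      also have "\<dots> \<le> sqrt c * (c powr (- 25 * real m) * sqrt (m * b))" using v(1) i c(1) by (intro mult_left_mono) auto
      finally show "cmod (\<Sum>j<m * b. entry \<omega> i j * v j) < \<eta>" using less by simp
    next
      show "\<exists>k<m * b. 1 / 2 < cmod (v k)" using v(2) by auto
    qed
  qed
  then have "measure (iid idx) Ev \<le> measure (iid idx) G"
    by (rule finite_measure.finite_measure_mono[OF prob_space.finite_measure[OF prob_space_iid] _ G])
  also have "\<dots> \<le> (3 * \<kappa> + 1 + 6 * k * (2 + 2 * k)) / sqrt y"
  proof -
    have sq: "0 < sqrt y" using y0 by simp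
    define u where "u = 1 / sqrt y"
    have u0: "0 < u" using sq by (simp add: u_def)
    have U: "measure (iid idx) {\<omega> \<in> space (iid idx). \<not> bounded_entries \<omega>} \<le> 3 * \<kappa> * u"
    proof -
      have "measure (iid idx) {\<omega> \<in> space (iid idx). \<not> bounded_entries \<omega>} \<le> 3 * m * b * b * (\<kappa> / (y powr (7 / 8)) ^ 4)"
        using y0 by (intro unbounded_probability large) auto
      also have "(y powr (7 / 8)) ^ 4 = y ^ 3 * sqrt y"
      proof -
        have "(y powr (7 / 8)) ^ 4 = (y powr (7 / 8)) powr (real 4)" using y0 by (intro powr_realpow[symmetric]) auto
        also have "\<dots> = y powr (3 + 1 / 2)" by (simp add: powr_powr)
        also have "\<dots> = y powr 3 * y powr (1 / 2)" by (rule powr_add)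
        also have "y powr 3 = y ^ 3" using y0 powr_realpow[of y 3] by simp
        finally show ?thesis using y0 by (simp add: powr_half_sqrt)
      qed
      also have "3 * m * b * b * (\<kappa> / (y ^ 3 * sqrt y)) \<le> 3 * y * y * y * (\<kappa> / (y ^ 3 * sqrt y))"
        using m \<kappa> y0 by (intro mult_right_mono) (auto simp: y_def)
      also have "\<dots> = 3 * \<kappa> * u" using y0 by (simp add: u_def power3_eq_cube)
      finally show ?thesis .
    qed
    have q\<theta>: "sqrt q \<le> \<theta>"
      using q powr_mono'[of "1 / 8" "1 / 2" q] by (simp add: \<theta>_def powr_half_sqrt)
    have SE: "spread_error \<le> 2 * y ^ 2 * \<theta> ^ b"
      unfolding spread_error_def y_def using q m sb ent[of b]
      by (intro spread_error_bound q\<theta>) (auto simp: s_def \<theta>_def)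
    have \<theta>b: "2 * y ^ 3 * \<theta> ^ b \<le> u" using D1 \<theta> by (simp add: u_def y_def \<theta>_def powr_realpow)
    have mSE: "m * spread_error \<le> u"
    proof -
      have "m * spread_error \<le> y * (2 * y ^ 2 * \<theta> ^ b)"
        using m SE spread_error_nonneg y0 \<theta> by (intro mult_mono) (auto simp: y_def)
      then show ?thesis using \<theta>b by (simp add: power2_eq_square power3_eq_cube mult_ac)
    qed
    have SEu: "spread_error \<le> u"
    proof -
      have "1 * spread_error \<le> m * spread_error" using m spread_error_nonneg by (intro mult_right_mono) auto
      then show ?thesis using mSE by simp
    qed
    have FE: "form_error \<le> 2 * k * u + u"
    proof -
      have "real s < real (t * k + k)"
        using dividend_less_div_times[of k s] k by (simp add: t_def add.commute del: of_nat_add of_nat_mult)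
      then have "real s < (real t + 1) * k" by (simp add: algebra_simps)
      then have "y / (2 * k) < (real t + 1) * k" using bs by linarith
      then have "y < (2 * real k * real k) * (real t + 1)" using k by (simp add: field_simps)
      also have "\<dots> \<le> (2 * real k)\<^sup>2 * (t / 2 + 1)" by (simp add: power2_eq_square algebra_simps)
      finally have "y \<le> (2 * real k)\<^sup>2 * (t / 2 + 1)" by simp
      then have "sqrt y \<le> 2 * k * sqrt (t / 2 + 1)"
        by (metis real_sqrt_le_iff real_sqrt_mult real_sqrt_abs abs_of_nat of_nat_mult of_nat_numeral)
      then have 1: "1 / sqrt (t / 2 + 1) \<le> 2 * k * u" using sq by (simp add: u_def field_simps)
      \<comment> \<open>The binomial coefficient is enlarged to fit the entropy bound, which is
        stated for triples and is used here with \<open>s\<close> in place of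
        \<open>b\<close>.\<close>
      have "real (s choose t) * q ^ (s - t) \<le> real ((3 * s) choose t) * q ^ (s - t)"
        using q by (intro mult_right_mono of_nat_mono binomial_right_mono) auto
      also have "\<dots> \<le> \<theta> ^ s" using ent[of s] by (simp add: t_def \<theta>_def)
      also have "\<dots> = \<theta> powr s" using \<theta> by (simp add: powr_realpow)
      also have "\<dots> \<le> \<theta> powr (y / (2 * k))" using \<theta> bs by (intro powr_mono') auto
      also have "\<dots> \<le> u" using D2 by (simp add: \<theta>_def y_def u_def)
      finally show ?thesis using 1 by (simp add: form_error_def)
    qed
    have "3 * b / s * (spread_error + form_error) \<le> 6 * k * (u + (2 * k * u + u))"
    proof (rule mult_mono)
      have "y \<le> 2 * k * s" using bs k by (simp add: field_simps)
      then show "3 * b / s \<le> 6 * k" using s1 by (simp add: y_def field_simps)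
    qed (use SEu FE spread_error_nonneg form_error_nonneg in auto)
    also have "\<dots> = 6 * k * (2 + 2 * k) * u" by (simp add: algebra_simps)
    finally have "measure (iid idx) G \<le> (3 * \<kappa> + 1 + 6 * k * (2 + 2 * k)) * u"
      using PG U mSE by (simp add: distrib_right)
    then show ?thesis by (simp add: u_def)
  qed
  finally show ?thesis by (simp add: Ev_def c_def y_def)
qed

theorem theorem2p1:
  fixes \<epsilon> C K' :: real
  assumes "\<epsilon> > 0" and "K' > 0" and "C > 0"
  shows "\<exists>m0::nat. \<exists>C\<^sub>\<xi>::real.
    \<forall>(\<mu>::complex measure) (b::nat) (m::nat) (z::complex).
      prob_space \<mu> \<and> sets \<mu> = sets borel \<and>
      integrable \<mu> (\<lambda>x. x) \<and> (\<integral>x. x \<partial>\<mu>) = 0 \<and>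
      (\<integral>\<^sup>+ x. ennreal ((cmod x)\<^sup>2) \<partial>\<mu>) = 1 \<and>
      (\<integral>\<^sup>+ x. ennreal (cmod x powr (4 + \<epsilon>)) \<partial>\<mu>) \<le> ennreal C \<and>
      m0 \<le> m \<and> m \<le> b \<and> cmod z \<le> K'
      \<longrightarrow>
      measure (PiM (band_index m b) (\<lambda>_. \<mu>))
        {\<omega> \<in> space (PiM (band_index m b) (\<lambda>_. \<mu>)).
           smallest_singular_value
             ((1 / complex_of_real (sqrt (real (3*b)))) \<cdot>\<^sub>m band_matrix m b \<omega>
               - z \<cdot>\<^sub>m 1\<^sub>m (m*b))
           \<le> real (3*b) powr (- 25 * real m)}
      \<le> C\<^sub>\<xi> / sqrt (real (3*b))"
proof -
  \<comment> \<open>All constants are fixed before the law, the sizes and \<open>z\<close>: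
    \<open>q\<close> depends on \<open>C\<close> only, \<open>k\<close> on \<open>q\<close>, and
    \<open>Y\<close> on \<open>q\<close>, \<open>k\<close> and \<open>K'\<close>.\<close>
  define \<kappa> where "\<kappa> = 1 + C"
  define q where "q = 1 - 1 / (16 * \<kappa>)"
  have \<kappa>: "1 \<le> \<kappa>" using \<open>C > 0\<close> by (simp add: \<kappa>_def)
  have q: "0 < q" "q < 1" using \<kappa> by (auto simp: q_def divide_less_eq)
  obtain k where k: "2 \<le> k" and ent: "\<And>n. real ((3 * n) choose (n div k)) * q ^ (n - n div k) \<le> (q powr (1 / 8)) ^ n"
    using binomial_entropy[OF q] by blast
  define a where "a = - ln q / 8"
  have a: "0 < a" using q by (simp add: a_def)
  have \<theta>: "(q powr (1 / 8)) powr x = exp (- a * x)" for x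
    using q by (simp add: powr_def a_def)
  define a' where "a' = a / (2 * k)"
  have a': "0 < a'" using a k by (simp add: a'_def)
  have "\<forall>\<^sub>F y :: real in at_top. K' * sqrt (3 * y) \<le> y powr (7 / 8)" by real_asymp
  moreover have "\<forall>\<^sub>F y :: real in at_top. 2 * (1 + 6 * y ^ 3 * (2 * y powr (7 / 8))) \<le> y ^ 4" by real_asymp
  moreover have "\<forall>\<^sub>F y :: real in at_top.
    1 + 6 * y ^ 4 * (2 * y * (2 + 2 * y ^ 3 * (2 * y powr (7 / 8)))) * (2 * y powr (7 / 8)) \<le> y ^ 10" by real_asymp
  moreover have "\<forall>\<^sub>F y :: real in at_top. y * (1 / y ^ 12 + 3 * y * ((2 * y powr (7 / 8)) * (1 / y ^ 4))) < 1 / 2" by real_asymp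
  moreover have "\<forall>\<^sub>F y :: real in at_top. 2 * y ^ 3 * exp (- a * y) \<le> 1 / sqrt y" using a by real_asymp
  moreover have "\<forall>\<^sub>F y :: real in at_top. exp (- a' * y) \<le> 1 / sqrt y" using a' by real_asymp
  ultimately have "\<forall>\<^sub>F y :: real in at_top. K' * sqrt (3 * y) \<le> y powr (7 / 8) \<and>
      2 * (1 + 6 * y ^ 3 * (2 * y powr (7 / 8))) \<le> y ^ 4 \<and>
      1 + 6 * y ^ 4 * (2 * y * (2 + 2 * y ^ 3 * (2 * y powr (7 / 8)))) * (2 * y powr (7 / 8)) \<le> y ^ 10 \<and>
      y * (1 / y ^ 12 + 3 * y * ((2 * y powr (7 / 8)) * (1 / y ^ 4))) < 1 / 2 \<and>
      2 * y ^ 3 * exp (- a * y) \<le> 1 / sqrt y \<and> exp (- a' * y) \<le> 1 / sqrt y"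
    by eventually_elim simp
  then obtain Y :: real where Y: "\<And>y. Y \<le> y \<Longrightarrow> K' * sqrt (3 * y) \<le> y powr (7 / 8) \<and>
      2 * (1 + 6 * y ^ 3 * (2 * y powr (7 / 8))) \<le> y ^ 4 \<and>
      1 + 6 * y ^ 4 * (2 * y * (2 + 2 * y ^ 3 * (2 * y powr (7 / 8)))) * (2 * y powr (7 / 8)) \<le> y ^ 10 \<and>
      y * (1 / y ^ 12 + 3 * y * ((2 * y powr (7 / 8)) * (1 / y ^ 4))) < 1 / 2 \<and>
      2 * y ^ 3 * exp (- a * y) \<le> 1 / sqrt y \<and> exp (- a' * y) \<le> 1 / sqrt y"
    unfolding eventually_at_top_linorder by blast
  \<comment> \<open>A lower bound on \<open>m\<close> is also one on \<open>b\<close>.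
    \<open>Y\<close> serves the asymptotic inequalities, 25 the final exponent, and
    \<open>2 * k * k\<close> ensures that rounding in \<open>b div k\<close> costs at most a factor
    2.\<close>
  define m0 where "m0 = max (nat \<lceil>Y\<rceil>) (max 25 (2 * k * k))"
  \<comment> \<open>The summands stand for the truncation, the failure of spreading for some row
    block, and the averaged column events; the factor \<open>sqrt 3\<close> used with it passes from
    \<open>b\<close> to \<open>3 * b\<close>.\<close>
  define C1 where "C1 = 3 * \<kappa> + 1 + 6 * k * (2 + 2 * k)"
  show ?thesis
  proof (intro exI[of _ m0] exI[of _ "sqrt 3 * C1"] allI impI, elim conjE)
    fix \<mu> :: "complex measure" and b m :: nat and z :: complex
    assume ps: "prob_space \<mu>" and sets: "sets \<mu> = sets borel"
      and int1: "integrable \<mu> (\<lambda>x. x)" and mean: "(\<integral>x. x \<partial>\<mu>) = 0"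
      and var: "(\<integral>\<^sup>+ x. ennreal ((cmod x)\<^sup>2) \<partial>\<mu>) = 1"
      and mom: "(\<integral>\<^sup>+ x. ennreal (cmod x powr (4 + \<epsilon>)) \<partial>\<mu>) \<le> ennreal C"
      and m: "m0 \<le> m" and mb: "m \<le> b" and z: "cmod z \<le> K'"
    have int4: "integrable \<mu> (\<lambda>x. cmod x ^ 4)" and mom4: "(\<integral>x. cmod x ^ 4 \<partial>\<mu>) \<le> \<kappa>"
      using fourth_moment[OF ps sets \<open>\<epsilon> > 0\<close> \<open>C > 0\<close> mom] by (auto simp: \<kappa>_def)
    have conc: "measure \<mu> (ball x (1 / 2)) \<le> q" for x
      unfolding q_def by (rule small_ball_atom[OF ps sets \<kappa> int1 mean var int4 mom4])
    have large: "measure \<mu> {x. \<Lambda> < cmod x} \<le> \<kappa> / \<Lambda> ^ 4" if "0 < \<Lambda>" for \<Lambda>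
      by (rule large_atom[OF ps sets that int4 mom4])
    have m25: "25 \<le> m" and kb: "2 * k * k \<le> b" and Yb: "Y \<le> real b"
      using m mb by (auto simp: m0_def)
    note Yb' = Y[OF Yb]
    have D2: "(q powr (1 / 8)) powr (real b / (2 * k)) \<le> 1 / sqrt (real b)"
      using Yb' unfolding \<theta> a'_def by simp
    have "measure (PiM (band_index m b) (\<lambda>_. \<mu>))
        {\<omega> \<in> space (PiM (band_index m b) (\<lambda>_. \<mu>)).
           smallest_singular_value
             ((1 / complex_of_real (sqrt (real (3*b)))) \<cdot>\<^sub>m band_matrix m b \<omega> - z \<cdot>\<^sub>m 1\<^sub>m (m*b))
           \<le> real (3*b) powr (- 25 * real m)} \<le> C1 / sqrt (real b)"
      unfolding C1_def
      by (rule band_instance[where K' = K' and q = q and \<kappa> = \<kappa> and k = k, OF ps sets conc q large _ k ent m25 mb kb z _ _ _ _ _ D2])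
        (use Yb' \<kappa> in \<open>simp_all add: \<theta>\<close>)
    also have "C1 / sqrt (real b) = sqrt 3 * C1 / sqrt (real (3 * b))" by (simp add: real_sqrt_mult)
    finally show "measure (PiM (band_index m b) (\<lambda>_. \<mu>))
        {\<omega> \<in> space (PiM (band_index m b) (\<lambda>_. \<mu>)).
           smallest_singular_value
             ((1 / complex_of_real (sqrt (real (3*b)))) \<cdot>\<^sub>m band_matrix m b \<omega> - z \<cdot>\<^sub>m 1\<^sub>m (m*b))
           \<le> real (3*b) powr (- 25 * real m)} \<le> sqrt 3 * C1 / sqrt (real (3 * b))" .
  qed
qed

end
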